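(* Let $H$ be a Hopf algebra over a field $F$ of characteristic $0$ and let $L$ be a finite dimensional $H$-comodule Lie algebra over $F$ with solvable radical $R$. Suppose $R$ is an $H$-subcomodule of $L$ and there exists an $\mathrm{ad}$-invariant left integral $t\in H^*$ such that $t(1)=1$. Then there exists a maximal semisimple subalgebra $B$ of $L$ such that $L=B\oplus R$ is a direct sum of $H$-subcomodules.
   Context: Here $H$ may be infinite dimensional, $H^*=\mathrm{Hom}_F(H,F)$, and Sweedler notation is used: $\Delta(a)=a_{(1)}\otimes a_{(2)}$ for the comultiplication; $\varepsilon$ and $S$ are the counit and antipode of $H$. An element $t\in H^*$ is a left integral on $H$ if $t(a_{(2)})a_{(1)}=t(a)1$ for all $a\in H$. A left integral $t$ is $\mathrm{ad}$-invariant if $t(a_{(1)}\,b\,S(a_{(2)}))=\varepsilon(a)t(b)$ for all $a,b\in H$. A Lie algebra $L$ over $F$ that is a right $H$-comodule via $\rho\colon L\to L\otimes H$, $\rho(a)=a_{(0)}\otimes a_{(1)}$, is an $H$-comodule Lie algebra if $\rho([a,b])=[a_{(0)},b_{(0)}]\otimes a_{(1)}b_{(1)}$ for all $a,b\in L$. A subspace $W\subseteq L$ is an $H$-subcomodule ($H$-coinvariant) if $\rho(W)\subseteq W\otimes H$. The solvable radical is the largest solvable ideal of $L$. *)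

theory Defs
  imports Complex_Main "HOL-Library.Poly_Mapping"
begin

section \<open>Tensor products\<close>

text \<open>
  The tensor product of two vector spaces over \<open>'f\<close> is the free vector space
  \<open>('a \<times> 'b) \<Rightarrow>\<^sub>0 'f\<close> of finitely supported formal sums of pairs, modulo the subspace generated
  by the bilinearity relations; threefold products are treated in the same way.
  As the scalar multiplications are terms, the quotient is not formed as a type: elements of the
  tensor product are represented by formal sums, and equality in the tensor product is the relation
  \<open>tensor_eq\<close> (respectively \<open>tensor3_eq\<close>). A map into the tensor product is given by a choice of
  representatives, and all equations about it are imposed modulo this relation only.
\<close>

definition fscale :: "'f::field \<Rightarrow> ('k \<Rightarrow>\<^sub>0 'f) \<Rightarrow> ('k \<Rightarrow>\<^sub>0 'f)"
  where "fscale c x = Poly_Mapping.map ((*) c) x"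

abbreviation pure :: "'k \<Rightarrow> ('k \<Rightarrow>\<^sub>0 'f::field)"
  where "pure k \<equiv> Poly_Mapping.single k 1"

lemma lookup_fscale [simp]: "Poly_Mapping.lookup (fscale c x) k = c * Poly_Mapping.lookup x k"
  by (simp add: fscale_def Poly_Mapping.map.rep_eq when_def)

lemma vector_space_fscale: "vector_space fscale"
  by unfold_locales (auto intro!: poly_mapping_eqI simp: lookup_add algebra_simps)

text \<open>The linear extension of a map \<open>g\<close> on generators to formal sums.\<close>

definition lin_ext :: "('f::field \<Rightarrow> 'm::ab_group_add \<Rightarrow> 'm) \<Rightarrow> ('k \<Rightarrow> 'm) \<Rightarrow> ('k \<Rightarrow>\<^sub>0 'f) \<Rightarrow> 'm"
  where "lin_ext s g x = (\<Sum>k\<in>Poly_Mapping.keys x. s (Poly_Mapping.lookup x k) (g k))"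

definition tensor_relations ::
    "('f::field \<Rightarrow> 'a::ab_group_add \<Rightarrow> 'a) \<Rightarrow> ('f \<Rightarrow> 'b::ab_group_add \<Rightarrow> 'b) \<Rightarrow> ('a \<times> 'b \<Rightarrow>\<^sub>0 'f) set"
  where "tensor_relations s1 s2 =
    {pure (a + a', b) - pure (a, b) - pure (a', b) | a a' b. True} \<union>
    {pure (a, b + b') - pure (a, b) - pure (a, b') | a b b'. True} \<union>
    {pure (s1 c a, b) - fscale c (pure (a, b)) | c a b. True} \<union>
    {pure (a, s2 c b) - fscale c (pure (a, b)) | c a b. True}"

definition tensor_eq ::
    "('f::field \<Rightarrow> 'a::ab_group_add \<Rightarrow> 'a) \<Rightarrow> ('f \<Rightarrow> 'b::ab_group_add \<Rightarrow> 'b) \<Rightarrow>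
     ('a \<times> 'b \<Rightarrow>\<^sub>0 'f) \<Rightarrow> ('a \<times> 'b \<Rightarrow>\<^sub>0 'f) \<Rightarrow> bool"
  where "tensor_eq s1 s2 x y \<longleftrightarrow> x - y \<in> module.span fscale (tensor_relations s1 s2)"

definition tensor3_relations ::
    "('f::field \<Rightarrow> 'a::ab_group_add \<Rightarrow> 'a) \<Rightarrow> ('f \<Rightarrow> 'b::ab_group_add \<Rightarrow> 'b) \<Rightarrow>
     ('f \<Rightarrow> 'c::ab_group_add \<Rightarrow> 'c) \<Rightarrow> ('a \<times> 'b \<times> 'c \<Rightarrow>\<^sub>0 'f) set"
  where "tensor3_relations s1 s2 s3 =
    {pure (a + a', b, c) - pure (a, b, c) - pure (a', b, c) | a a' b c. True} \<union>
    {pure (a, b + b', c) - pure (a, b, c) - pure (a, b', c) | a b b' c. True} \<union>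
    {pure (a, b, c + c') - pure (a, b, c) - pure (a, b, c') | a b c c'. True} \<union>
    {pure (s1 r a, b, c) - fscale r (pure (a, b, c)) | r a b c. True} \<union>
    {pure (a, s2 r b, c) - fscale r (pure (a, b, c)) | r a b c. True} \<union>
    {pure (a, b, s3 r c) - fscale r (pure (a, b, c)) | r a b c. True}"

definition tensor3_eq ::
    "('f::field \<Rightarrow> 'a::ab_group_add \<Rightarrow> 'a) \<Rightarrow> ('f \<Rightarrow> 'b::ab_group_add \<Rightarrow> 'b) \<Rightarrow>
     ('f \<Rightarrow> 'c::ab_group_add \<Rightarrow> 'c) \<Rightarrow>
     ('a \<times> 'b \<times> 'c \<Rightarrow>\<^sub>0 'f) \<Rightarrow> ('a \<times> 'b \<times> 'c \<Rightarrow>\<^sub>0 'f) \<Rightarrow> bool"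
  where "tensor3_eq s1 s2 s3 x y \<longleftrightarrow> x - y \<in> module.span fscale (tensor3_relations s1 s2 s3)"

definition linear_into_tensor ::
    "('f::field \<Rightarrow> 'm::ab_group_add \<Rightarrow> 'm) \<Rightarrow> ('f \<Rightarrow> 'a::ab_group_add \<Rightarrow> 'a) \<Rightarrow>
     ('f \<Rightarrow> 'b::ab_group_add \<Rightarrow> 'b) \<Rightarrow> ('m \<Rightarrow> ('a \<times> 'b \<Rightarrow>\<^sub>0 'f)) \<Rightarrow> bool"
  where "linear_into_tensor s s1 s2 \<phi> \<longleftrightarrow>
    (\<forall>u v. tensor_eq s1 s2 (\<phi> (u + v)) (\<phi> u + \<phi> v)) \<and>
    (\<forall>c u. tensor_eq s1 s2 (\<phi> (s c u)) (fscale c (\<phi> u)))"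

text \<open>\<open>\<phi> \<otimes> id\<close> and \<open>id \<otimes> \<phi>\<close> for \<open>\<phi>\<close> with values in a tensor product; the triple products are
  identified by the associativity isomorphism.\<close>

definition tensor_left :: "('m \<Rightarrow> ('a \<times> 'b \<Rightarrow>\<^sub>0 'f)) \<Rightarrow> ('m \<times> 'n \<Rightarrow>\<^sub>0 'f) \<Rightarrow> ('a \<times> 'b \<times> 'n \<Rightarrow>\<^sub>0 'f::field)"
  where "tensor_left \<phi> =
    lin_ext fscale (\<lambda>(m, n). lin_ext fscale (\<lambda>(a, b). pure (a, b, n)) (\<phi> m))"

definition tensor_right :: "('n \<Rightarrow> ('a \<times> 'b \<Rightarrow>\<^sub>0 'f)) \<Rightarrow> ('m \<times> 'n \<Rightarrow>\<^sub>0 'f) \<Rightarrow> ('m \<times> 'a \<times> 'b \<Rightarrow>\<^sub>0 'f::field)"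
  where "tensor_right \<phi> =
    lin_ext fscale (\<lambda>(m, n). lin_ext fscale (\<lambda>(a, b). pure (m, a, b)) (\<phi> n))"

text \<open>The product \<open>(a \<otimes> b)(a' \<otimes> b') = f a a' \<otimes> g b b'\<close> induced by bilinear products \<open>f\<close> and \<open>g\<close>.\<close>

definition tensor_product_mult ::
    "('a \<Rightarrow> 'a \<Rightarrow> 'a) \<Rightarrow> ('b \<Rightarrow> 'b \<Rightarrow> 'b) \<Rightarrow>
     ('a \<times> 'b \<Rightarrow>\<^sub>0 'f) \<Rightarrow> ('a \<times> 'b \<Rightarrow>\<^sub>0 'f) \<Rightarrow> ('a \<times> 'b \<Rightarrow>\<^sub>0 'f::field)"
  where "tensor_product_mult f g x y =
    lin_ext fscale (\<lambda>(a, b). lin_ext fscale (\<lambda>(a', b'). pure (f a a', g b b')) y) x"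

lemma lin_ext_superset:
  assumes "vector_space s" "finite A" "Poly_Mapping.keys x \<subseteq> A"
  shows "lin_ext s g x = (\<Sum>k\<in>A. s (Poly_Mapping.lookup x k) (g k))"
proof -
  interpret vector_space s by fact
  show ?thesis
    unfolding lin_ext_def
    by (rule sum.mono_neutral_left) (use assms in \<open>auto simp: in_keys_iff\<close>)
qed

lemma linear_lin_ext:
  fixes s :: "'f::field \<Rightarrow> 'm::ab_group_add \<Rightarrow> 'm" and g :: "'k \<Rightarrow> 'm"
  assumes "vector_space s"
  shows "Vector_Spaces.linear fscale s (lin_ext s g)"
proof -
  interpret V: vector_space s by fact
  interpret W: vector_space fscale by (rule vector_space_fscale)
  show ?thesis
  proof
    fix x y :: "'k \<Rightarrow>\<^sub>0 'f"
    let ?A = "Poly_Mapping.keys x \<union> Poly_Mapping.keys y"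
    have "Poly_Mapping.keys (x + y) \<subseteq> ?A"
      by (rule Poly_Mapping.keys_add)
    then show "lin_ext s g (x + y) = lin_ext s g x + lin_ext s g y"
      by (simp add: lin_ext_superset[OF assms, of ?A] lookup_add V.scale_left_distrib sum.distrib)
  next
    fix c and x :: "'k \<Rightarrow>\<^sub>0 'f"
    let ?A = "Poly_Mapping.keys x"
    have "Poly_Mapping.keys (fscale c x) \<subseteq> ?A"
      by (auto simp: in_keys_iff)
    then show "lin_ext s g (fscale c x) = s c (lin_ext s g x)"
      by (simp add: lin_ext_superset[OF assms, of ?A] V.scale_sum_right)
  qed
qed

text \<open>Linear extensions of bilinear maps do not depend on the chosen representative, so that the
  formulas in Sweedler notation below are well defined.\<close>

lemma lin_ext_tensor_eq:
  assumes "vector_space s"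
    and "\<And>a a' b. g (a + a', b) = g (a, b) + g (a', b)"
    and "\<And>a b b'. g (a, b + b') = g (a, b) + g (a, b')"
    and "\<And>c a b. g (s1 c a, b) = s c (g (a, b))"
    and "\<And>c a b. g (a, s2 c b) = s c (g (a, b))"
    and "tensor_eq s1 s2 x y"
  shows "lin_ext s g x = lin_ext s g y"
proof -
  interpret L: Vector_Spaces.linear fscale s "lin_ext s g"
    by (rule linear_lin_ext) fact
  have pure: "lin_ext s g (pure k) = g k" for k
    by (simp add: lin_ext_def)
  have "lin_ext s g r = 0" if "r \<in> tensor_relations s1 s2" for r
    using that assms(2-5)
    by (auto simp: tensor_relations_def L.diff L.scale pure)
  then have "lin_ext s g (x - y) = 0"
    using assms(6) unfolding tensor_eq_def by (rule L.eq_0_on_span)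
  then show ?thesis by (simp add: L.diff)
qed


section \<open>Hopf algebras\<close>

locale unital_algebra = vector_space scale
  for scale :: "'f::field \<Rightarrow> 'h::ring_1 \<Rightarrow> 'h" +
  assumes scale_mult_left: "scale c (a * b) = scale c a * b"
    and scale_mult_right: "scale c (a * b) = a * scale c b"

locale coalgebra = vector_space scale
  for scale :: "'f::field \<Rightarrow> 'h::ab_group_add \<Rightarrow> 'h"
    and \<Delta> :: "'h \<Rightarrow> ('h \<times> 'h \<Rightarrow>\<^sub>0 'f)" and \<epsilon> :: "'h \<Rightarrow> 'f" +
  assumes comult_linear: "linear_into_tensor scale scale scale \<Delta>"
    and counit_linear: "Vector_Spaces.linear scale (*) \<epsilon>"
    and coassoc: "tensor3_eq scale scale scale (tensor_left \<Delta> (\<Delta> a)) (tensor_right \<Delta> (\<Delta> a))"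
    and counit_left: "lin_ext scale (\<lambda>(a1, a2). scale (\<epsilon> a1) a2) (\<Delta> a) = a"
    and counit_right: "lin_ext scale (\<lambda>(a1, a2). scale (\<epsilon> a2) a1) (\<Delta> a) = a"

locale bialgebra = unital_algebra scale + coalgebra scale \<Delta> \<epsilon>
  for scale :: "'f::field \<Rightarrow> 'h::ring_1 \<Rightarrow> 'h"
    and \<Delta> :: "'h \<Rightarrow> ('h \<times> 'h \<Rightarrow>\<^sub>0 'f)" and \<epsilon> :: "'h \<Rightarrow> 'f" +
  assumes comult_mult:
      "tensor_eq scale scale (\<Delta> (a * b)) (tensor_product_mult (*) (*) (\<Delta> a) (\<Delta> b))"
    and comult_one: "tensor_eq scale scale (\<Delta> 1) (pure (1, 1))"
    and counit_mult: "\<epsilon> (a * b) = \<epsilon> a * \<epsilon> b"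
    and counit_one: "\<epsilon> 1 = 1"

locale hopf_algebra = bialgebra scale \<Delta> \<epsilon>
  for scale :: "'f::field \<Rightarrow> 'h::ring_1 \<Rightarrow> 'h"
    and \<Delta> :: "'h \<Rightarrow> ('h \<times> 'h \<Rightarrow>\<^sub>0 'f)" and \<epsilon> :: "'h \<Rightarrow> 'f" and S :: "'h \<Rightarrow> 'h" +
  assumes antipode_linear: "Vector_Spaces.linear scale scale S"
    and antipode_left: "lin_ext scale (\<lambda>(a1, a2). S a1 * a2) (\<Delta> a) = scale (\<epsilon> a) 1"
    and antipode_right: "lin_ext scale (\<lambda>(a1, a2). a1 * S a2) (\<Delta> a) = scale (\<epsilon> a) 1"
begin

definition left_integral :: "('h \<Rightarrow> 'f) \<Rightarrow> bool"
  where "left_integral t \<longleftrightarrow> Vector_Spaces.linear scale (*) t \<and>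
    (\<forall>a. lin_ext scale (\<lambda>(a1, a2). scale (t a2) a1) (\<Delta> a) = scale (t a) 1)"

definition ad_invariant :: "('h \<Rightarrow> 'f) \<Rightarrow> bool"
  where "ad_invariant t \<longleftrightarrow>
    (\<forall>a b. t (lin_ext scale (\<lambda>(a1, a2). a1 * b * S a2) (\<Delta> a)) = \<epsilon> a * t b)"

end


section \<open>Lie algebras\<close>

locale lie_algebra = vector_space scale
  for scale :: "'f::field \<Rightarrow> 'l::ab_group_add \<Rightarrow> 'l" and bracket :: "'l \<Rightarrow> 'l \<Rightarrow> 'l" +
  assumes bracket_linear_left: "Vector_Spaces.linear scale scale (\<lambda>x. bracket x y)"
    and bracket_linear_right: "Vector_Spaces.linear scale scale (\<lambda>y. bracket x y)"
    and bracket_self: "bracket x x = 0"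
    and jacobi: "bracket x (bracket y z) + bracket y (bracket z x) + bracket z (bracket x y) = 0"
begin

definition subalgebra :: "'l set \<Rightarrow> bool"
  where "subalgebra A \<longleftrightarrow> subspace A \<and> (\<forall>x\<in>A. \<forall>y\<in>A. bracket x y \<in> A)"

definition ideal_of :: "'l set \<Rightarrow> 'l set \<Rightarrow> bool"
  where "ideal_of A I \<longleftrightarrow> I \<subseteq> A \<and> subspace I \<and> (\<forall>x\<in>A. \<forall>y\<in>I. bracket x y \<in> I)"

primrec derived_series :: "'l set \<Rightarrow> nat \<Rightarrow> 'l set"
  where
    "derived_series A 0 = A"
  | "derived_series A (Suc n) =
      span {bracket x y | x y. x \<in> derived_series A n \<and> y \<in> derived_series A n}"

definition solvable :: "'l set \<Rightarrow> bool"
  where "solvable A \<longleftrightarrow> (\<exists>n. derived_series A n = {0})"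

definition solvable_radical_of :: "'l set \<Rightarrow> 'l set \<Rightarrow> bool"
  where "solvable_radical_of A R \<longleftrightarrow> ideal_of A R \<and> solvable R \<and>
    (\<forall>I. ideal_of A I \<and> solvable I \<longrightarrow> I \<subseteq> R)"

text \<open>Semisimple means that the solvable radical vanishes; in particular \<open>{0}\<close> is semisimple.\<close>

definition semisimple_subalgebra :: "'l set \<Rightarrow> bool"
  where "semisimple_subalgebra B \<longleftrightarrow> subalgebra B \<and> solvable_radical_of B {0}"

definition maximal_semisimple_subalgebra :: "'l set \<Rightarrow> bool"
  where "maximal_semisimple_subalgebra B \<longleftrightarrow> semisimple_subalgebra B \<and>
    (\<forall>C. semisimple_subalgebra C \<and> B \<subseteq> C \<longrightarrow> C = B)"

end


section \<open>Comodules and comodule Lie algebras\<close>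

locale right_comodule =
  H: coalgebra scaleH \<Delta> \<epsilon> + M: vector_space scaleM
  for scaleH :: "'f::field \<Rightarrow> 'h::ab_group_add \<Rightarrow> 'h"
    and \<Delta> :: "'h \<Rightarrow> ('h \<times> 'h \<Rightarrow>\<^sub>0 'f)" and \<epsilon> :: "'h \<Rightarrow> 'f"
    and scaleM :: "'f \<Rightarrow> 'm::ab_group_add \<Rightarrow> 'm"
    and \<rho> :: "'m \<Rightarrow> ('m \<times> 'h \<Rightarrow>\<^sub>0 'f)" +
  assumes coaction_linear: "linear_into_tensor scaleM scaleM scaleH \<rho>"
    and coaction_coassoc:
      "tensor3_eq scaleM scaleH scaleH (tensor_left \<rho> (\<rho> m)) (tensor_right \<Delta> (\<rho> m))"
    and coaction_counit: "lin_ext scaleM (\<lambda>(m0, m1). scaleM (\<epsilon> m1) m0) (\<rho> m) = m"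
begin

text \<open>\<open>\<rho> w\<close> lies in the image of \<open>W \<otimes> H\<close> iff it is represented by a formal sum of pairs whose
  first components are in \<open>W\<close>.\<close>

definition subcomodule :: "'m set \<Rightarrow> bool"
  where "subcomodule W \<longleftrightarrow> M.subspace W \<and>
    (\<forall>w\<in>W. \<exists>x. Poly_Mapping.keys x \<subseteq> W \<times> UNIV \<and> tensor_eq scaleM scaleH (\<rho> w) x)"

end

locale comodule_lie_algebra =
  H: hopf_algebra scaleH \<Delta> \<epsilon> S +
  L: lie_algebra scaleL bracket +
  right_comodule scaleH \<Delta> \<epsilon> scaleL \<rho>
  for scaleH :: "'f::field \<Rightarrow> 'h::ring_1 \<Rightarrow> 'h"
    and \<Delta> :: "'h \<Rightarrow> ('h \<times> 'h \<Rightarrow>\<^sub>0 'f)" and \<epsilon> :: "'h \<Rightarrow> 'f" and S :: "'h \<Rightarrow> 'h"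
    and scaleL :: "'f \<Rightarrow> 'l::ab_group_add \<Rightarrow> 'l" and bracket :: "'l \<Rightarrow> 'l \<Rightarrow> 'l"
    and \<rho> :: "'l \<Rightarrow> ('l \<times> 'h \<Rightarrow>\<^sub>0 'f)" +
  assumes coaction_bracket:
    "tensor_eq scaleL scaleH (\<rho> (bracket a b)) (tensor_product_mult bracket (*) (\<rho> a) (\<rho> b))"

end

theory Submission
  imports Defs "HOL-Algebra.Algebraic_Closure_Type"
begin

text \<open>
  Let \<open>A\<close> be a subalgebra with \<open>A + R = L\<close> whose intersection \<open>J\<close> with \<open>R\<close> is a term of the derived
  series of \<open>R\<close>, and let \<open>J' = [J, J]\<close>. By Levi's theorem for the abelian kernel \<open>J / J'\<close> there is a
  linear map \<open>p : A \<rightarrow> J\<close> that is the identity on \<open>J\<close> and a derivation, both modulo \<open>J'\<close>. These are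
  linear conditions on \<open>p\<close>, and they survive the averaging
  \<open>x \<mapsto> t(p(x_(0))_(1) S(x_(1))) p(x_(0))_(0)\<close>: the derivation property because \<open>t\<close> is
  \<open>ad\<close>-invariant, the identity on \<open>J\<close> because \<open>t 1 = 1\<close>. As \<open>t\<close> is a left integral, the average is
  colinear, so \<open>{x \<in> A. p x \<in> J'}\<close> is a coinvariant subalgebra that meets \<open>R\<close> in \<open>J'\<close>. Iterating along
  the derived series reaches \<open>B \<inter> R = {0}\<close>.

  Levi's theorem itself rests on Cartan's criterion. A linear operator that is a sum of commutators
  and has vanishing trace form with them is nilpotent (this uses the eigenvalues in the algebraic
  closure), so by Engel's theorem a Lie algebra with vanishing trace form is solvable. Hence the
  Killing form of \<open>A / J\<close> is nondegenerate, and Casimir operators yield the map \<open>p\<close>.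
\<close>

section \<open>The ring of additive endomorphisms\<close>

text \<open>Levi complements do not form a linear family, so a complement itself cannot be averaged.
  Over an abelian kernel they are described by maps \<open>p\<close> subject to linear conditions;
  this is why the proof descends along the derived series of \<open>R\<close>, whose terms inherit
  coinvariance from \<open>R\<close> because the coaction is multiplicative. The antipode reverses
  factors. In the average of \<open>p [x, y]\<close> the factors from \<open>y\<close> therefore
  meet and cancel by the antipode axiom, whereas those from \<open>x\<close> enclose the rest; they
  are removed by ad-invariance. \<open>H\<close> may be infinite dimensional but \<open>L\<close> is
  not, so the coaction is read as a matrix over \<open>H\<close> and Sweedler identities become
  matrix identities. Quotients are not formed: \<open>A / J\<close> and \<open>J / J'\<close> live
  on complements, cut out by idempotents \<open>q\<close> and \<open>u\<close>, and equations hold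
  modulo \<open>J\<close> or \<open>J'\<close>. The ground field has neither enough eigenvalues nor
  an order. Eigenvalues come from the algebraic closure, positivity from additive functionals with
  rational values.\<close>

typedef (overloaded) 'a endo = "{f :: 'a::ab_group_add \<Rightarrow> 'a. \<forall>x y. f (x + y) = f x + f y}"
  morphisms app Endo
  by (rule exI[of _ "\<lambda>x. x"]) auto

notation app (infixr "\<bullet>" 68)

setup_lifting type_definition_endo

instantiation endo :: (ab_group_add) ring
begin
lift_definition zero_endo :: "'a endo" is "\<lambda>_. 0" by simp
lift_definition plus_endo :: "'a endo \<Rightarrow> 'a endo \<Rightarrow> 'a endo" is "\<lambda>f g x. f x + g x"
  by (simp add: algebra_simps)
lift_definition minus_endo :: "'a endo \<Rightarrow> 'a endo \<Rightarrow> 'a endo" is "\<lambda>f g x. f x - g x"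
  by (simp add: algebra_simps)
lift_definition uminus_endo :: "'a endo \<Rightarrow> 'a endo" is "\<lambda>f x. - f x"
  by (simp add: algebra_simps)
lift_definition times_endo :: "'a endo \<Rightarrow> 'a endo \<Rightarrow> 'a endo" is "\<lambda>f g x. f (g x)"
  by simp
instance
  by standard (transfer; simp add: algebra_simps)+
end

text \<open>The maps are only additive because the scalar multiplication is a term and cannot enter
  the type; linearity is the predicate \<open>lin\<close>. The unit is a separate instance since
  \<open>ring_1\<close> demands \<open>0 \<noteq> 1\<close>, which fails on the zero group.\<close>

instantiation endo :: (ab_group_add) monoid_mult
begin
lift_definition one_endo :: "'a endo" is "\<lambda>x. x" by simp
instance by standard (transfer; simp)+
end

lemma app_zero_endo [simp]: "0 \<bullet> x = 0" by transfer simp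
lemma app_one [simp]: "1 \<bullet> x = x" by transfer simp
lemma app_plus_endo [simp]: "(f + g) \<bullet> x = f \<bullet> x + g \<bullet> x" by transfer simp
lemma app_minus_endo [simp]: "(f - g) \<bullet> x = f \<bullet> x - g \<bullet> x" by transfer simp
lemma app_uminus_endo [simp]: "(- f) \<bullet> x = - (f \<bullet> x)" by transfer simp
lemma app_times [simp]: "f * g \<bullet> x = f \<bullet> g \<bullet> x" by transfer simp
lemma app_add [simp]: "f \<bullet> (x + y) = f \<bullet> x + f \<bullet> y" by transfer simp

lemma additive_app: "Modules.additive (app f)"
  by (simp add: Modules.additive_def)

lemma app_0 [simp]: "f \<bullet> 0 = 0"
  using additive_app by (rule Modules.additive.zero)
lemma app_neg [simp]: "f \<bullet> (- x) = - (f \<bullet> x)"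
  using additive_app by (rule Modules.additive.minus)
lemma app_diff [simp]: "f \<bullet> (x - y) = f \<bullet> x - f \<bullet> y"
  using additive_app by (rule Modules.additive.diff)
lemma app_sum: "f \<bullet> (\<Sum>i\<in>I. x i) = (\<Sum>i\<in>I. f \<bullet> x i)"
  using additive_app by (rule Modules.additive.sum)
lemma app_sum_endo: "(\<Sum>i\<in>I. f i) \<bullet> x = (\<Sum>i\<in>I. f i \<bullet> x)"
  by (induction I rule: infinite_finite_induct) auto

lemma endo_eqI: "(\<And>x. f \<bullet> x = g \<bullet> x) \<Longrightarrow> f = g"
  by transfer auto

lemma app_Endo: "(\<And>x y. f (x + y) = f x + f y) \<Longrightarrow> Endo f \<bullet> x = f x"
  by (subst Endo_inverse) auto

lemma commute_power:
  fixes f g :: "'r::monoid_mult"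
  assumes "f * g = g * f"
  shows "f ^ n * g = g * f ^ n"
  by (induction n) (simp_all add: mult.assoc, metis assms mult.assoc)

text \<open>A copy of \<open>vector_space\<close>: definitions made there directly would be re-exported by the
  global interpretation for real vector spaces.\<close>

locale vspace = vector_space scale
  for scale :: "'a::field \<Rightarrow> 'b::ab_group_add \<Rightarrow> 'b" (infixr \<open>*s\<close> 75)
begin

definition lin :: "'b endo \<Rightarrow> bool"
  where "lin f \<longleftrightarrow> (\<forall>c x. f \<bullet> (c *s x) = c *s (f \<bullet> x))"

definition scl :: "'a \<Rightarrow> 'b endo"
  where "scl c = Endo (\<lambda>x. c *s x)"

lemma app_scl [simp]: "scl c \<bullet> x = c *s x"
  unfolding scl_def by (rule app_Endo) (simp add: scale_right_distrib)

lemma lin_scale: "lin f \<Longrightarrow> f \<bullet> (c *s x) = c *s (f \<bullet> x)"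
  by (simp add: lin_def)

lemma scl_add: "scl (a + b) = scl a + scl b"
  and scl_mult: "scl (a * b) = scl a * scl b"
  and scl_0 [simp]: "scl 0 = 0"
  and scl_1 [simp]: "scl 1 = 1"
  by (rule endo_eqI; simp add: scale_left_distrib)+

text \<open>Makes linearity a ring identity, so that scalars move through products of operators by
  rewriting.\<close>

lemma lin_commute: "lin f \<longleftrightarrow> (\<forall>c. f * scl c = scl c * f)"
proof
  assume "lin f" then show "\<forall>c. f * scl c = scl c * f"
    by (auto intro!: endo_eqI simp: lin_scale)
next
  assume *: "\<forall>c. f * scl c = scl c * f"
  show "lin f" unfolding lin_def
  proof (intro allI)
    fix c x
    have "f * scl c \<bullet> x = scl c * f \<bullet> x" using * by simp
    then show "f \<bullet> (c *s x) = c *s (f \<bullet> x)" by simp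
  qed
qed

lemma lin_Endo: "Vector_Spaces.linear scale scale f \<Longrightarrow> lin (Endo f)"
  and app_Endo_linear: "Vector_Spaces.linear scale scale f \<Longrightarrow> Endo f \<bullet> x = f x"
proof -
  assume "Vector_Spaces.linear scale scale f"
  then interpret Vector_Spaces.linear scale scale f .
  have *: "Endo f \<bullet> x = f x" for x by (rule app_Endo) (rule add)
  then show "lin (Endo f)" by (simp add: lin_def scale)
  show "Endo f \<bullet> x = f x" by (rule *)
qed

lemma lin_zero [simp]: "lin 0" and lin_one [simp]: "lin 1" and lin_scl [simp]: "lin (scl c)"
  by (auto simp: lin_def mult.commute)

lemma lin_plus [simp]: "lin f \<Longrightarrow> lin g \<Longrightarrow> lin (f + g)"
  and lin_minus [simp]: "lin f \<Longrightarrow> lin g \<Longrightarrow> lin (f - g)"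
  and lin_uminus [simp]: "lin f \<Longrightarrow> lin (- f)"
  and lin_times [simp]: "lin f \<Longrightarrow> lin g \<Longrightarrow> lin (f * g)"
  by (auto simp: lin_def scale_right_distrib scale_right_diff_distrib)

lemma lin_power [simp]: "lin f \<Longrightarrow> lin (f ^ n)"
  by (induction n) auto

lemma lin_sum: "(\<And>i. i \<in> I \<Longrightarrow> lin (f i)) \<Longrightarrow> lin (\<Sum>i\<in>I. f i)"
  by (induction I rule: infinite_finite_induct) auto

lemma span_closed_app:
  assumes "lin f" "\<And>x. x \<in> S \<Longrightarrow> f \<bullet> x \<in> W" "subspace W" "x \<in> span S"
  shows "f \<bullet> x \<in> W"
proof -
  have "subspace {x. f \<bullet> x \<in> W}"
    using assms(1,3) by (auto simp: subspace_def lin_scale)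
  then have "span S \<subseteq> {x. f \<bullet> x \<in> W}"
    by (intro span_minimal) (use assms(2) in auto)
  with assms(4) show ?thesis by auto
qed

lemma subspace_image_app:
  shows "lin f \<Longrightarrow> subspace W \<Longrightarrow> subspace (app f ` W)"
proof -
  assume f: "lin f" and W: "subspace W"
  show ?thesis
  proof (rule subspaceI)
    show "0 \<in> app f ` W" using subspace_0[OF W] by (rule rev_image_eqI) simp
    show "x + y \<in> app f ` W" if xy: "x \<in> app f ` W" "y \<in> app f ` W" for x y
    proof -
      from xy obtain a b where "a \<in> W" "b \<in> W" "x = f \<bullet> a" "y = f \<bullet> b" by auto
      then show ?thesis by (intro rev_image_eqI[of "a + b"] subspace_add[OF W]) auto
    qed
    show "c *s x \<in> app f ` W" if x: "x \<in> app f ` W" for c x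
    proof -
      from x obtain a where "a \<in> W" "x = f \<bullet> a" by auto
      then show ?thesis using f by (intro rev_image_eqI[of "c *s a"] subspace_scale[OF W]) (auto simp: lin_scale)
    qed
  qed
qed

subsection \<open>Polynomials in an endomorphism\<close>

text \<open>Horner scheme with the coefficients inserted as scalar operators. Multiplicativity in
  the polynomial rests on \<open>lin x\<close>, since \<open>x\<close> has to pass the
  coefficients.\<close>

definition peval :: "'a poly \<Rightarrow> 'b endo \<Rightarrow> 'b endo"
  where "peval p x = fold_coeffs (\<lambda>a e. scl a + x * e) p 0"

lemma peval_0 [simp]: "peval 0 x = 0"
  by (simp add: peval_def)

lemma peval_pCons [simp]: "peval (pCons a p) x = scl a + x * peval p x"
  by (cases "p = 0 \<and> a = 0") (auto simp: peval_def)

lemma peval_1 [simp]: "peval 1 x = 1"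
  by (simp add: one_pCons)

lemma peval_add: "peval (p + q) x = peval p x + peval q x"
proof (induction p arbitrary: q)
  case (pCons a p)
  show ?case by (cases q) (simp add: pCons.IH scl_add distrib_left add.assoc add.left_commute)
qed simp

lemma lin_peval [simp]: "lin x \<Longrightarrow> lin (peval p x)"
  by (induction p) auto

lemma peval_smult: "lin x \<Longrightarrow> peval (smult c p) x = scl c * peval p x"
proof (induction p)
  case (pCons a p)
  have "x * (scl c * y) = scl c * (x * y)" for y
    using \<open>lin x\<close> unfolding lin_commute by (metis mult.assoc)
  then show ?case using pCons by (simp add: scl_mult distrib_left)
qed simp

lemma peval_mult: "lin x \<Longrightarrow> peval (p * q) x = peval p x * peval q x"
  by (induction p) (auto simp: peval_add peval_smult distrib_right mult.assoc)

lemma peval_diff: "lin x \<Longrightarrow> peval (p - q) x = peval p x - peval q x"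
  using peval_add[of "p - q" q x] by simp

lemma peval_power: "lin x \<Longrightarrow> peval (p ^ n) x = peval p x ^ n"
  by (induction n) (auto simp: peval_mult)

lemma peval_sum: "peval (\<Sum>i\<in>I. p i) x = (\<Sum>i\<in>I. peval (p i) x)"
  by (induction I rule: infinite_finite_induct) (auto simp: peval_add)

lemma peval_commute:
  assumes "lin y" "y * x = x * y"
  shows "y * peval p x = peval p x * y"
proof (induction p)
  case (pCons a p)
  have "y * (x * peval p x) = x * (y * peval p x)"
    by (metis assms(2) mult.assoc)
  then show ?case
    using assms(1) by (simp add: lin_commute pCons.IH algebra_simps)
qed simp

lemma peval_eq_sum: "n \<ge> degree p \<Longrightarrow> lin x \<Longrightarrow> peval p x \<bullet> v = (\<Sum>i\<le>n. coeff p i *s (x ^ i \<bullet> v))"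
proof (induction p arbitrary: n)
  case (pCons a p)
  show ?case
  proof (cases n)
    case 0
    then have "p = 0" using pCons.prems by (auto split: if_splits)
    then show ?thesis using 0 by simp
  next
    case (Suc m)
    then have "degree p \<le> m" using pCons.prems by (auto split: if_splits)
    then have "peval p x \<bullet> v = (\<Sum>i\<le>m. coeff p i *s (x ^ i \<bullet> v))"
      using pCons by blast
    then have "peval (pCons a p) x \<bullet> v = a *s v + (\<Sum>i\<le>m. coeff p i *s (x ^ Suc i \<bullet> v))"
      using pCons.prems by (simp add: app_sum lin_scale)
    then show ?thesis
      unfolding Suc by (simp add: sum.atMost_Suc_shift del: sum.atMost_Suc)
  qed
qed simp

text \<open>The idempotent \<open>c * peval d c\<close> projects onto the Fitting component on which
  \<open>c\<close> is invertible, and \<open>peval d c\<close> is the inverse there. Writing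
  \<open>p = X^a * q\<close> with \<open>q(0) \<noteq> 0\<close>, the equation
  \<open>p(c) = 0\<close> says that some polynomial \<open>r\<close> in \<open>c\<close> inverts
  \<open>c\<close> on the range of \<open>c ^ a\<close>.\<close>

lemma fitting:
  assumes "lin c" "p \<noteq> 0" "peval p c = 0"
  obtains d b where "c * peval d c * (c * peval d c) = c * peval d c"
    "c ^ b * (1 - c * peval d c) = 0"
proof -
  obtain q where q: "p = [:-0, 1:] ^ order 0 p * q" "\<not> [:-0, 1:] dvd q"
    using order_decomp[OF assms(2)] by blast
  define a where "a = order 0 p"
  obtain q0 q' where qq: "q = pCons q0 q'" by (cases q)
  have "q0 \<noteq> 0" using q(2) qq by (auto simp: dvd_def)
  \<comment> \<open>Chosen such that \<open>1 - X * s\<close> is \<open>q\<close> divided by its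
    constant term \<open>q0\<close>.\<close>
  define s where "s = smult (- inverse q0) q'"
  define r where "r = peval s c"
  have cr: "c * r = r * c"
    unfolding r_def by (rule peval_commute) (use assms in auto)
  have "c ^ a * (scl q0 + c * peval q' c) = 0"
  proof -
    have "peval p c = peval ([:0, 1:] ^ a * q) c" using q(1) by (simp add: a_def)
    also have "\<dots> = c ^ a * (scl q0 + c * peval q' c)"
      unfolding peval_mult[OF assms(1)] peval_power[OF assms(1)] qq by simp
    finally show ?thesis using assms(3) by simp
  qed
  then have "scl (inverse q0) * (c ^ a * (scl q0 + c * peval q' c)) = 0" by simp
  moreover have "scl (inverse q0) * (c ^ a * (scl q0 + c * peval q' c)) = c ^ a - c ^ a * c * r"
  proof -
    have 1: "scl (inverse q0) * (c ^ a * y) = c ^ a * (scl (inverse q0) * y)" for y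
      using lin_power[OF assms(1), of a] unfolding lin_commute by (metis mult.assoc)
    have 2: "scl (inverse q0) * (c * y) = c * (scl (inverse q0) * y)" for y
      using assms(1) unfolding lin_commute by (metis mult.assoc)
    have 3: "scl (inverse q0) * scl q0 = 1"
      using \<open>q0 \<noteq> 0\<close> by (simp flip: scl_mult)
    have 4: "scl (- inverse q0) = - scl (inverse q0)"
      by (rule endo_eqI) simp
    show ?thesis
      unfolding r_def s_def peval_smult[OF assms(1)] 1
      by (simp add: algebra_simps 2 3 4)
  qed
  ultimately have step: "c ^ a = c ^ a * c * r" by simp
  \<comment> \<open>At least 1, so that a factor \<open>c\<close> can be split off from
    \<open>(c * r) ^ b\<close> even when \<open>a = 0\<close>.\<close>
  define b where "b = Suc a"
  have cb: "c ^ b = c ^ b * (c * r)"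
  proof -
    have "c ^ b = c * c ^ a" by (simp add: b_def)
    also have "\<dots> = c * (c ^ a * c * r)" using step by simp
    also have "\<dots> = c ^ b * (c * r)" by (simp add: b_def mult.assoc)
    finally show ?thesis .
  qed
  have cbj: "c ^ b = c ^ b * (c * r) ^ j" for j
    by (induction j) (simp, metis cb mult.assoc power_Suc2)
  have pow: "(c * r) ^ j = c ^ j * r ^ j" for j
  proof (induction j)
    case (Suc j)
    have "(c * r) ^ Suc j = c * r * (c ^ j * r ^ j)" using Suc by simp
    also have "\<dots> = c * (r * c ^ j) * r ^ j" by (simp add: mult.assoc)
    also have "r * c ^ j = c ^ j * r" using commute_power[OF cr] by simp
    finally show ?case by (simp add: mult.assoc)
  qed simp
  define d where "d = [:0, 1:] ^ a * s ^ b"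
  have d: "c * peval d c = (c * r) ^ b"
    using assms(1) unfolding pow b_def unfolding d_def b_def r_def
    by (simp add: peval_mult peval_power mult.assoc)
  have "(c * r) ^ b * (c * r) ^ b = (c * r) ^ b"
  proof -
    have "(c * r) ^ b * (c * r) ^ b = c ^ b * (r ^ b * c ^ b) * r ^ b" by (simp add: pow mult.assoc)
    also have "r ^ b * c ^ b = c ^ b * r ^ b"
      by (metis commute_power cr)
    also have "c ^ b * (c ^ b * r ^ b) * r ^ b = c ^ b * r ^ b"
      using cbj[of b] by (simp add: pow)
    finally show ?thesis by (simp add: pow)
  qed
  moreover have "c ^ b * (1 - (c * r) ^ b) = 0"
    using cbj[of b] by (simp add: algebra_simps)
  ultimately show thesis by (intro that[of d b]) (simp_all add: d)
qed

subsection \<open>The trace\<close>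

text \<open>Relative to a basis of a subspace: traces are compared on invariant subspaces, and after
  extension of scalars the ambient space is larger than the one of interest.\<close>

definition trace_on :: "'b set \<Rightarrow> 'b endo \<Rightarrow> 'a"
  where "trace_on C f = (\<Sum>c\<in>C. representation C (f \<bullet> c) c)"

definition maps_span :: "'b set \<Rightarrow> 'b endo \<Rightarrow> bool"
  where "maps_span C f \<longleftrightarrow> lin f \<and> (\<forall>v\<in>span C. f \<bullet> v \<in> span C)"

lemma maps_span_lin: "maps_span C f \<Longrightarrow> lin f"
  by (simp add: maps_span_def)

lemma maps_span_plus [simp]: "maps_span C f \<Longrightarrow> maps_span C g \<Longrightarrow> maps_span C (f + g)"
  and maps_span_minus [simp]: "maps_span C f \<Longrightarrow> maps_span C g \<Longrightarrow> maps_span C (f - g)"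
  and maps_span_times [simp]: "maps_span C f \<Longrightarrow> maps_span C g \<Longrightarrow> maps_span C (f * g)"
  and maps_span_scl [simp]: "maps_span C (scl c)"
  and maps_span_one [simp]: "maps_span C 1"
  and maps_span_zero [simp]: "maps_span C 0"
  by (auto simp: maps_span_def span_add span_diff span_scale span_zero)

lemma maps_span_sum: "(\<And>i. i \<in> I \<Longrightarrow> maps_span C (f i)) \<Longrightarrow> maps_span C (\<Sum>i\<in>I. f i)"
  by (induction I rule: infinite_finite_induct) auto

lemma maps_span_peval [simp]: "maps_span C x \<Longrightarrow> maps_span C (peval p x)"
  by (induction p) auto

lemma representation_app:
  assumes C: "finite C" "independent C" and D: "finite D" "independent D"
    and f: "lin f" "\<And>b. b \<in> D \<Longrightarrow> f \<bullet> b \<in> span C" and v: "v \<in> span D"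
  shows "representation C (f \<bullet> v) c = (\<Sum>b\<in>D. representation D v b * representation C (f \<bullet> b) c)"
proof -
  have "f \<bullet> v = f \<bullet> (\<Sum>b\<in>D. representation D v b *s b)"
    using sum_representation_eq[OF D(2) v D(1)] by simp
  also have "\<dots> = (\<Sum>b\<in>D. representation D v b *s (f \<bullet> b))"
    using f(1) by (simp add: app_sum lin_scale)
  finally show ?thesis
    using f(2) C(2) by (simp add: representation_sum representation_scale span_scale)
qed

text \<open>An instance of \<open>tr (f g) = tr (g f)\<close> with \<open>g\<close> the inclusion of
  \<open>span D\<close>: expanding \<open>f \<bullet> c\<close> in \<open>D\<close> and
  \<open>d\<close> in \<open>C\<close> gives the same double sum for both traces.\<close>

lemma trace_sub:
  assumes C: "finite C" "independent C" and D: "finite D" "independent D" "D \<subseteq> span C"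
    and f: "lin f" "\<And>v. v \<in> span C \<Longrightarrow> f \<bullet> v \<in> span D"
  shows "trace_on C f = trace_on D f"
proof -
  have sDC: "span D \<subseteq> span C" using D(3) by (rule span_minimal) simp
  have "trace_on C f = (\<Sum>c\<in>C. \<Sum>d\<in>D. representation D (f \<bullet> c) d * representation C d c)"
  proof (unfold trace_on_def, rule sum.cong)
    fix c assume "c \<in> C"
    then have "f \<bullet> c \<in> span D" by (simp add: f span_base)
    then show "representation C (f \<bullet> c) c = (\<Sum>d\<in>D. representation D (f \<bullet> c) d * representation C d c)"
      using representation_app[OF C D(1,2), of 1 "f \<bullet> c" c] D(3) by auto
  qed simp
  also have "\<dots> = (\<Sum>d\<in>D. \<Sum>c\<in>C. representation C d c * representation D (f \<bullet> c) d)"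
    by (subst sum.swap) (simp add: mult.commute)
  also have "\<dots> = trace_on D f"
  proof (unfold trace_on_def, rule sum.cong)
    fix d assume "d \<in> D"
    then show "(\<Sum>c\<in>C. representation C d c * representation D (f \<bullet> c) d) = representation D (f \<bullet> d) d"
      using representation_app[OF D(1,2) C, of f d d] f D(3) by (auto simp: span_base)
  qed simp
  finally show ?thesis .
qed

lemma trace_cyclic:
  assumes C: "finite C" "independent C" and f: "maps_span C f" "maps_span C g"
  shows "trace_on C (f * g) = trace_on C (g * f)"
proof -
  have *: "trace_on C (f * g) = (\<Sum>c\<in>C. \<Sum>b\<in>C. representation C (g \<bullet> c) b * representation C (f \<bullet> b) c)"
    if "maps_span C f" "maps_span C g" for f g
    unfolding trace_on_def
  proof (rule sum.cong)
    fix c assume "c \<in> C"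
    then have "g \<bullet> c \<in> span C" using that by (simp add: maps_span_def span_base)
    then show "representation C (f * g \<bullet> c) c = (\<Sum>b\<in>C. representation C (g \<bullet> c) b * representation C (f \<bullet> b) c)"
      using representation_app[OF C C, of f "g \<bullet> c" c] that by (simp add: maps_span_def span_base)
  qed simp
  show ?thesis
    unfolding *[OF f] *[OF f(2,1)] by (subst sum.swap) (simp add: mult.commute)
qed

lemma trace_add:
  assumes "independent C" "maps_span C f" "maps_span C g"
  shows "trace_on C (f + g) = trace_on C f + trace_on C g"
  using assms by (simp add: trace_on_def maps_span_def span_base representation_add sum.distrib)

lemma trace_scl:
  assumes "independent C" "maps_span C f"
  shows "trace_on C (scl a * f) = a * trace_on C f"
  using assms by (simp add: trace_on_def maps_span_def span_base representation_scale sum_distrib_left)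

lemma trace_zero [simp]: "independent C \<Longrightarrow> trace_on C 0 = 0"
  by (simp add: trace_on_def representation_zero)

lemma trace_diff:
  assumes "independent C" "maps_span C f" "maps_span C g"
  shows "trace_on C (f - g) = trace_on C f - trace_on C g"
  using trace_add[of C "f - g" g] assms by simp

lemma trace_sum:
  assumes "independent C" "\<And>i. i \<in> I \<Longrightarrow> maps_span C (f i)"
  shows "trace_on C (\<Sum>i\<in>I. f i) = (\<Sum>i\<in>I. trace_on C (f i))"
  using assms(2)
  by (induction I rule: infinite_finite_induct) (auto simp: assms(1) trace_add maps_span_sum)

lemma finite_basis_in_span:
  assumes "finite C" "subspace W" "W \<subseteq> span C"
  obtains D where "finite D" "independent D" "span D = W"
proof -
  obtain D where D: "D \<subseteq> W" "independent D" "W \<subseteq> span D"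
    using basis_exists[of W] by metis
  moreover have "finite D"
    using independent_span_bound[OF assms(1) D(2)] D(1) assms(3) by auto
  moreover have "span D = W"
    using D assms(2) span_subspace by blast
  ultimately show thesis using that by blast
qed

text \<open>By \<open>trace_sub\<close> the trace may be computed on the image of \<open>f\<close>,
  where a smaller power already vanishes.\<close>

lemma trace_nilpotent:
  assumes "finite C" "independent C" "maps_span C f" "\<And>v. v \<in> span C \<Longrightarrow> f ^ m \<bullet> v = 0"
  shows "trace_on C f = 0"
  using assms
proof (induction m arbitrary: C)
  case 0
  then have "C \<subseteq> {0}" using span_superset by auto
  moreover have "0 \<notin> C" using 0(2) dependent_zero by blast
  ultimately have "C = {}" by auto
  then show ?case by (simp add: trace_on_def)
next
  case (Suc m)
  have lin: "lin f" using Suc.prems(3) by (simp add: maps_span_def)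
  let ?W = "app f ` span C"
  have W: "?W \<subseteq> span C" using Suc.prems(3) by (auto simp: maps_span_def)
  obtain D where D: "finite D" "independent D" "span D = ?W"
    using finite_basis_in_span[OF Suc.prems(1) subspace_image_app[OF lin subspace_span] W] .
  have DC: "D \<subseteq> span C" using D(3) W span_superset by blast
  have "trace_on C f = trace_on D f"
    by (rule trace_sub[OF Suc.prems(1,2) D(1,2) DC lin]) (auto simp: D(3))
  also have "\<dots> = 0"
  proof (rule Suc.IH[OF D(1,2)])
    show "maps_span D f" unfolding maps_span_def D(3) using lin W by auto
    show "f ^ m \<bullet> v = 0" if "v \<in> span D" for v
      using that Suc.prems(4) unfolding D(3) power_Suc2 by auto
  qed
  finally show ?case .
qed

text \<open>On its range an idempotent is the identity, so the trace is the rank. The rank is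
  returned as a natural number because its sign enters a positivity argument later.\<close>

lemma trace_idempotent:
  assumes "finite C" "independent C" "maps_span C f" "f * f = f"
  obtains n where "trace_on C f = of_nat n" "n = 0 \<Longrightarrow> (\<And>v. v \<in> span C \<Longrightarrow> f \<bullet> v = 0)"
proof -
  have lin: "lin f" using assms(3) by (simp add: maps_span_def)
  let ?W = "app f ` span C"
  have W: "?W \<subseteq> span C" using assms(3) by (auto simp: maps_span_def)
  obtain D where D: "finite D" "independent D" "span D = ?W"
    using finite_basis_in_span[OF assms(1) subspace_image_app[OF lin subspace_span] W] .
  have DC: "D \<subseteq> span C" using D(3) W span_superset by blast
  have "trace_on C f = trace_on D f"
    by (rule trace_sub[OF assms(1,2) D(1,2) DC lin]) (auto simp: D(3))
  also have "\<dots> = (\<Sum>d\<in>D. 1)"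
    unfolding trace_on_def
  proof (rule sum.cong)
    fix d assume d: "d \<in> D"
    then obtain v where "d = f \<bullet> v" using D(3) span_base by blast
    then have "f \<bullet> d = d" using assms(4) by (metis app_times)
    then show "representation D (f \<bullet> d) d = 1"
      using representation_basis[OF D(2) d] by simp
  qed simp
  finally have "trace_on C f = of_nat (card D)" by simp
  moreover have "f \<bullet> v = 0" if "card D = 0" "v \<in> span C" for v
    using that D by auto
  ultimately show thesis using that by blast
qed

lemma peval_monom: "lin x \<Longrightarrow> peval (monom c n) x = scl c * x ^ n"
proof (induction n)
  case (Suc n)
  have "x * (scl c * y) = scl c * (x * y)" for y
    using \<open>lin x\<close> unfolding lin_commute by (metis mult.assoc)
  then show ?case using Suc by (simp add: monom_Suc)
qed (simp add: monom_0)

end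

section \<open>Annihilating polynomials in finite dimension\<close>

locale fd_vspace = vspace scale + finite_dimensional_vector_space scale Basis
  for scale :: "'a::field \<Rightarrow> 'b::ab_group_add \<Rightarrow> 'b" (infixr \<open>*s\<close> 75) and Basis
begin

lemma maps_Basis [simp]: "maps_span Basis f \<longleftrightarrow> lin f"
  by (simp add: maps_span_def span_Basis)

text \<open>The vectors \<open>f ^ k \<bullet> v\<close> with \<open>k \<le> card Basis\<close> are
  too many to be independent. Dependence speaks of sets, so a repetition among these vectors is
  treated apart, with \<open>X^i - X^j\<close>.\<close>

lemma annihilating_poly_at:
  assumes "lin f"
  obtains p where "p \<noteq> 0" "peval p f \<bullet> v = 0"
proof -
  let ?n = "card Basis" and ?s = "\<lambda>k. f ^ k \<bullet> v"
  show thesis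
  proof (cases "inj_on ?s {..?n}")
    case True
    then have card: "card (?s ` {..?n}) = Suc ?n" by (simp add: card_image)
    have "dependent (?s ` {..?n})"
    proof (rule ccontr)
      assume "independent (?s ` {..?n})"
      then have "card (?s ` {..?n}) \<le> card Basis"
        using independent_span_bound[OF finite_Basis] span_Basis by auto
      with card show False by simp
    qed
    then obtain u where u: "\<exists>w\<in>?s ` {..?n}. u w \<noteq> 0" "(\<Sum>w\<in>?s ` {..?n}. u w *s w) = 0"
      unfolding dependent_finite[OF finite_imageI[OF finite_atMost]] by blast
    define p where "p = (\<Sum>k\<le>?n. monom (u (?s k)) k)"
    have coeff: "coeff p k = (if k \<le> ?n then u (?s k) else 0)" for k
      unfolding p_def by (simp add: coeff_sum)
    have "degree p \<le> ?n" by (rule degree_le) (simp add: coeff)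
    then have "peval p f \<bullet> v = (\<Sum>k\<le>?n. u (?s k) *s ?s k)"
      using assms by (simp add: peval_eq_sum coeff)
    also have "\<dots> = 0" using u(2) by (simp add: sum.reindex[OF True])
    finally have "peval p f \<bullet> v = 0" .
    moreover have "p \<noteq> 0"
    proof -
      from u(1) obtain k where "k \<le> ?n" "u (?s k) \<noteq> 0" by auto
      then have "coeff p k \<noteq> 0" by (simp add: coeff)
      then show ?thesis by auto
    qed
    ultimately show thesis using that by blast
  next
    case False
    then obtain i j where ij: "?s i = ?s j" "i \<noteq> j" by (auto simp: inj_on_def)
    define p :: "'a poly" where "p = monom 1 i - monom 1 j"
    have "coeff p i = 1" using ij(2) by (simp add: p_def)
    then have "p \<noteq> 0" by auto
    moreover have "peval p f \<bullet> v = 0"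
      using assms ij(1) by (simp add: p_def peval_diff peval_monom)
    ultimately show thesis using that by blast
  qed
qed

lemma annihilating_poly:
  assumes "lin f"
  obtains p where "p \<noteq> 0" "peval p f = 0"
proof -
  obtain q where q: "\<And>b. q b \<noteq> 0" "\<And>b. peval (q b) f \<bullet> b = 0"
  proof -
    have "\<exists>p. p \<noteq> 0 \<and> peval p f \<bullet> b = 0" for b
      using annihilating_poly_at[OF assms, of b] by blast
    then show thesis using that by metis
  qed
  define p where "p = (\<Prod>b\<in>Basis. q b)"
  have "p \<noteq> 0" using q(1) finite_Basis by (simp add: p_def)
  moreover have "peval p f = 0"
  proof (rule endo_eqI)
    fix x
    have "peval p f \<bullet> x \<in> {0}"
    proof (rule span_closed_app)
      show "peval p f \<bullet> b \<in> {0}" if b: "b \<in> Basis" for b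
      proof -
        have "p = (\<Prod>b\<in>Basis - {b}. q b) * q b"
          unfolding p_def using prod.remove[OF finite_Basis b, of q] by (simp only: mult.commute)
        then show ?thesis using assms q(2)[of b] by (simp add: peval_mult)
      qed
      show "x \<in> span Basis" by (simp add: span_Basis)
    qed (use assms in auto)
    then show "peval p f \<bullet> x = 0 \<bullet> x" by simp
  qed
  ultimately show thesis by (rule that)
qed

end

section \<open>Nilpotency from vanishing traces\<close>

lemma bezout_prod:
  fixes p :: "'r::comm_ring_1"
  assumes "\<And>i. i \<in> I \<Longrightarrow> \<exists>u v. u * p + v * q i = 1"
  shows "\<exists>u v. u * p + v * prod q I = 1"
  using assms
proof (induction I rule: infinite_finite_induct)
  case (insert i I)
  then obtain u v u' v' where *: "u * p + v * q i = 1" "u' * p + v' * prod q I = 1" by blast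
  have "(u * u' * p + u * v' * prod q I + u' * v * q i) * p + (v * v') * (q i * prod q I)
      = (u * p + v * q i) * (u' * p + v' * prod q I)"
    by (simp add: algebra_simps)
  then show ?case using insert * by auto
qed (auto intro: exI[of _ 0] exI[of _ 1])

lemma bezout_linear_powers:
  fixes a b :: "'k::field"
  assumes "a \<noteq> b"
  shows "\<exists>u v. u * [:- a, 1:] ^ n + v * [:- b, 1:] ^ n = 1"
proof -
  have "inverse (b - a) * b - inverse (b - a) * a = 1"
    using assms by (simp flip: right_diff_distrib)
  then have "[: inverse (b - a) :] * [:- a, 1:] + [: - inverse (b - a) :] * [:- b, 1:] = 1"
    by (simp add: one_pCons mult.commute)
  then have "\<exists>u v. u * [:- a, 1:] + v * [:- b, 1:] = 1" by blast
  then have "\<exists>u v. u * [:- a, 1:] + v * [:- b, 1:] ^ n = 1"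
    using bezout_prod[of "{..<n}" "[:- a, 1:]" "\<lambda>_. [:- b, 1:]"] by auto
  then have "\<exists>u v. u * [:- b, 1:] ^ n + v * [:- a, 1:] = 1" by (metis add.commute)
  then have "\<exists>u v. u * [:- b, 1:] ^ n + v * [:- a, 1:] ^ n = 1"
    using bezout_prod[of "{..<n}" "[:- b, 1:] ^ n" "\<lambda>_. [:- a, 1:]"] by auto
  then show ?thesis by (metis add.commute)
qed

lemma bezout_linear_power_prod:
  fixes a :: "'k::field"
  assumes "a \<notin> A"
  shows "\<exists>u v. u * [:- a, 1:] ^ n + v * (\<Prod>b\<in>A. [:- b, 1:] ^ n) = 1"
  by (rule bezout_prod) (use assms bezout_linear_powers in metis)

lemma polynomial_crt:
  fixes A :: "'k::field set"
  assumes "finite A"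
  shows "\<exists>g. \<forall>a\<in>A. [:- a, 1:] ^ n dvd g - [:f a:]"
  using assms
proof (induction A rule: finite_induct)
  case (insert a A)
  then obtain g where g: "\<forall>a\<in>A. [:- a, 1:] ^ n dvd g - [:f a:]" by blast
  let ?P = "[:- a, 1:] ^ n" and ?Q = "\<Prod>b\<in>A. [:- b, 1:] ^ n"
  obtain u v where uv: "u * ?P + v * ?Q = 1"
    using bezout_linear_power_prod[OF insert(2), of n] by blast
  define h where "h = u * ?P * g + v * ?Q * [:f a:]"
  have "[:- b, 1:] ^ n dvd h - [:f b:]" if "b \<in> insert a A" for b
  proof (cases "b = a")
    case True
    have "v * ?Q = 1 - u * ?P" using uv by (simp add: algebra_simps)
    then have "h - [:f a:] = ?P * (u * (g - [:f a:]))" 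
      unfolding h_def by (simp only:) (simp add: algebra_simps)
    then show ?thesis using True by simp
  next
    case False
    with that have b: "b \<in> A" by simp
    have "u * ?P = 1 - v * ?Q" using uv by (simp add: algebra_simps)
    then have "h - [:f b:] = (g - [:f b:]) + ?Q * (v * ([:f a:] - g))"
      unfolding h_def by (simp only:) (simp add: algebra_simps)
    moreover have "[:- b, 1:] ^ n dvd ?Q" using b insert(1) by (rule dvd_prodI[rotated])
    ultimately show ?thesis using g b by (metis dvd_add dvd_mult2)
  qed
  then show ?case by blast
qed simp

lemma prod_linear_powers_dvd:
  fixes A :: "'k::field set"
  assumes "finite A" "\<And>a. a \<in> A \<Longrightarrow> [:- a, 1:] ^ n dvd p"
  shows "(\<Prod>a\<in>A. [:- a, 1:] ^ n) dvd p"
  using assms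
proof (induction A rule: finite_induct)
  case (insert a A)
  let ?P = "[:- a, 1:] ^ n" and ?Q = "\<Prod>b\<in>A. [:- b, 1:] ^ n"
  obtain u v where uv: "u * ?P + v * ?Q = 1"
    using bezout_linear_power_prod[OF insert(2), of n] by blast
  have "?P dvd p" "?Q dvd p" using insert by auto
  then have "?P * ?Q dvd p * (u * ?P) + p * (v * ?Q)"
    by (intro dvd_add) (auto simp: mult_ac intro: mult_dvd_mono)
  moreover have "p * (u * ?P) + p * (v * ?Q) = p"
    using uv by (simp flip: distrib_left)
  ultimately show ?case using insert by simp
qed simp

text \<open>Peeling off one factor \<open>u - v\<close> replaces \<open>w\<close> by
  \<open>u \<bullet> w\<close> or \<open>v \<bullet> w\<close>, and either choice shortens one of
  the two annihilation lengths. It is used for left and right multiplications, which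
  commute.\<close>

lemma diff_power_app_eq_0:
  fixes u v :: "'b::ab_group_add endo"
  assumes "u * v = v * u" "u ^ i \<bullet> w = 0" "v ^ j \<bullet> w = 0" "i + j \<le> n"
  shows "(u - v) ^ n \<bullet> w = 0"
  using assms(2-)
proof (induction n arbitrary: w i j)
  case (Suc n)
  have 1: "(u - v) ^ n \<bullet> u \<bullet> w = 0"
  proof (cases i)
    case (Suc i')
    show ?thesis
    proof (rule Suc.IH[of i' _ j])
      show "u ^ i' \<bullet> u \<bullet> w = 0" using Suc.prems(1) unfolding Suc power_Suc2 by simp
      show "v ^ j \<bullet> u \<bullet> w = 0"
        by (metis Suc.prems(2) app_0 app_times assms(1) commute_power)
    qed (use Suc Suc.prems in auto)
  qed (use Suc.prems in auto)
  have 2: "(u - v) ^ n \<bullet> v \<bullet> w = 0"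
  proof (cases j)
    case (Suc j')
    show ?thesis
    proof (rule Suc.IH[of i _ j'])
      show "v ^ j' \<bullet> v \<bullet> w = 0" using Suc.prems(2) unfolding Suc power_Suc2 by simp
      show "u ^ i \<bullet> v \<bullet> w = 0"
        by (metis Suc.prems(1) app_0 app_times assms(1) commute_power)
    qed (use Suc Suc.prems in auto)
  qed (use Suc.prems in auto)
  show ?case using 1 2 by (simp add: power_Suc2 del: power_Suc)
qed simp

text \<open>The field is seen as a rational vector space, in which \<open>{l}\<close> is
  independent. The functional carries an equation in an unordered field over to the rationals, where
  squares are nonnegative.\<close>

lemma rational_functional:
  fixes l :: "'k::field_char_0"
  assumes "l \<noteq> 0"
  obtains \<phi> :: "'k \<Rightarrow> rat" where "\<And>x y. \<phi> (x + y) = \<phi> x + \<phi> y" "\<And>q x. \<phi> (of_rat q * x) = q * \<phi> x" "\<phi> l = 1"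
proof -
  interpret vector_space_pair "\<lambda>q (x::'k). of_rat q * x" "(*) :: rat \<Rightarrow> rat \<Rightarrow> rat"
    by unfold_locales (auto simp: algebra_simps of_rat_add of_rat_mult)
  obtain g where g: "Vector_Spaces.linear (\<lambda>q (x::'k). of_rat q * x) ((*) :: rat \<Rightarrow> rat \<Rightarrow> rat) g"
      "\<forall>x\<in>{l}. g x = 1"
    using linear_independent_extend[of "{l}" "\<lambda>_. 1"] assms by auto
  interpret g: Vector_Spaces.linear "\<lambda>q (x::'k). of_rat q * x" "(*) :: rat \<Rightarrow> rat \<Rightarrow> rat" g
    by (rule g(1))
  show thesis by (rule that[of g]) (use g(2) in \<open>auto simp: g.add g.scale\<close>)
qed

definition comm :: "'r::ring \<Rightarrow> 'r \<Rightarrow> 'r"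
  where "comm x b = x * b - b * x"

text \<open>Operators on operators. With them \<open>ad x\<close> is the element
  \<open>lmul x - rmul x\<close> of an endomorphism ring, and polynomials in it make sense.\<close>

definition lmul :: "'r::ring \<Rightarrow> 'r endo" where "lmul x = Endo (\<lambda>b. x * b)"
definition rmul :: "'r::ring \<Rightarrow> 'r endo" where "rmul x = Endo (\<lambda>b. b * x)"

lemma app_lmul [simp]: "lmul x \<bullet> b = x * b"
  unfolding lmul_def by (rule app_Endo) (simp add: distrib_left)
lemma app_rmul [simp]: "rmul x \<bullet> b = b * x"
  unfolding rmul_def by (rule app_Endo) (simp add: distrib_right)

lemma lmul_power: "lmul (x :: 'r::{ring,monoid_mult}) ^ n \<bullet> b = x ^ n * b"
  by (induction n) (auto simp: mult.assoc)
lemma rmul_power: "rmul (x :: 'r::{ring,monoid_mult}) ^ n \<bullet> b = b * x ^ n"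
proof (induction n arbitrary: b)
  case (Suc n)
  show ?case unfolding power_Suc2[of "rmul x"] power_Suc[of x] by (simp add: Suc mult.assoc)
qed simp

lemma app_comm_power: "(lmul x - rmul x) ^ k \<bullet> b = (comm x ^^ k) b"
  by (induction k) (auto simp: comm_def)

context vspace
begin

text \<open>Lets \<open>peval\<close> be applied one level up, to \<open>ad x\<close>. The space
  contains all additive maps, also nonlinear ones, so statements about \<open>ad x\<close> on an
  operator still have to require its linearity.\<close>

lemma vspace_endo: "vspace (\<lambda>c f. scl c * f)"
  by unfold_locales (auto simp: distrib_left distrib_right scl_add scl_mult mult.assoc)

end


lemma prod_mset_linear_dvd:
  fixes A :: "'k::field multiset"
  assumes "size A \<le> n"
  shows "(\<Prod>x\<in>#A. [:- x, 1:]) dvd (\<Prod>x\<in>set_mset A. [:- x, 1:] ^ n)"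
proof -
  have "(\<Prod>x\<in>#A. [:- x, 1:]) = (\<Prod>x\<in>set_mset A. [:- x, 1:] ^ count A x)"
    by (simp add: image_prod_mset_multiplicity)
  also have "\<dots> dvd (\<Prod>x\<in>set_mset A. [:- x, 1:] ^ n)"
    by (rule prod_dvd_prod) (meson assms count_le_size le_imp_power_dvd le_trans)
  finally show ?thesis .
qed

text \<open>With \<open>e l\<close> the projection onto the generalised eigenspace of \<open>x\<close> for \<open>l\<close> and \<open>\<phi>\<close> additive
  with rational values, \<open>y = \<Sum>l. \<phi> l \<cdot> e l\<close> satisfies \<open>comm y b = g(ad x) b\<close> for a polynomial \<open>g\<close>,
  so \<open>tr (x y) = \<Sum>l. l * \<phi> l * tr (e l) = 0\<close>. Applying \<open>\<phi>\<close> makes this a sum of squares.\<close>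

theorem nilpotent_if_traces_vanish_alg_closed:
  fixes scale :: "'k::{alg_closed_field, field_char_0} \<Rightarrow> 'b::ab_group_add \<Rightarrow> 'b"
    and x E :: "'b endo" and a b :: "'i \<Rightarrow> 'b endo"
  assumes V: "vspace scale"
    and C: "finite C" "module.independent scale C"
    and mE: "vspace.maps_span scale C E" and mx: "vspace.maps_span scale C x"
    and ma: "\<And>i. i \<in> I \<Longrightarrow> vspace.maps_span scale C (a i)"
    and mb: "\<And>i. i \<in> I \<Longrightarrow> vspace.maps_span scale C (b i)"
    and E: "E * E = E" "E * x = x" "x * E = x"
    and Eab: "\<And>i. i \<in> I \<Longrightarrow> E * b i = b i" "\<And>i. i \<in> I \<Longrightarrow> b i * E = b i"
    and EC: "\<And>v. v \<in> module.span scale C \<Longrightarrow> E \<bullet> v = v"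
    and EV: "\<And>v. E \<bullet> v \<in> module.span scale C"
    and m: "m \<noteq> 0" "vspace.peval scale m x * E = 0"
    and x: "x = (\<Sum>i\<in>I. comm (a i) (b i))"
    and tr: "\<And>i k. i \<in> I \<Longrightarrow> vspace.trace_on scale C (a i * (comm x ^^ k) (b i)) = 0"
  shows "\<exists>n. x ^ n * E = 0"
proof -
  interpret vspace scale by (rule V)
  let ?s = "\<lambda>c f. scl c * f"
  interpret En: vspace ?s by (rule vspace_endo)
  have lE: "lin E" and lx: "lin x" using mE mx by (auto dest: maps_span_lin)
  let ?ad = "lmul x - rmul x"
  have lad: "En.lin ?ad"
  proof -
    have "x * (scl c * y) = scl c * (x * y)" for c y
      using lx unfolding lin_commute by (metis mult.assoc)
    then show ?thesis by (simp add: En.lin_def right_diff_distrib mult.assoc)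
  qed
  obtain A where A: "m = smult (lead_coeff m) (\<Prod>z\<in>#A. [:- z, 1:])"
    using alg_closed_imp_factorization[OF m(1)] by blast
  \<comment> \<open>Bounds all multiplicities of roots of \<open>m\<close>; the successor keeps it
    positive for constant \<open>m\<close>.\<close>
  define n where "n = Suc (size A)"
  \<comment> \<open>Zero is included even if it is no root, so that the component \<open>e 0\<close>
    exists; it is the one that survives at the end.\<close>
  define L where "L = insert 0 (set_mset A)"
  have finL: "finite L" by (simp add: L_def)
  define P where "P = (\<Prod>z\<in>L. [:- z, 1:] ^ n)"
  have "m dvd P"
  proof -
    have "(\<Prod>z\<in>#A. [:- z, 1:]) dvd (\<Prod>z\<in>set_mset A. [:- z, 1:] ^ n)"
      by (rule prod_mset_linear_dvd) (simp add: n_def)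
    also have "\<dots> dvd P" unfolding P_def L_def by (rule prod_dvd_prod_subset) auto
    finally have "smult (lead_coeff m) (\<Prod>z\<in>#A. [:- z, 1:]) dvd P"
      using m(1) by (subst smult_dvd_iff) simp
    then show ?thesis using A by simp
  qed
  \<comment> \<open>Evaluation at \<open>x\<close> with \<open>E\<close> as unit. It is
    multiplicative and kills the multiples of \<open>m\<close>, so idempotents modulo
    \<open>P\<close> become projections.\<close>
  define Z where "Z p = peval p x * E" for p
  have pE: "E * peval p x = peval p x * E" for p
    by (rule peval_commute) (use lE E in auto)
  have Z_mult: "Z (p * q) = Z p * Z q" for p q
  proof -
    have "Z p * Z q = peval p x * (E * peval q x) * E" by (simp add: Z_def mult.assoc)
    also have "\<dots> = peval p x * peval q x * (E * E)" by (simp add: pE mult.assoc)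
    finally show ?thesis by (simp add: Z_def E lx peval_mult)
  qed
  have Z_add: "Z (p + q) = Z p + Z q" and Z_diff: "Z (p - q) = Z p - Z q" for p q
    by (simp_all add: Z_def peval_add peval_diff lx algebra_simps)
  have Z_eq: "Z p = Z q" if "\<And>l. l \<in> L \<Longrightarrow> [:- l, 1:] ^ n dvd p - q" for p q
  proof -
    have "P dvd p - q" unfolding P_def by (rule prod_linear_powers_dvd[OF finL that])
    then have "m dvd p - q" using \<open>m dvd P\<close> by (rule dvd_trans[rotated])
    then obtain r where "p - q = m * r" by (auto simp: dvd_def)
    then have "Z p - Z q = Z m * Z r" by (metis Z_diff Z_mult)
    then show ?thesis using m(2) by (simp add: Z_def)
  qed
  obtain r where r: "\<forall>z\<in>L. [:- z, 1:] ^ n dvd r l - [:if z = l then 1 else 0:]" for l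
  proof -
    have "\<forall>l. \<exists>g. \<forall>z\<in>L. [:- z, 1:] ^ n dvd g - [:if z = l then 1 else 0:]"
      by (intro allI polynomial_crt finL)
    then show thesis using that unfolding choice_iff by blast
  qed
  have r1: "[:- l, 1:] ^ n dvd r l - 1" if "l \<in> L" for l
    using r[of l] that by (metis one_pCons)
  have r0: "[:- l, 1:] ^ n dvd r l'" if "l \<in> L" "l \<noteq> l'" for l l'
    using r[of l'] that by (metis diff_zero pCons_0_0)
  define e where "e l = Z (r l)" for l
  have e_sum: "(\<Sum>l\<in>L. e l) = E"
  proof -
    have "(\<Sum>l\<in>L. e l) = Z (\<Sum>l\<in>L. r l)"
      by (simp add: e_def Z_def peval_sum sum_distrib_right)
    also have "\<dots> = Z 1"
    proof (rule Z_eq)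
      fix l assume l: "l \<in> L"
      have "(\<Sum>l\<in>L. r l) - 1 = (r l - 1) + (\<Sum>l'\<in>L - {l}. r l')"
        using l finL by (simp add: sum.remove)
      moreover have "[:- l, 1:] ^ n dvd (\<Sum>l'\<in>L - {l}. r l')"
        using l r0 by (intro dvd_sum) auto
      ultimately show "[:- l, 1:] ^ n dvd (\<Sum>l\<in>L. r l) - 1"
        using l r1 by (metis dvd_add)
    qed
    finally show ?thesis by (simp add: Z_def)
  qed
  have e_idem: "e l * e l = e l" if "l \<in> L" for l
    unfolding e_def Z_mult[symmetric]
  proof (rule Z_eq)
    fix z assume z: "z \<in> L"
    have "r l * r l - r l = r l * (r l - 1)" by (simp add: algebra_simps)
    then show "[:- z, 1:] ^ n dvd r l * r l - r l"
      using r1[OF that] r0[of z l] z by (cases "z = l") auto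
  qed
  have e_ann: "Z ([:- l, 1:] ^ n * r l) = 0" if "l \<in> L" for l
  proof -
    have "Z ([:- l, 1:] ^ n * r l) = Z 0"
    proof (rule Z_eq)
      fix z assume z: "z \<in> L"
      show "[:- z, 1:] ^ n dvd [:- l, 1:] ^ n * r l - 0"
        using r0[OF z, of l] by (cases "z = l") auto
    qed
    then show ?thesis by (simp add: Z_def)
  qed
  have me: "maps_span C (e l)" for l
    unfolding e_def Z_def using mE mx by simp
  have peval_lin: "peval [:- l, 1:] x = x - scl l" for l
  proof -
    have "scl (- l) = - scl l" by (rule endo_eqI) simp
    then show ?thesis by simp
  qed
  have npos: "n > 0" by (simp add: n_def)
  have tr_xe: "trace_on C (x * e l) = l * trace_on C (e l)" if l: "l \<in> L" for l
  proof -
    let ?N = "Z ([:- l, 1:] * r l)"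
    have N: "?N = x * e l - scl l * e l"
      unfolding e_def Z_def peval_mult[OF lx] peval_lin by (simp add: left_diff_distrib mult.assoc)
    have ZN: "?N ^ k = Z (([:- l, 1:] * r l) ^ k)" if "k > 0" for k
      using that by (induction k rule: nat_induct_non_zero) (auto simp: Z_mult)
    have "?N ^ n = Z ([:- l, 1:] ^ n * r l * r l ^ (n - 1))"
      unfolding ZN[OF npos] power_mult_distrib using npos
      by (cases n) (simp_all add: mult.assoc)
    also have "\<dots> = 0" unfolding Z_mult[of _ "r l ^ (n - 1)"] e_ann[OF l] by simp
    finally have "?N ^ n = 0" .
    moreover have mN: "maps_span C ?N" unfolding N using mx me by simp
    ultimately have "trace_on C ?N = 0" by (intro trace_nilpotent[OF C mN, of n]) simp
    then show ?thesis unfolding N using C mx me by (simp add: trace_diff trace_scl)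
  qed
  \<comment> \<open>Additivity of \<open>f\<close> makes the scalar \<open>f u - f v\<close>, by
    which the commutator with \<open>y\<close> acts on \<open>e u * w * e v\<close>, depend on
    \<open>u - v\<close> alone. Only therefore can that commutator be a polynomial in
    \<open>ad x\<close>.\<close>
  have key: "(\<Sum>l\<in>L. f l * l * trace_on C (e l)) = 0"
    if f: "\<And>u v. f (u + v) = f u + f v" for f :: "'k \<Rightarrow> 'k"
  proof -
    have f_diff: "f (u - v) = f u - f v" for u v
      using f[of "u - v" v] by simp
    define y where "y = (\<Sum>l\<in>L. scl (f l) * e l)"
    have my: "maps_span C y" unfolding y_def using me by (intro maps_span_sum) simp
    define L' where "L' = (\<lambda>(u, v). u - v) ` (L \<times> L)"
    have "finite L'" using finL by (simp add: L'_def)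
    \<comment> \<open>The elements \<open>u - v\<close> of \<open>L'\<close> are the eigenvalues of
      \<open>ad x\<close> on the blocks \<open>e u * w * e v\<close>. There \<open>x - u\<close>
      from the left and \<open>x - v\<close> from the right both vanish at the power
      \<open>n\<close>, hence their difference at \<open>n + n\<close>.\<close>
    then obtain g where g: "\<forall>z\<in>L'. [:- z, 1:] ^ (n + n) dvd g - [:f z:]"
      using polynomial_crt by blast
    have ge: "En.peval g ?ad \<bullet> (e u * w * e v) = scl (f (u - v)) * (e u * w * e v)"
      if u: "u \<in> L" and v: "v \<in> L" and w: "lin w" for u v w
    proof -
      let ?W = "e u * w * e v"
      have "u - v \<in> L'" using u v by (auto simp: L'_def)
      then obtain h where h: "g - [:f (u - v):] = [:- (u - v), 1:] ^ (n + n) * h"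
        using g by (auto simp: dvd_def)
      have ev: "e v * x = x * e v"
        unfolding e_def Z_def by (metis E(2,3) mult.assoc peval_commute[OF lx refl])
      have lm: "lmul (x - scl u) ^ n \<bullet> ?W = 0"
      proof -
        have "(x - scl u) ^ n * e u = Z ([:- u, 1:] ^ n * r u)"
          unfolding e_def Z_def peval_mult[OF lx] peval_power[OF lx] peval_lin by (simp add: mult.assoc)
        then have "(x - scl u) ^ n * e u = 0" using e_ann[OF u] by simp
        then show ?thesis unfolding lmul_power by (simp flip: mult.assoc)
      qed
      have rm: "rmul (x - scl v) ^ n \<bullet> ?W = 0"
      proof -
        have "(x - scl v) * e v = e v * (x - scl v)"
          using ev me[of v] maps_span_lin[of C "e v"] by (simp add: algebra_simps lin_commute)
        then have "e v * (x - scl v) ^ n = (x - scl v) ^ n * e v"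
          by (metis commute_power)
        also have "\<dots> = Z ([:- v, 1:] ^ n * r v)"
          unfolding e_def Z_def peval_mult[OF lx] peval_power[OF lx] peval_lin by (simp add: mult.assoc)
        finally have "e v * (x - scl v) ^ n = 0" using e_ann[OF v] by simp
        then show ?thesis unfolding rmul_power by (simp add: mult.assoc)
      qed
      have "(lmul (x - scl u) - rmul (x - scl v)) ^ (n + n) \<bullet> ?W = 0"
        by (rule diff_power_app_eq_0[OF _ lm rm]) (auto intro!: endo_eqI simp: mult.assoc)
      moreover have "(lmul (x - scl u) - rmul (x - scl v)) ^ k \<bullet> ?W
          = (?ad - En.scl (u - v)) ^ k \<bullet> ?W \<and> lin ((?ad - En.scl (u - v)) ^ k \<bullet> ?W)" for k
      proof (induction k)
        case 0 show ?case using maps_span_lin[OF me] w by simp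
      next
        case (Suc k)
        let ?w = "(?ad - En.scl (u - v)) ^ k \<bullet> ?W"
        have "scl (u - v) = scl u - scl v"
          by (rule endo_eqI) (simp add: scale_left_diff_distrib)
        moreover have "?w * scl v = scl v * ?w" using Suc by (simp add: lin_commute)
        ultimately have "x * ?w - scl u * ?w - (?w * x - ?w * scl v) = x * ?w - ?w * x - scl (u - v) * ?w"
          by (simp add: algebra_simps)
        then show ?case using Suc lx by (simp add: left_diff_distrib right_diff_distrib)
      qed
      ultimately have "(?ad - En.scl (u - v)) ^ (n + n) \<bullet> ?W = 0" by metis
      moreover have "En.peval ([:- (u - v), 1:] ^ (n + n)) ?ad = (?ad - En.scl (u - v)) ^ (n + n)"
      proof -
        have "En.scl (- (u - v)) = - En.scl (u - v)"
          by (rule endo_eqI, rule endo_eqI) (simp add: scale_left_diff_distrib)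
        then have "En.peval [:- (u - v), 1:] ?ad = ?ad - En.scl (u - v)" 
          unfolding En.peval_pCons by simp
        then show ?thesis using En.peval_power[OF lad] by metis
      qed
      ultimately have "En.peval (g - [:f (u - v):]) ?ad \<bullet> ?W = 0"
        unfolding h by (subst mult.commute) (simp add: En.peval_mult[OF lad])
      then show ?thesis by (simp add: En.peval_diff[OF lad])
    qed
    \<comment> \<open>Cyclicity gives \<open>tr ([a, b] y) = - tr (a [y, b])\<close>, and
      \<open>[y, b] = g(ad x) b\<close> is a combination of the iterated commutators whose product
      with \<open>a\<close> has trace zero by assumption.\<close>
    have tr_ab: "trace_on C (comm (a i) (b i) * y) = 0" if i: "i \<in> I" for i
    proof -
      let ?a = "a i" and ?b = "b i"
      note mab = ma[OF i] mb[OF i]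
      have dec: "(\<Sum>u\<in>L. f u) * c * (\<Sum>v\<in>L. g v) = (\<Sum>u\<in>L. \<Sum>v\<in>L. f u * c * g v)" for f g :: "'k \<Rightarrow> 'b endo" and c
        by (simp add: sum_distrib_left sum_distrib_right) (rule sum.swap)
      have "?b = E * ?b * E" using Eab[OF i] by (simp add: mult.assoc)
      also have "\<dots> = (\<Sum>u\<in>L. \<Sum>v\<in>L. e u * ?b * e v)"
        unfolding e_sum[symmetric] by (rule dec)
      finally have b_dec: "?b = (\<Sum>u\<in>L. \<Sum>v\<in>L. e u * ?b * e v)" .
      have "En.peval g ?ad \<bullet> ?b = (\<Sum>u\<in>L. \<Sum>v\<in>L. scl (f (u - v)) * (e u * ?b * e v))"
        by (subst b_dec) (simp add: app_sum ge maps_span_lin[OF mab(2)])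
      also have "\<dots> = (\<Sum>u\<in>L. \<Sum>v\<in>L. scl (f u) * e u * ?b * e v)
          - (\<Sum>u\<in>L. \<Sum>v\<in>L. e u * ?b * (scl (f v) * e v))"
      proof -
        have "scl (f (u - v)) * (e u * ?b * e v) = scl (f u) * e u * ?b * e v - e u * ?b * (scl (f v) * e v)" for u v
        proof -
          have "lin (e u * ?b)" using me mab by (metis lin_times maps_span_lin)
          then have "scl c * (e u * ?b * e v) = e u * ?b * (scl c * e v)" for c
            unfolding lin_commute by (metis mult.assoc)
          moreover have "scl (f (u - v)) = scl (f u) - scl (f v)"
            by (rule endo_eqI) (simp add: f_diff scale_left_diff_distrib)
          ultimately show ?thesis by (simp add: left_diff_distrib mult.assoc)
        qed
        then show ?thesis by (simp add: sum_subtractf)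
      qed
      also have "\<dots> = y * ?b * E - E * ?b * y"
        unfolding y_def e_sum[symmetric] dec ..
      also have "\<dots> = y * ?b - ?b * y"
        using Eab[OF i] by (simp add: mult.assoc)
      finally have gb: "En.peval g ?ad \<bullet> ?b = y * ?b - ?b * y" .
      have mc: "maps_span C ((comm x ^^ k) ?b)" for k
        by (induction k) (auto simp: comm_def mx mab)
      have "En.peval g ?ad \<bullet> ?b = (\<Sum>k\<le>degree g. scl (coeff g k) * (comm x ^^ k) ?b)"
        using En.peval_eq_sum[OF order_refl lad, of g ?b] by (simp add: app_comm_power)
      then have "?a * (y * ?b - ?b * y) = (\<Sum>k\<le>degree g. scl (coeff g k) * (?a * (comm x ^^ k) ?b))"
        unfolding gb using maps_span_lin[OF mab(1)] unfolding lin_commute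
        by (simp add: sum_distrib_left) (simp flip: mult.assoc)
      then have "trace_on C (?a * (y * ?b - ?b * y)) = 0"
        using C mc mab tr[OF i] by (simp add: trace_sum trace_scl)
      moreover have "trace_on C (comm ?a ?b * y) = - trace_on C (?a * (y * ?b - ?b * y))"
      proof -
        have "comm ?a ?b * y = ?a * (?b * y) - ?b * (?a * y)"
          by (simp add: comm_def left_diff_distrib mult.assoc)
        moreover have "trace_on C (?b * (?a * y)) = trace_on C (?a * y * ?b)"
          by (rule trace_cyclic) (use C mab my in auto)
        ultimately show ?thesis
          using C mab my by (simp add: trace_diff right_diff_distrib mult.assoc)
      qed
      ultimately show ?thesis by simp
    qed
    have mc: "maps_span C (comm (a i) (b i) * y)" if "i \<in> I" for i
      using ma mb my that by (simp add: comm_def)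
    have "x * y = (\<Sum>i\<in>I. comm (a i) (b i) * y)"
      by (subst x) (simp add: sum_distrib_right)
    then have "trace_on C (x * y) = 0"
      using C mc tr_ab by (simp add: trace_sum)
    moreover have "x * y = (\<Sum>l\<in>L. scl (f l) * (x * e l))"
      unfolding y_def using lx unfolding lin_commute by (simp add: sum_distrib_left) (simp flip: mult.assoc)
    ultimately show ?thesis
      using C mx me tr_xe by (simp add: trace_sum trace_scl mult.assoc)
  qed
  have e0: "e l \<bullet> v = 0" if l: "l \<in> L" "l \<noteq> 0" and v: "v \<in> span C" for l v
  proof -
    have "\<exists>k. trace_on C (e l) = of_nat k \<and> (k = 0 \<longrightarrow> (\<forall>v\<in>span C. e l \<bullet> v = 0))" if "l \<in> L" for l
      by (rule trace_idempotent[OF C me e_idem[OF that]]) blast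
    then obtain k where k: "\<And>l. l \<in> L \<Longrightarrow> trace_on C (e l) = of_nat (k l)"
      "\<And>l v. l \<in> L \<Longrightarrow> k l = 0 \<Longrightarrow> v \<in> span C \<Longrightarrow> e l \<bullet> v = 0" by metis
    obtain \<phi> :: "'k \<Rightarrow> rat" where \<phi>: "\<And>x y. \<phi> (x + y) = \<phi> x + \<phi> y"
      "\<And>q x. \<phi> (of_rat q * x) = q * \<phi> x" "\<phi> l = 1"
      by (rule rational_functional[OF l(2)]) blast
    interpret \<phi>: Modules.additive \<phi> by (simp add: Modules.additive_def \<phi>)
    \<comment> \<open>The values of \<open>\<phi>\<close> are put back into the field as rational
      coefficients, so that \<open>\<phi>\<close> can pull them out again and leave
      \<open>\<phi> z\<close> squared times the rank of \<open>e z\<close>.\<close>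
    have "0 = \<phi> (\<Sum>z\<in>L. of_rat (\<phi> z) * z * trace_on C (e z))"
      by (subst key) (auto simp: \<phi> of_rat_add \<phi>.zero)
    also have "\<dots> = (\<Sum>z\<in>L. \<phi> (of_rat (\<phi> z * of_nat (k z)) * z))"
      unfolding \<phi>.sum using k by (intro sum.cong) (auto simp: of_rat_mult mult_ac)
    also have "\<dots> = (\<Sum>z\<in>L. \<phi> z * \<phi> z * of_nat (k z))"
      unfolding \<phi>(2) by (simp add: mult_ac)
    finally have "(\<Sum>z\<in>L. \<phi> z * \<phi> z * of_nat (k z)) = 0" by simp
    then have "\<phi> l * \<phi> l * of_nat (k l) = 0"
      using finL l(1) by (subst (asm) sum_nonneg_eq_0_iff) auto
    then have "k l = 0" using \<phi>(3) by simp
    then show ?thesis using k(2) l(1) v by blast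
  qed
  have e0': "e l = 0" if "l \<in> L" "l \<noteq> 0" for l
  proof (rule endo_eqI)
    fix v
    have "e l * E = e l" unfolding e_def Z_def by (simp add: mult.assoc E)
    then have "e l \<bullet> v = e l \<bullet> E \<bullet> v" by (metis app_times)
    then show "e l \<bullet> v = 0 \<bullet> v" using e0[OF that EV] by simp
  qed
  have "x ^ n * E = (\<Sum>l\<in>L. x ^ n * e l)"
    by (simp add: e_sum flip: sum_distrib_left)
  also have "\<dots> = x ^ n * e 0"
    using e0' finL by (subst sum.remove[of _ 0]) (auto simp: L_def)
  also have "\<dots> = Z ([:- 0, 1:] ^ n * r 0)"
    unfolding e_def Z_def peval_mult[OF lx] peval_power[OF lx] peval_lin by (simp add: mult.assoc)
  also have "\<dots> = 0" by (rule e_ann) (simp add: L_def)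
  finally show ?thesis by blast
qed

subsection \<open>Extension of scalars to the algebraic closure\<close>

lemma vspace_fscale: "vspace fscale"
  unfolding vspace_def by (rule vector_space_fscale)

context fd_vspace
begin

text \<open>The matrix of \<open>f\<close> over the algebraic closure. Formal sums range over the
  whole type \<open>'b\<close>, but only keys in \<open>Basis\<close> are reached, so
  \<open>acl 1\<close> is the projection onto the span of \<open>PB\<close> and not the identity; it
  serves as the \<open>E\<close> of the preceding theorem.\<close>

definition acl :: "'b endo \<Rightarrow> ('b \<Rightarrow>\<^sub>0 'a alg_closure) endo"
  where "acl f = Endo (\<lambda>v. \<Sum>i\<in>Basis. Poly_Mapping.single i
    (\<Sum>j\<in>Basis. to_ac (representation Basis (f \<bullet> j) i) * Poly_Mapping.lookup v j))"

lemma lookup_sum_single: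
  "Poly_Mapping.lookup (\<Sum>i\<in>Basis. Poly_Mapping.single i (g i)) k = (if k \<in> Basis then g k else 0)"
  by (simp add: lookup_sum lookup_single when_def finite_Basis)

lemma lookup_acl:
  "Poly_Mapping.lookup (acl f \<bullet> v) i =
    (if i \<in> Basis then \<Sum>j\<in>Basis. to_ac (representation Basis (f \<bullet> j) i) * Poly_Mapping.lookup v j else 0)"
proof -
  have "acl f \<bullet> v = (\<Sum>i\<in>Basis. Poly_Mapping.single i
    (\<Sum>j\<in>Basis. to_ac (representation Basis (f \<bullet> j) i) * Poly_Mapping.lookup v j))"
    unfolding acl_def
    by (rule app_Endo) (simp add: lookup_add distrib_left sum.distrib single_add)
  then show ?thesis by (simp add: lookup_sum_single)
qed

interpretation A: vspace "fscale :: 'a alg_closure \<Rightarrow> ('b \<Rightarrow>\<^sub>0 'a alg_closure) \<Rightarrow> _"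
  by (rule vspace_fscale)

lemma representation_Basis_app:
  "lin f \<Longrightarrow> representation Basis (f \<bullet> v) c
    = (\<Sum>b\<in>Basis. representation Basis v b * representation Basis (f \<bullet> b) c)"
  by (rule representation_app) (auto simp: finite_Basis independent_Basis span_Basis)

lemma representation_Basis_plus: "representation Basis (u + v) b = representation Basis u b + representation Basis v b"
  and representation_Basis_diff: "representation Basis (u - v) b = representation Basis u b - representation Basis v b"
  and representation_Basis_scale: "representation Basis (c *s v) b = c * representation Basis v b"
  by (simp_all add: representation_add representation_diff representation_scale independent_Basis span_Basis)

lemma acl_lin [simp]: "A.lin (acl f)"
  unfolding A.lin_def by (auto intro!: poly_mapping_eqI simp: lookup_acl sum_distrib_left mult_ac)

lemma acl_mult:
  assumes "lin f" shows "acl (f * g) = acl f * acl g"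
proof (rule endo_eqI, rule poly_mapping_eqI)
  fix v i
  show "Poly_Mapping.lookup (acl (f * g) \<bullet> v) i = Poly_Mapping.lookup (acl f * acl g \<bullet> v) i"
  proof (cases "i \<in> Basis")
    case True
    have "Poly_Mapping.lookup (acl (f * g) \<bullet> v) i
      = (\<Sum>j\<in>Basis. \<Sum>k\<in>Basis. to_ac (representation Basis (f \<bullet> k) i) * (to_ac (representation Basis (g \<bullet> j) k) * Poly_Mapping.lookup v j))"
      using True unfolding lookup_acl app_times representation_Basis_app[OF assms, of "g \<bullet> _"]
      by (simp add: to_ac_sum sum_distrib_left sum_distrib_right mult_ac)
    also have "\<dots> = Poly_Mapping.lookup (acl f * acl g \<bullet> v) i"
      using True by (subst sum.swap) (simp add: lookup_acl sum_distrib_left)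
    finally show ?thesis .
  qed (simp add: lookup_acl)
qed

lemma acl_add: "acl (f + g) = acl f + acl g"
  and acl_diff: "acl (f - g) = acl f - acl g"
  by (rule endo_eqI, rule poly_mapping_eqI,
      simp add: lookup_acl lookup_add lookup_minus representation_Basis_plus representation_Basis_diff
        sum.distrib sum_subtractf algebra_simps)+

lemma acl_0: "acl 0 = 0"
  using acl_diff[of 0 0] by simp

lemma acl_sum: "acl (\<Sum>i\<in>I. f i) = (\<Sum>i\<in>I. acl (f i))"
  by (induction I rule: infinite_finite_induct) (auto simp: acl_0 acl_add)

lemma acl_comm: "lin f \<Longrightarrow> lin g \<Longrightarrow> acl (comm f g) = comm (acl f) (acl g)"
  by (simp add: comm_def acl_diff acl_mult)

lemma lin_comm_power: "lin f \<Longrightarrow> lin g \<Longrightarrow> lin ((comm f ^^ k) g)"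
  by (induction k) (auto simp: comm_def)

lemma acl_comm_power: "lin f \<Longrightarrow> lin g \<Longrightarrow> acl ((comm f ^^ k) g) = (comm (acl f) ^^ k) (acl g)"
  by (induction k) (auto simp: acl_comm lin_comm_power)

lemma acl_scl: "acl (scl c) = A.scl (to_ac c) * acl 1"
  by (rule endo_eqI, rule poly_mapping_eqI)
    (simp add: lookup_acl representation_Basis_scale sum_distrib_left mult.assoc)

abbreviation "PB \<equiv> (pure ` Basis :: ('b \<Rightarrow>\<^sub>0 'a alg_closure) set)"

lemma PB_comb: "(\<Sum>b\<in>Basis. fscale (c b) (pure b)) = (\<Sum>b\<in>Basis. Poly_Mapping.single b (c b))"
  by (intro sum.cong refl poly_mapping_eqI) (auto simp: lookup_single when_def)

lemma inj_PB: "inj_on (pure :: 'b \<Rightarrow> 'b \<Rightarrow>\<^sub>0 'a alg_closure) Basis"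
  by (rule inj_onI) (metis lookup_single_eq lookup_single_not_eq zero_neq_one)

lemma lookup_acl_pure:
  assumes "b \<in> Basis"
  shows "Poly_Mapping.lookup (acl f \<bullet> pure b) i
    = (if i \<in> Basis then to_ac (representation Basis (f \<bullet> b) i) else 0)"
proof -
  have *: "Poly_Mapping.lookup (pure b) j = (if j = b then 1 else 0)" for j
    by (simp add: lookup_single when_def)
  show ?thesis
    using assms by (simp add: lookup_acl * if_distrib[of "(*) _"] finite_Basis cong: if_cong)
qed

lemma acl_inj:
  assumes "acl f = 0" "lin f" shows "f = 0"
proof (rule endo_eqI)
  have "f \<bullet> b = 0" if b: "b \<in> Basis" for b
  proof -
    have "representation Basis (f \<bullet> b) i = 0" if i: "i \<in> Basis" for i
    proof -
      have "Poly_Mapping.lookup (acl f \<bullet> pure b) i = to_ac (representation Basis (f \<bullet> b) i)"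
        using b i by (simp add: lookup_acl_pure)
      then show ?thesis using assms(1) by simp
    qed
    then show ?thesis
      using sum_representation_eq[OF independent_Basis, of "f \<bullet> b" Basis]
      by (simp add: span_Basis finite_Basis)
  qed
  then show "f \<bullet> x = 0 \<bullet> x" for x
    using span_closed_app[OF assms(2), of Basis "{0}" x] by (simp add: span_Basis)
qed

lemma independent_PB: "A.independent PB"
proof
  assume "A.dependent PB"
  then obtain u where u: "\<exists>w\<in>PB. u w \<noteq> 0" "(\<Sum>w\<in>PB. fscale (u w) w) = 0"
    unfolding A.dependent_finite[OF finite_imageI[OF finite_Basis]] by blast
  have *: "(\<Sum>b\<in>Basis. Poly_Mapping.single b (u (pure b))) = 0"
    using u(2) unfolding sum.reindex[OF inj_PB] o_def PB_comb .
  have "u (pure b) = 0" if "b \<in> Basis" for b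
    using lookup_sum_single[of "\<lambda>b. u (pure b)" b] that unfolding * by simp
  then show False using u(1) by auto
qed

lemma acl_in_span: "acl f \<bullet> v \<in> A.span PB"
proof -
  have "acl f \<bullet> v = (\<Sum>b\<in>Basis. fscale (Poly_Mapping.lookup (acl f \<bullet> v) b) (pure b))"
    unfolding PB_comb by (rule poly_mapping_eqI) (simp add: lookup_sum_single lookup_acl)
  also have "\<dots> \<in> A.span PB"
    by (intro A.span_sum A.span_scale A.span_base) simp
  finally show ?thesis .
qed

lemma maps_span_acl [simp]: "A.maps_span PB (acl f)"
  by (simp add: A.maps_span_def acl_in_span)

lemma acl_one:
  assumes "v \<in> A.span PB" shows "acl 1 \<bullet> v = v"
proof -
  have "A.span PB \<subseteq> {v. acl 1 \<bullet> v = v}"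
  proof (rule A.span_minimal)
    show "A.subspace {v. acl 1 \<bullet> v = v}"
      using acl_lin[of 1] by (auto simp: A.subspace_def A.lin_def)
    have "acl 1 \<bullet> pure b = pure b" if "b \<in> Basis" for b
      using that by (intro poly_mapping_eqI)
        (auto simp: lookup_acl_pure representation_basis[OF independent_Basis] lookup_single when_def)
    then show "PB \<subseteq> {v. acl 1 \<bullet> v = v}" by auto
  qed
  then show ?thesis using assms by auto
qed

lemma trace_acl: "A.trace_on PB (acl f) = to_ac (trace_on Basis f)"
proof -
  have rep: "A.representation PB v (pure i) = Poly_Mapping.lookup v i"
    if "v \<in> A.span PB" "i \<in> Basis" for v i
  proof -
    have "v = (\<Sum>w\<in>PB. fscale (A.representation PB v w) w)"
      using A.sum_representation_eq[OF independent_PB that(1)] finite_Basis by simp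
    also have "\<dots> = (\<Sum>b\<in>Basis. Poly_Mapping.single b (A.representation PB v (pure b)))"
      unfolding sum.reindex[OF inj_PB] o_def PB_comb ..
    finally have "Poly_Mapping.lookup v i = Poly_Mapping.lookup (\<Sum>b\<in>Basis. Poly_Mapping.single b (A.representation PB v (pure b))) i"
      by (rule arg_cong)
    then show ?thesis using that by (simp add: lookup_sum_single)
  qed
  have "A.trace_on PB (acl f) = (\<Sum>b\<in>Basis. Poly_Mapping.lookup (acl f \<bullet> pure b) b)"
    unfolding A.trace_on_def sum.reindex[OF inj_PB] o_def
    by (intro sum.cong refl rep acl_in_span)
  also have "\<dots> = (\<Sum>b\<in>Basis. to_ac (representation Basis (f \<bullet> b) b))"
    by (intro sum.cong refl) (simp add: lookup_acl_pure)
  finally show ?thesis by (simp add: trace_on_def to_ac_sum)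
qed

text \<open>The factor \<open>acl 1\<close> reconciles the constant terms: on the left they act as
  scalars on all formal sums, on the right only on the span of \<open>PB\<close>.\<close>

lemma peval_acl:
  assumes "lin x"
  shows "A.peval (map_poly to_ac p) (acl x) * acl 1 = acl (peval p x)"
proof (induction p)
  case (pCons c p)
  then have "A.peval (map_poly to_ac (pCons c p)) (acl x) * acl 1
      = A.scl (to_ac c) * acl 1 + acl x * (A.peval (map_poly to_ac p) (acl x) * acl 1)"
    by (simp add: map_poly_pCons distrib_right mult.assoc)
  also have "\<dots> = acl (peval (pCons c p) x)"
    using assms pCons by (simp add: acl_add acl_scl acl_mult)
  finally show ?case .
qed (simp add: acl_0)

end

text \<open>This is the core of Cartan's criterion.\<close>

theorem nilpotent_if_traces_vanish:
  fixes scale :: "'f::field_char_0 \<Rightarrow> 'b::ab_group_add \<Rightarrow> 'b"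
  assumes V: "fd_vspace scale Basis"
    and ab: "\<And>i. i \<in> I \<Longrightarrow> vspace.lin scale (a i)" "\<And>i. i \<in> I \<Longrightarrow> vspace.lin scale (b i)"
    and x: "x = (\<Sum>i\<in>I. comm (a i) (b i))"
    and tr: "\<And>i k. i \<in> I \<Longrightarrow> vspace.trace_on scale Basis (a i * (comm x ^^ k) (b i)) = 0"
  shows "\<exists>n. x ^ n = 0"
proof -
  interpret fd_vspace scale Basis by (rule V)
  interpret A: vspace "fscale :: 'f alg_closure \<Rightarrow> ('b \<Rightarrow>\<^sub>0 'f alg_closure) \<Rightarrow> _"
    by (rule vspace_fscale)
  have lx: "lin x" unfolding x using ab by (intro lin_sum) (simp add: comm_def)
  obtain m where m: "m \<noteq> 0" "peval m x = 0" using annihilating_poly[OF lx] .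
  have "\<exists>n. acl x ^ n * acl 1 = 0"
  proof (rule nilpotent_if_traces_vanish_alg_closed[OF vspace_fscale, where C = PB and a = "\<lambda>i. acl (a i)" and b = "\<lambda>i. acl (b i)" and I = I])
    show "finite PB" using finite_Basis by simp
    show "map_poly to_ac m \<noteq> 0" using m(1) by (simp add: map_poly_eq_0_iff)
    show "A.peval (map_poly to_ac m) (acl x) * acl 1 = 0"
      using peval_acl[OF lx, of m] m(2) by (simp add: acl_0)
    show "acl x = (\<Sum>i\<in>I. comm (acl (a i)) (acl (b i)))"
      by (subst x) (simp add: acl_sum acl_comm ab)
    show "A.trace_on PB (acl (a i) * (comm (acl x) ^^ k) (acl (b i))) = 0" if "i \<in> I" for i k
      using tr[OF that, of k] ab[OF that] lx
      by (simp add: trace_acl flip: acl_comm_power acl_mult)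
  qed (use independent_PB acl_one acl_in_span lx ab in \<open>auto simp flip: acl_mult\<close>)
  then obtain n where n: "acl x ^ n * acl 1 = 0" by blast
  have "acl x ^ k * acl 1 = acl (x ^ k)" for k
    by (induction k) (auto simp: acl_mult lx mult.assoc)
  then have "acl (x ^ n) = 0" using n by simp
  then have "x ^ n = 0" by (rule acl_inj) (simp add: lx)
  then show ?thesis ..
qed

section \<open>Engel's and Cartan's theorems\<close>

locale fd_lie = fd_vspace scale Basis + lie_algebra scale br
  for scale :: "'f::field \<Rightarrow> 'l::ab_group_add \<Rightarrow> 'l" (infixr \<open>*s\<close> 75)
    and Basis and br :: "'l \<Rightarrow> 'l \<Rightarrow> 'l"
begin

definition ad :: "'l \<Rightarrow> 'l endo"
  where "ad x = Endo (br x)"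

lemma app_ad [simp]: "ad x \<bullet> y = br x y"
  unfolding ad_def by (rule app_Endo_linear) (rule bracket_linear_right)

lemma lin_ad [simp]: "lin (ad x)"
  unfolding ad_def by (rule lin_Endo) (rule bracket_linear_right)

lemma br_add_right: "br x (y + z) = br x y + br x z"
  and br_diff_right: "br x (y - z) = br x y - br x z"
  and br_minus_right [simp]: "br x (- y) = - br x y"
  and br_zero_right [simp]: "br x 0 = 0"
  and br_scale_right: "br x (c *s y) = c *s br x y"
  and br_sum_right: "br x (\<Sum>i\<in>I. f i) = (\<Sum>i\<in>I. br x (f i))"
proof -
  interpret r: Vector_Spaces.linear scale scale "\<lambda>y. br x y"
    by (rule bracket_linear_right)
  show "br x (y + z) = br x y + br x z" "br x (y - z) = br x y - br x z" "br x (- y) = - br x y"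
    "br x 0 = 0" "br x (c *s y) = c *s br x y" "br x (\<Sum>i\<in>I. f i) = (\<Sum>i\<in>I. br x (f i))"
    by (simp_all add: r.add r.diff r.neg r.zero r.scale r.sum)
qed

lemma br_skew: "br x y = - br y x"
proof -
  interpret l: Vector_Spaces.linear scale scale "\<lambda>x. br x z" for z
    by (rule bracket_linear_left)
  have "br (x + y) (x + y) = br x x + br x y + br y x + br y y"
    by (simp add: l.add br_add_right)
  then show ?thesis by (simp add: bracket_self eq_neg_iff_add_eq_0)
qed

lemma br_add_left: "br (x + y) z = br x z + br y z"
  and br_diff_left: "br (x - y) z = br x z - br y z"
  and br_minus_left [simp]: "br (- x) z = - br x z"
  and br_zero_left [simp]: "br 0 z = 0"
  and br_scale_left: "br (c *s x) z = c *s br x z"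
  and br_sum_left: "br (\<Sum>i\<in>I. f i) z = (\<Sum>i\<in>I. br (f i) z)"
proof -
  interpret l: Vector_Spaces.linear scale scale "\<lambda>x. br x z"
    by (rule bracket_linear_left)
  show "br (x + y) z = br x z + br y z" "br (x - y) z = br x z - br y z" "br (- x) z = - br x z"
    "br 0 z = 0" "br (c *s x) z = c *s br x z" "br (\<Sum>i\<in>I. f i) z = (\<Sum>i\<in>I. br (f i) z)"
    by (simp_all add: l.add l.diff l.neg l.zero l.scale l.sum)
qed

lemma br_br_left: "br (br x y) z = br x (br y z) - br y (br x z)"
proof -
  have "br (br x y) z = - br z (br x y)" by (rule br_skew)
  also have "\<dots> = br x (br y z) + br y (br z x)"
    using jacobi[of x y z] by (simp add: eq_neg_iff_add_eq_0 add_eq_0_iff2 add.assoc minus_equation_iff)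
  also have "br z x = - br x z" by (rule br_skew)
  finally show ?thesis by simp
qed

lemma ad_add: "ad (x + y) = ad x + ad y"
  and ad_scale: "ad (c *s x) = scl c * ad x"
  by (rule endo_eqI; simp add: br_add_left br_scale_left)+

definition rep_on :: "'l set \<Rightarrow> ('l \<Rightarrow> 'l endo) \<Rightarrow> bool"
  where "rep_on A \<xi> \<longleftrightarrow> (\<forall>x\<in>A. lin (\<xi> x)) \<and> (\<forall>x\<in>A. \<forall>y\<in>A. \<xi> (x + y) = \<xi> x + \<xi> y) \<and>
    (\<forall>c. \<forall>x\<in>A. \<xi> (c *s x) = scl c * \<xi> x) \<and> (\<forall>x\<in>A. \<forall>y\<in>A. \<xi> (br x y) = comm (\<xi> x) (\<xi> y))"

lemma rep_on_lin: "rep_on A \<xi> \<Longrightarrow> x \<in> A \<Longrightarrow> lin (\<xi> x)"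
  and rep_on_add: "rep_on A \<xi> \<Longrightarrow> x \<in> A \<Longrightarrow> y \<in> A \<Longrightarrow> \<xi> (x + y) = \<xi> x + \<xi> y"
  and rep_on_scale: "rep_on A \<xi> \<Longrightarrow> x \<in> A \<Longrightarrow> \<xi> (c *s x) = scl c * \<xi> x"
  and rep_on_br: "rep_on A \<xi> \<Longrightarrow> x \<in> A \<Longrightarrow> y \<in> A \<Longrightarrow> \<xi> (br x y) = comm (\<xi> x) (\<xi> y)"
  by (auto simp: rep_on_def)

lemma rep_on_zero: "rep_on A \<xi> \<Longrightarrow> subspace A \<Longrightarrow> \<xi> 0 = 0"
  using rep_on_add[of A \<xi> 0 0] by (simp add: subspace_0)

lemma rep_on_subset: "rep_on A \<xi> \<Longrightarrow> B \<subseteq> A \<Longrightarrow> rep_on B \<xi>"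
  unfolding rep_on_def by blast

lemma rep_on_sum:
  assumes "rep_on A \<xi>" "subspace A" "\<And>i. i \<in> I \<Longrightarrow> f i \<in> A"
  shows "\<xi> (\<Sum>i\<in>I. f i) = (\<Sum>i\<in>I. \<xi> (f i))"
  using assms(3)
  by (induction I rule: infinite_finite_induct)
    (auto simp: rep_on_zero[OF assms(1,2)] rep_on_add[OF assms(1)] subspace_sum[OF assms(2)])

lemma subalgebra_subspace: "subalgebra A \<Longrightarrow> subspace A"
  and subalgebra_br: "subalgebra A \<Longrightarrow> x \<in> A \<Longrightarrow> y \<in> A \<Longrightarrow> br x y \<in> A"
  by (auto simp: subalgebra_def)

section \<open>Engel's theorem, as nilpotency of the associative algebra generated by the
  representation\<close>

definition prods_vanish :: "nat \<Rightarrow> 'l endo set \<Rightarrow> bool"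
  where "prods_vanish m Z \<longleftrightarrow> (\<forall>zs. set zs \<subseteq> Z \<longrightarrow> length zs = m \<longrightarrow> prod_list zs = 0)"

lemma prods_vanishD: "prods_vanish m Z \<Longrightarrow> set zs \<subseteq> Z \<Longrightarrow> length zs = m \<Longrightarrow> prod_list zs = 0"
  by (simp add: prods_vanish_def)

lemma prods_vanish_ge:
  assumes "prods_vanish m Z" "set zs \<subseteq> Z" "length zs \<ge> m"
  shows "prod_list zs = 0"
proof -
  have "prod_list (take m zs) = 0"
    using assms unfolding prods_vanish_def
    by (metis dual_order.trans length_take min.absorb2 set_take_subset)
  moreover have "prod_list zs = prod_list (take m zs) * prod_list (drop m zs)"
    by (metis append_take_drop_id prod_list.append)
  ultimately show ?thesis by simp
qed

text \<open>By \<open>u v = v u - [v, u]\<close> the letter \<open>u\<close> moves to the right. The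
  correction replaces a letter of \<open>Z\<close> by another one, and at the end \<open>u\<close>
  stands behind \<open>l\<close> letters of \<open>Z\<close>.\<close>

lemma move_right:
  assumes "\<And>zs. set zs \<subseteq> Z \<Longrightarrow> length zs = l \<Longrightarrow> z * prod_list zs = 0"
    and "\<And>v. v \<in> Z \<Longrightarrow> comm v u \<in> Z"
    and "set pre \<subseteq> Z" "set vs \<subseteq> Z" "length pre + length vs = l"
  shows "z * prod_list pre * u * prod_list vs = 0"
  using assms(3-)
proof (induction vs arbitrary: pre)
  case Nil
  then show ?case using assms(1) by simp
next
  case (Cons v vs)
  have "z * prod_list (pre @ [v]) * u * prod_list vs = 0"
    by (rule Cons.IH) (use Cons.prems in auto)
  moreover have "z * prod_list (pre @ [comm v u] @ vs) = 0"
    by (rule assms(1)) (use Cons.prems assms(2) in auto)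
  moreover have "z * prod_list pre * u * prod_list (v # vs)
    = z * prod_list (pre @ [v]) * u * prod_list vs - z * prod_list (pre @ [comm v u] @ vs)"
    by (simp add: comm_def algebra_simps)
  ultimately show ?case by simp
qed

text \<open>The word is consumed from its right end and \<open>vs\<close> collects letters of
  \<open>Z\<close>. When the last letter is \<open>u\<close>, the induction hypothesis says that the
  rest kills all products as long as \<open>vs\<close>, and \<open>move_right\<close> removes
  \<open>u\<close>.\<close>

lemma prod_list_many_letters:
  assumes Z: "prods_vanish m Z" and u: "\<And>v. v \<in> Z \<Longrightarrow> comm v u \<in> Z"
    and "set w \<subseteq> insert u Z" "set vs \<subseteq> Z" "length (filter (\<lambda>z. z \<in> Z) w) + length vs \<ge> m"
  shows "prod_list w * prod_list vs = 0"
  using assms(3-)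
proof (induction w arbitrary: vs rule: rev_induct)
  case Nil
  then show ?case using prods_vanish_ge[OF Z] by simp
next
  case (snoc z w)
  show ?case
  proof (cases "z \<in> Z")
    case True
    then have "prod_list w * prod_list (z # vs) = 0"
      by (intro snoc.IH) (use snoc.prems in auto)
    then show ?thesis by (simp add: mult.assoc)
  next
    case False
    then have "z = u" using snoc.prems by auto
    have "prod_list w * prod_list [] * u * prod_list vs = 0"
      by (rule move_right[where Z = Z and l = "length vs"])
        (use snoc False u in auto)
    then show ?thesis using \<open>z = u\<close> by simp
  qed
qed

text \<open>The word is cut into blocks of length \<open>k\<close>; a block without a letter of
  \<open>Z\<close> is \<open>u ^ k = 0\<close>.\<close>

lemma prod_list_long:
  fixes u :: "'l endo"
  assumes "u ^ k = 0" "set w \<subseteq> insert u Z" "length w \<ge> i * k"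
  shows "prod_list w = 0 \<or> length (filter (\<lambda>z. z \<in> Z) w) \<ge> i"
  using assms(2,3)
proof (induction i arbitrary: w)
  case (Suc i)
  let ?a = "take k w" and ?b = "drop k w"
  have w: "prod_list w = prod_list ?a * prod_list ?b" "filter P w = filter P ?a @ filter P ?b" for P
    by (metis append_take_drop_id prod_list.append, metis append_take_drop_id filter_append)
  have "set ?a \<subseteq> insert u Z" "set ?b \<subseteq> insert u Z"
    using Suc.prems(1) set_take_subset set_drop_subset by fast+
  have len: "length ?a = k" using Suc.prems(2) by simp
  show ?case
  proof (cases "set ?a \<subseteq> {u}")
    case True
    then have "?a = replicate k u" using len by (metis replicate_length_same singletonD subsetD)
    then have "prod_list ?a = 0" using assms(1) by simp
    then show ?thesis using w(1) by simp
  next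
    case False
    then obtain z where "z \<in> set ?a" "z \<in> Z" using \<open>set ?a \<subseteq> insert u Z\<close> by blast
    then have "filter (\<lambda>z. z \<in> Z) ?a \<noteq> []" by (auto simp: filter_empty_conv)
    then have "length (filter (\<lambda>z. z \<in> Z) ?a) \<ge> 1" by (simp add: Suc_leI)
    moreover have "prod_list ?b = 0 \<or> length (filter (\<lambda>z. z \<in> Z) ?b) \<ge> i"
      by (rule Suc.IH) (use \<open>set ?b \<subseteq> _\<close> Suc.prems(2) in auto)
    ultimately show ?thesis unfolding w by auto
  qed
qed simp

lemma lin_prod_list: "(\<And>z. z \<in> set zs \<Longrightarrow> lin z) \<Longrightarrow> lin (prod_list zs)"
  by (induction zs) auto

text \<open>A word of length \<open>m * k\<close> in \<open>u\<close> and \<open>Z\<close> is zero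
  or has \<open>m\<close> letters in \<open>Z\<close>, and then it vanishes too. Products of sums
  \<open>z + scl c * u\<close> are expanded factor by factor, \<open>w\<close> holding the letters
  already chosen.\<close>

lemma prods_vanish_insert:
  assumes Z: "prods_vanish m Z" "\<And>z. z \<in> Z \<Longrightarrow> lin z" and u: "\<And>v. v \<in> Z \<Longrightarrow> comm v u \<in> Z"
    and lu: "lin u" and uk: "u ^ k = 0"
  shows "prods_vanish (m * k) {z + scl c * u | z c. z \<in> Z}"
proof -
  have word: "prod_list w = 0" if "set w \<subseteq> insert u Z" "length w = m * k" for w
    using prod_list_long[OF uk that(1), of m] prod_list_many_letters[OF Z(1) u that(1), of "[]"] that(2)
    by auto
  have "prod_list w * prod_list zs = 0"
    if "set w \<subseteq> insert u Z" "set zs \<subseteq> {z + scl c * u | z c. z \<in> Z}" "length w + length zs = m * k" for w zs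
    using that
  proof (induction zs arbitrary: w)
    case Nil
    then show ?case using word by simp
  next
    case (Cons z zs)
    then obtain y c where z: "z = y + scl c * u" "y \<in> Z" by auto
    have "lin (prod_list w)" by (rule lin_prod_list) (use Cons.prems Z(2) lu in auto)
    then have "prod_list w * scl c = scl c * prod_list w" by (simp add: lin_commute)
    then have "prod_list w * prod_list (z # zs)
      = prod_list (w @ [y]) * prod_list zs + scl c * (prod_list (w @ [u]) * prod_list zs)"
      unfolding z by (simp add: distrib_left distrib_right flip: mult.assoc)
    moreover have "prod_list (w @ [y]) * prod_list zs = 0" "prod_list (w @ [u]) * prod_list zs = 0"
      by (rule Cons.IH; use Cons.prems z in auto)+
    ultimately show ?case by simp
  qed
  from this[of "[]"] show ?thesis unfolding prods_vanish_def by simp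
qed

text \<open>Otherwise bracketing \<open>y\<close> repeatedly with elements of \<open>h\<close> would never lead into \<open>h\<close>; but the image
  under \<open>\<xi>\<close> of a bracket with \<open>2 * m\<close> elements of \<open>h\<close> is a sum of products with \<open>m\<close> adjacent factors
  in \<open>\<xi> ` h\<close>.\<close>

lemma normalizer_step:
  assumes h: "prods_vanish m (\<xi> ` h)" and hD: "h \<subseteq> D" "subalgebra D" and \<xi>: "rep_on D \<xi>"
    and ker: "\<And>x. x \<in> D \<Longrightarrow> \<xi> x = 0 \<Longrightarrow> x \<in> h"
    and "y \<in> D" "y \<notin> h"
  and out: "\<And>x. x \<in> D \<Longrightarrow> x \<notin> h \<Longrightarrow> (\<And>z. z \<in> h \<Longrightarrow> br z x \<in> h) \<Longrightarrow> thesis"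
  shows thesis
proof (rule ccontr)
  assume "\<not> thesis"
  then have step: "\<exists>z\<in>h. br z x \<notin> h" if "x \<in> D" "x \<notin> h" for x
    using \<open>\<not> thesis\<close> out that by blast
  \<comment> \<open>Operators killed by any \<open>j\<close> factors from the image of
    \<open>h\<close>, distributed over both sides. Every operator is in \<open>T (2 * m)\<close>, as
    one side then has \<open>m\<close> factors; a bracket with \<open>h\<close> lowers the index by
    one, and \<open>T 0\<close> is zero.\<close>
  define T where "T j = {z. \<forall>us vs. set us \<subseteq> \<xi> ` h \<longrightarrow> set vs \<subseteq> \<xi> ` h \<longrightarrow>
    length us + length vs = j \<longrightarrow> prod_list us * z * prod_list vs = 0}" for j
  have "\<exists>x\<in>D - h. \<xi> x \<in> T (2 * m - j)" if "j \<le> 2 * m" for j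
    using that
  proof (induction j)
    case 0
    have "\<xi> y \<in> T (2 * m)" unfolding T_def
    proof (safe)
      fix us vs assume *: "set us \<subseteq> \<xi> ` h" "set vs \<subseteq> \<xi> ` h" "length us + length vs = 2 * m"
      then have "length us \<ge> m \<or> length vs \<ge> m" by linarith
      then show "prod_list us * \<xi> y * prod_list vs = 0"
        using prods_vanish_ge[OF h *(1)] prods_vanish_ge[OF h *(2)] by auto
    qed
    then show ?case using assms by auto
  next
    case (Suc j)
    then obtain x where x: "x \<in> D" "x \<notin> h" "\<xi> x \<in> T (2 * m - j)" by auto
    obtain z where z: "z \<in> h" "br z x \<notin> h" using step[OF x(1,2)] by blast
    have "\<xi> (br z x) = \<xi> z * \<xi> x - \<xi> x * \<xi> z"
      using rep_on_br[OF \<xi>, of z x] x z hD by (auto simp: comm_def)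
    moreover have "prod_list us * (\<xi> z * \<xi> x - \<xi> x * \<xi> z) * prod_list vs = 0"
      if "set us \<subseteq> \<xi> ` h" "set vs \<subseteq> \<xi> ` h" "length us + length vs = 2 * m - Suc j" for us vs
    proof -
      have T: "prod_list us * \<xi> x * prod_list vs = 0"
        if "set us \<subseteq> \<xi> ` h" "set vs \<subseteq> \<xi> ` h" "length us + length vs = 2 * m - j" for us vs
        using x(3) that unfolding T_def by blast
      have "length us + length vs + 1 = 2 * m - j" using that(3) Suc.prems by linarith
      then have "prod_list (us @ [\<xi> z]) * \<xi> x * prod_list vs = 0"
        "prod_list us * \<xi> x * prod_list (\<xi> z # vs) = 0"
        using z(1) that(1,2) by (intro T; simp)+
      then show ?thesis by (simp add: algebra_simps)
    qed
    ultimately have "\<xi> (br z x) \<in> T (2 * m - Suc j)" unfolding T_def by auto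
    moreover have "br z x \<in> D" using z x hD by (auto intro: subalgebra_br)
    ultimately show ?case using z by blast
  qed
  from this[of "2 * m"] obtain x where x: "x \<in> D" "x \<notin> h" "\<xi> x \<in> T 0" by auto
  have "\<xi> x = 0"
    using x(3)[unfolded T_def mem_Collect_eq, rule_format, of "[]" "[]"] by simp
  then show False using ker x by simp
qed

lemma subalgebra_insert:
  assumes h: "subalgebra h" and x: "\<And>z. z \<in> h \<Longrightarrow> br z x \<in> h"
  shows "subalgebra {z + c *s x | z c. z \<in> h}"
proof -
  let ?H = "{z + c *s x | z c. z \<in> h}"
  note hs = subalgebra_subspace[OF h]
  have "subspace ?H"
  proof (rule subspaceI)
    have "0 = 0 + 0 *s x" "0 \<in> h" using hs by (auto simp: subspace_0)
    then show "0 \<in> ?H" by blast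
    fix a assume "a \<in> ?H"
    then obtain z c where a: "a = z + c *s x" "z \<in> h" by blast
    show "d *s a \<in> ?H" for d
    proof -
      have "d *s a = d *s z + (d * c) *s x" "d *s z \<in> h"
        using a hs by (auto simp: scale_right_distrib subspace_scale)
      then show ?thesis by blast
    qed
    fix b assume "b \<in> ?H"
    then obtain z' c' where b: "b = z' + c' *s x" "z' \<in> h" by blast
    have "a + b = (z + z') + (c + c') *s x" "z + z' \<in> h"
      using a b hs by (auto simp: scale_left_distrib subspace_add)
    then show "a + b \<in> ?H" by blast
  qed
  moreover have "br a b \<in> ?H" if ab: "a \<in> ?H" "b \<in> ?H" for a b
  proof -
    obtain z c z' c' where a: "a = z + c *s x" "z \<in> h" and b: "b = z' + c' *s x" "z' \<in> h"
      using ab by blast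
    have "br a b = (br z z' + c' *s br z x - c *s br z' x) + 0 *s x"
      unfolding a b by (simp add: br_add_left br_add_right br_scale_left br_scale_right bracket_self br_skew[of x])
    moreover have "br z z' + c' *s br z x - c *s br z' x \<in> h"
      using a b x[of z] x[of z'] h hs
      by (intro subspace_diff subspace_add subspace_scale) (auto intro: subalgebra_br)
    ultimately show ?thesis by blast
  qed
  ultimately show ?thesis unfolding subalgebra_def by blast
qed

text \<open>Among the subalgebras that contain the kernel of \<open>\<xi>\<close> and have vanishing
  long products, one of largest dimension is taken. Were it proper, \<open>normalizer_step\<close>
  would provide an \<open>x\<close> outside that normalises it, and adjoining \<open>x\<close> would
  give a larger one.\<close>

theorem engel:
  assumes D: "subalgebra D" and \<xi>: "rep_on D \<xi>" and nil: "\<And>x. x \<in> D \<Longrightarrow> \<exists>n. \<xi> x ^ n = 0"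
  shows "\<exists>m. prods_vanish m (\<xi> ` D)"
proof -
  note Ds = subalgebra_subspace[OF D]
  define P where "P h \<longleftrightarrow> subalgebra h \<and> h \<subseteq> D \<and> (\<forall>x\<in>D. \<xi> x = 0 \<longrightarrow> x \<in> h) \<and> (\<exists>m. prods_vanish m (\<xi> ` h))" for h
  have "P {x \<in> D. \<xi> x = 0}"
  proof -
    have "subalgebra {x \<in> D. \<xi> x = 0}"
      unfolding subalgebra_def subspace_def using D Ds \<xi>
      by (auto simp: subspace_0 subspace_add subspace_scale rep_on_zero rep_on_add rep_on_scale
          rep_on_br subalgebra_br comm_def)
    moreover have "prods_vanish 1 (\<xi> ` {x \<in> D. \<xi> x = 0})"
      unfolding prods_vanish_def by (auto simp: length_Suc_conv)
    ultimately show ?thesis unfolding P_def by blast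
  qed
  moreover have "\<forall>h. P h \<longrightarrow> dim h < Suc (dim D)" using dim_subset P_def le_imp_less_Suc by blast
  ultimately have "\<exists>h. P h \<and> (\<forall>h'. P h' \<longrightarrow> dim h' \<le> dim h)" by (rule ex_has_greatest_nat)
  then obtain h where h: "P h" and max: "\<And>h'. P h' \<Longrightarrow> dim h' \<le> dim h" by blast
  have hs: "subspace h" using h subalgebra_subspace P_def by blast
  have "h = D"
  proof (rule ccontr)
    assume "h \<noteq> D"
    then obtain y where y: "y \<in> D" "y \<notin> h" using h P_def by blast
    obtain m where m: "prods_vanish m (\<xi> ` h)" using h P_def by blast
    have hD: "h \<subseteq> D" using h P_def by blast
    obtain x where x: "x \<in> D" "x \<notin> h" "\<And>z. z \<in> h \<Longrightarrow> br z x \<in> h"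
      by (rule normalizer_step[OF m hD D \<xi> _ y]) (use h P_def in auto)
    let ?H = "{z + c *s x | z c. z \<in> h}"
    obtain k where k: "\<xi> x ^ k = 0" using nil x by blast
    have "prods_vanish (m * k) {z + scl c * \<xi> x | z c. z \<in> \<xi> ` h}"
    proof (rule prods_vanish_insert[OF m])
      show "lin z" if "z \<in> \<xi> ` h" for z using that \<xi> hD by (auto intro: rep_on_lin)
      show "comm v (\<xi> x) \<in> \<xi> ` h" if "v \<in> \<xi> ` h" for v
      proof -
        from that obtain z where "z \<in> h" "v = \<xi> z" by blast
        moreover then have "\<xi> (br z x) = comm (\<xi> z) (\<xi> x)" using \<xi> hD x by (intro rep_on_br) auto
        ultimately show ?thesis using x(3) by (metis imageI)
      qed
    qed (use \<xi> x k in \<open>auto intro: rep_on_lin\<close>)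
    moreover have "\<xi> ` ?H \<subseteq> {z + scl c * \<xi> x | z c. z \<in> \<xi> ` h}"
    proof
      fix w assume "w \<in> \<xi> ` ?H"
      then obtain z c where "z \<in> h" "w = \<xi> (z + c *s x)" by blast
      then have "w = \<xi> z + scl c * \<xi> x"
        using \<xi> hD x Ds by (auto simp: rep_on_add rep_on_scale subspace_scale)
      then show "w \<in> {z + scl c * \<xi> x | z c. z \<in> \<xi> ` h}" using \<open>z \<in> h\<close> by blast
    qed
    ultimately have "prods_vanish (m * k) (\<xi> ` ?H)"
      unfolding prods_vanish_def by (meson order_trans)
    moreover have hH: "h \<subseteq> ?H"
    proof
      fix z assume "z \<in> h"
      moreover have "z = z + 0 *s x" by simp
      ultimately show "z \<in> ?H" by blast
    qed
    moreover have HD: "?H \<subseteq> D" using hD x Ds by (auto intro: subspace_add subspace_scale)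
    moreover have sH: "subalgebra ?H"
      using subalgebra_insert h x(3) P_def by blast
    ultimately have "P ?H" using h unfolding P_def by blast
    then have "dim ?H \<le> dim h" by (rule max)
    moreover have "x \<in> ?H"
    proof -
      have "x = 0 + 1 *s x" "0 \<in> h" using hs by (auto simp: subspace_0)
      then show ?thesis by blast
    qed
    ultimately show False
      using subspace_dim_equal[OF hs subalgebra_subspace[OF sH] hH] x(2) by blast
  qed
  then show ?thesis using h P_def by blast
qed

text \<open>Produces the sum of commutators that \<open>nilpotent_if_traces_vanish\<close> asks for;
  coefficients are absorbed into \<open>a t\<close>.\<close>

lemma span_brackets_sum:
  assumes D: "subspace D" and \<xi>: "rep_on D \<xi>" and br: "\<And>x y. x \<in> D \<Longrightarrow> y \<in> D \<Longrightarrow> br x y \<in> D"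
    and x: "x \<in> span {br x y | x y. x \<in> D \<and> y \<in> D}"
  obtains T :: "'l set" and a b where "\<And>t. t \<in> T \<Longrightarrow> a t \<in> D" "\<And>t. t \<in> T \<Longrightarrow> b t \<in> D"
    "\<xi> x = (\<Sum>t\<in>T. comm (\<xi> (a t)) (\<xi> (b t)))"
proof -
  obtain T r where T: "finite T" "T \<subseteq> {br x y | x y. x \<in> D \<and> y \<in> D}" "x = (\<Sum>t\<in>T. r t *s t)"
    using x unfolding span_explicit by auto
  then have "\<forall>t\<in>T. \<exists>y z. y \<in> D \<and> z \<in> D \<and> t = br y z" by blast
  then obtain y z where yz: "\<And>t. t \<in> T \<Longrightarrow> y t \<in> D \<and> z t \<in> D \<and> t = br (y t) (z t)" by metis
  have x': "x = (\<Sum>t\<in>T. br (r t *s y t) (z t))"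
    unfolding T(3) by (rule sum.cong) (use yz in \<open>auto simp: br_scale_left\<close>)
  have "\<xi> x = (\<Sum>t\<in>T. \<xi> (br (r t *s y t) (z t)))"
    unfolding x' by (rule rep_on_sum[OF \<xi> D]) (use yz D br in \<open>auto simp: subspace_scale\<close>)
  also have "\<dots> = (\<Sum>t\<in>T. comm (\<xi> (r t *s y t)) (\<xi> (z t)))"
    by (rule sum.cong) (use yz D \<xi> in \<open>auto simp: subspace_scale rep_on_br\<close>)
  finally show thesis
    using that[of T "\<lambda>t. r t *s y t" z] yz D by (auto simp: subspace_scale)
qed

end

section \<open>Cartan's criterion\<close>

locale fd_lie0 = fd_lie scale Basis br
  for scale :: "'f::field_char_0 \<Rightarrow> 'l::ab_group_add \<Rightarrow> 'l" (infixr \<open>*s\<close> 75)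
    and Basis and br :: "'l \<Rightarrow> 'l \<Rightarrow> 'l"
begin

abbreviation "tr \<equiv> trace_on Basis"

text \<open>All \<open>\<xi> x\<close> are sums of commutators, hence nilpotent, and by Engel all
  long products vanish. Perfectness shortens them: the first factor of a product is a sum of
  commutators, which turns it into a sum of products with one factor more.\<close>

lemma cartan_perfect:
  assumes D: "subalgebra D" and \<xi>: "rep_on D \<xi>" and perf: "span {br x y | x y. x \<in> D \<and> y \<in> D} = D"
    and tr: "\<And>x y. x \<in> D \<Longrightarrow> y \<in> D \<Longrightarrow> tr (\<xi> x * \<xi> y) = 0"
    and x: "x \<in> D"
  shows "\<xi> x = 0"
proof -
  note Ds = subalgebra_subspace[OF D]
  have dec: "\<exists>(T :: 'l set) a b. (\<forall>t\<in>T. a t \<in> D \<and> b t \<in> D) \<and> \<xi> x = (\<Sum>t\<in>T. comm (\<xi> (a t)) (\<xi> (b t)))"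
    if x: "x \<in> D" for x
  proof -
    obtain T :: "'l set" and a b where "\<And>t. t \<in> T \<Longrightarrow> a t \<in> D" "\<And>t. t \<in> T \<Longrightarrow> b t \<in> D"
      "\<xi> x = (\<Sum>t\<in>T. comm (\<xi> (a t)) (\<xi> (b t)))"
      by (rule span_brackets_sum[OF Ds \<xi>, of x]) (use x perf in \<open>auto intro: subalgebra_br[OF D]\<close>)
    then show ?thesis by blast
  qed
  have "\<exists>n. \<xi> x ^ n = 0" if x: "x \<in> D" for x
  proof -
    obtain T :: "'l set" and a b where T: "\<And>t. t \<in> T \<Longrightarrow> a t \<in> D \<and> b t \<in> D"
      "\<xi> x = (\<Sum>t\<in>T. comm (\<xi> (a t)) (\<xi> (b t)))" using dec[OF x] by blast
    have "(comm (\<xi> x) ^^ k) (\<xi> y) = \<xi> ((br x ^^ k) y) \<and> (br x ^^ k) y \<in> D" if "y \<in> D" for k y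
      using that by (induction k) (auto simp: rep_on_br[OF \<xi> x] subalgebra_br[OF D x])
    then have "tr (\<xi> (a t) * (comm (\<xi> x) ^^ k) (\<xi> (b t))) = 0" if "t \<in> T" for t k
      using T(1)[OF that] tr by auto
    then show ?thesis
      using T \<xi> by (intro nilpotent_if_traces_vanish[OF fd_vspace_axioms, of T "\<lambda>t. \<xi> (a t)" "\<lambda>t. \<xi> (b t)"])
        (auto intro: rep_on_lin)
  qed
  then obtain m where "prods_vanish m (\<xi> ` D)" using engel[OF D \<xi>] by blast
  \<comment> \<open>The index is raised since Engel's theorem may return 0, and the descent has to
    stop at products of length one.\<close>
  then have m: "prods_vanish (Suc m) (\<xi> ` D)"
    using prods_vanish_ge unfolding prods_vanish_def by (metis le_SucI order_refl)
  have "prods_vanish (Suc j) (\<xi> ` D)" if "prods_vanish (Suc (Suc j)) (\<xi> ` D)" for j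
    unfolding prods_vanish_def
  proof safe
    fix zs assume zs: "set zs \<subseteq> \<xi> ` D" "length zs = Suc j"
    then obtain y ws where y: "zs = \<xi> y # ws" "y \<in> D" "set ws \<subseteq> \<xi> ` D" "length ws = j"
      by (cases zs) auto
    obtain T :: "'l set" and a b where T: "\<And>t. t \<in> T \<Longrightarrow> a t \<in> D \<and> b t \<in> D"
      "\<xi> y = (\<Sum>t\<in>T. comm (\<xi> (a t)) (\<xi> (b t)))" using dec[OF y(2)] by blast
    have "comm (\<xi> (a t)) (\<xi> (b t)) * prod_list ws = 0" if "t \<in> T" for t
    proof -
      have "prod_list (\<xi> (a t) # \<xi> (b t) # ws) = 0" "prod_list (\<xi> (b t) # \<xi> (a t) # ws) = 0"
        by (rule prods_vanishD[OF \<open>prods_vanish (Suc (Suc j)) (\<xi> ` D)\<close>]; use T(1)[OF that] y(3,4) in simp)+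
      then show ?thesis by (simp add: comm_def left_diff_distrib mult.assoc)
    qed
    then show "prod_list zs = 0" unfolding y(1) by (simp add: T(2) sum_distrib_right)
  qed
  then have "prods_vanish (Suc 0) (\<xi> ` D)"
    using m by (induction m) auto
  then have "prod_list [\<xi> x] = 0" by (rule prods_vanishD) (use x in auto)
  then show ?thesis by simp
qed

lemma derived_series_subset_subalgebra:
  assumes "subalgebra A"
  shows "subalgebra (derived_series A n) \<and> derived_series A (Suc n) \<subseteq> derived_series A n"
proof (induction n)
  case (Suc n)
  have sub: "derived_series A (Suc (Suc n)) \<subseteq> derived_series A (Suc n)"
    unfolding derived_series.simps(2)[of A "Suc n"] derived_series.simps(2)[of A n]
    by (rule span_mono) (use Suc in auto)
  have "br x y \<in> derived_series A (Suc n)" if "x \<in> derived_series A (Suc n)" "y \<in> derived_series A (Suc n)" for x y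
    using that Suc by (auto intro!: span_base)
  then have "subalgebra (derived_series A (Suc n))" unfolding subalgebra_def by (simp add: subspace_span)
  with sub show ?case by blast
next
  case 0
  have "span {br x y | x y. x \<in> A \<and> y \<in> A} \<subseteq> A"
    using assms by (intro span_minimal) (auto simp: subalgebra_def)
  then show ?case using assms by simp
qed

lemma derived_series_subset: "subalgebra A \<Longrightarrow> derived_series A n \<subseteq> A"
  by (induction n) (use derived_series_subset_subalgebra in force)+

text \<open>Dimensions along the derived series cannot drop forever, and the term where they stop
  dropping is perfect. The conclusion is solvability up to the kernel of
  \<open>\<xi>\<close>.\<close>

theorem cartan_solvable:
  assumes I: "subalgebra I" and \<xi>: "rep_on I \<xi>" and tr: "\<And>x y. x \<in> I \<Longrightarrow> y \<in> I \<Longrightarrow> tr (\<xi> x * \<xi> y) = 0"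
  obtains k where "\<And>x. x \<in> derived_series I k \<Longrightarrow> \<xi> x = 0"
proof -
  let ?D = "derived_series I"
  note sub = derived_series_subset_subalgebra[OF I]
  have "\<exists>k. dim (?D k) \<le> dim (?D (Suc k))"
  proof (rule ccontr)
    assume "\<nexists>k. dim (?D k) \<le> dim (?D (Suc k))"
    then have *: "dim (?D (Suc k)) < dim (?D k)" for k by (metis not_le)
    have "dim (?D k) + k \<le> dim (?D 0)" for k
    proof (induction k)
      case (Suc k) then show ?case using *[of k] by linarith
    qed simp
    from this[of "Suc (dim (?D 0))"] show False by simp
  qed
  then obtain k where k: "dim (?D k) \<le> dim (?D (Suc k))" by blast
  have eq: "?D (Suc k) = ?D k"
    by (rule subspace_dim_equal) (use sub[of k] sub[of "Suc k"] k subalgebra_subspace in auto)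
  have kI: "?D k \<subseteq> I" by (rule derived_series_subset[OF I])
  have "\<xi> x = 0" if "x \<in> ?D k" for x
    by (rule cartan_perfect[of "?D k"])
      (use sub[of k] rep_on_subset[OF \<xi> kI] eq tr kI that in auto)
  then show thesis by (rule that)
qed

end

section \<open>Complements, symmetric bilinear forms and dual bases\<close>

context fd_vspace
begin

lemma projection_exists:
  assumes "subspace W"
  obtains p where "lin p" "\<And>v. p \<bullet> v \<in> W" "\<And>w. w \<in> W \<Longrightarrow> p \<bullet> w = w"
proof -
  interpret vp: vector_space_pair scale scale by unfold_locales
  obtain B where B: "independent B" "span B = W"
    using finite_basis_in_span[OF finite_Basis assms] span_Basis by blast
  obtain g where g: "Vector_Spaces.linear scale scale g" "\<forall>x\<in>B. g x = x" "range g = span B"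
    using vp.linear_independent_extend_subspace[OF B(1), of "\<lambda>x. x"] by auto
  have app: "Endo g \<bullet> x = g x" for x by (rule app_Endo_linear[OF g(1)])
  have "lin (Endo g)" by (rule lin_Endo[OF g(1)])
  moreover have "Endo g \<bullet> v \<in> W" for v using g(3) B(2) app by auto
  moreover have "Endo g \<bullet> w = w" if "w \<in> W" for w
  proof -
    have "(Endo g - 1) \<bullet> w \<in> {0}"
      by (rule span_closed_app[of _ B]) (use g(2) B(2) app that \<open>lin (Endo g)\<close> in auto)
    then show ?thesis by simp
  qed
  ultimately show thesis by (rule that)
qed

text \<open>A stand-in for the quotient map from \<open>A\<close> to \<open>A / J\<close>: on
  \<open>A\<close> the kernel of \<open>q\<close> is \<open>J\<close>, and
  \<open>q \<bullet> x\<close> represents the class of \<open>x\<close>.\<close>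

lemma complement_projection:
  assumes "subspace A" "subspace J" "J \<subseteq> A"
  obtains q where "lin q" "\<And>v. q \<bullet> v \<in> A" "\<And>j. j \<in> J \<Longrightarrow> q \<bullet> j = 0"
    "\<And>x. x \<in> A \<Longrightarrow> q \<bullet> x - x \<in> J" "q * q = q"
proof -
  obtain a where a: "lin a" "\<And>v. a \<bullet> v \<in> A" "\<And>w. w \<in> A \<Longrightarrow> a \<bullet> w = w"
    using projection_exists[OF assms(1)] by blast
  obtain j where j: "lin j" "\<And>v. j \<bullet> v \<in> J" "\<And>w. w \<in> J \<Longrightarrow> j \<bullet> w = w"
    using projection_exists[OF assms(2)] by blast
  show thesis
  proof (rule that[of "(1 - j) * a"])
    show "(1 - j) * a \<bullet> v \<in> A" for v
      using a(2) j(2) assms(3) by (auto intro!: subspace_diff[OF assms(1)])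
    show "(1 - j) * a \<bullet> x - x \<in> J" if "x \<in> A" for x
      using a(3)[OF that] j(2) assms by (simp add: subspace_neg)
    show "(1 - j) * a * ((1 - j) * a) = (1 - j) * a"
    proof (rule endo_eqI)
      fix x
      show "(1 - j) * a * ((1 - j) * a) \<bullet> x = (1 - j) * a \<bullet> x"
        by (simp add: j a subsetD[OF assms(3) j(2)])
    qed
  qed (use a j assms in auto)
qed

definition bilin :: "('b \<Rightarrow> 'b \<Rightarrow> 'a) \<Rightarrow> bool"
  where "bilin \<beta> \<longleftrightarrow> (\<forall>x y z. \<beta> (x + y) z = \<beta> x z + \<beta> y z) \<and> (\<forall>c x z. \<beta> (c *s x) z = c * \<beta> x z) \<and>
    (\<forall>x y. \<beta> x y = \<beta> y x)"

lemma bilin_sym: "bilin \<beta> \<Longrightarrow> \<beta> x y = \<beta> y x"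
  and bilin_add_left: "bilin \<beta> \<Longrightarrow> \<beta> (x + y) z = \<beta> x z + \<beta> y z"
  and bilin_scale_left: "bilin \<beta> \<Longrightarrow> \<beta> (c *s x) z = c * \<beta> x z"
  by (auto simp: bilin_def)

lemma bilin_scale_right: "bilin \<beta> \<Longrightarrow> \<beta> z (c *s x) = c * \<beta> z x"
  by (metis bilin_sym bilin_scale_left)

lemma bilin_diff_left: "bilin \<beta> \<Longrightarrow> \<beta> (x - y) z = \<beta> x z - \<beta> y z"
  using bilin_add_left[of \<beta> "x - y" y z] by simp

lemma bilin_diff_right: "bilin \<beta> \<Longrightarrow> \<beta> z (x - y) = \<beta> z x - \<beta> z y"
  by (metis bilin_sym bilin_diff_left)

lemma bilin_zero_left: "bilin \<beta> \<Longrightarrow> \<beta> 0 z = 0"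
  using bilin_diff_left[of \<beta> 0 0 z] by simp

lemma bilin_sum_left: "bilin \<beta> \<Longrightarrow> \<beta> (\<Sum>i\<in>I. f i) z = (\<Sum>i\<in>I. \<beta> (f i) z)"
  by (induction I rule: infinite_finite_induct) (auto simp: bilin_add_left bilin_zero_left)

lemma bilin_sum_right: "bilin \<beta> \<Longrightarrow> \<beta> z (\<Sum>i\<in>I. f i) = (\<Sum>i\<in>I. \<beta> z (f i))"
  using bilin_sum_left bilin_sym by (metis (mono_tags, lifting) sum.cong)

definition dual_system :: "('b \<Rightarrow> 'b \<Rightarrow> 'a) \<Rightarrow> 'b set \<Rightarrow> nat \<Rightarrow> (nat \<Rightarrow> 'b) \<Rightarrow> (nat \<Rightarrow> 'b) \<Rightarrow> bool"
  where "dual_system \<beta> G n e f \<longleftrightarrow> (\<forall>i<n. e i \<in> G \<and> f i \<in> G) \<and>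
    (\<forall>i<n. \<forall>j<n. \<beta> (e i) (f j) = (if i = j then 1 else 0))"

lemma dual_system_bound:
  assumes "bilin \<beta>" "dual_system \<beta> G n e f"
  shows "n \<le> card Basis"
proof -
  have \<beta>: "\<beta> (e i) (f j) = (if i = j then 1 else 0)" if "i < n" "j < n" for i j
    using assms(2) that by (auto simp: dual_system_def)
  have inj: "inj_on e {..<n}"
  proof (rule inj_onI)
    fix i j assume "i \<in> {..<n}" "j \<in> {..<n}" "e i = e j"
    then show "i = j" using \<beta>[of i j] \<beta>[of j j] by (auto split: if_splits)
  qed
  have "independent (e ` {..<n})"
  proof (rule ccontr)
    assume "\<not> independent (e ` {..<n})"
    then obtain u where u: "\<exists>v\<in>e ` {..<n}. u v \<noteq> 0" "(\<Sum>v\<in>e ` {..<n}. u v *s v) = 0"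
      using dependent_finite[OF finite_imageI[OF finite_lessThan]] by blast
    have "u (e j) = 0" if "j < n" for j
    proof -
      have "0 = \<beta> (\<Sum>i<n. u (e i) *s e i) (f j)"
        using u(2) by (simp add: sum.reindex[OF inj] bilin_zero_left[OF assms(1)])
      also have "\<dots> = (\<Sum>i<n. u (e i) * (if i = j then 1 else 0))"
        unfolding bilin_sum_left[OF assms(1)] bilin_scale_left[OF assms(1)]
        by (rule sum.cong) (use \<beta> that in auto)
      also have "\<dots> = u (e j)" using that by (simp add: if_distrib[of "(*) _"] cong: if_cong)
      finally show ?thesis by simp
    qed
    then show False using u(1) by auto
  qed
  then have "card (e ` {..<n}) \<le> card Basis"
    using independent_span_bound[OF finite_Basis] span_Basis by auto
  then show ?thesis by (simp add: card_image[OF inj])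
qed

text \<open>A dual system of maximal size is taken. If \<open>x\<close> orthogonal to all
  \<open>f j\<close> and \<open>y\<close> orthogonal to all \<open>e j\<close> did not pair to zero,
  they would enlarge it after rescaling. So the remainder of every expansion lies in the radical of
  the form, hence in \<open>J\<close>.\<close>

lemma dual_bases:
  assumes \<beta>: "bilin \<beta>" and G: "subspace G"
    and rad: "\<And>x. x \<in> G \<Longrightarrow> (\<And>y. y \<in> G \<Longrightarrow> \<beta> x y = 0) \<Longrightarrow> x \<in> J"
  obtains n e f where "dual_system \<beta> G n e f"
    "\<And>g. g \<in> G \<Longrightarrow> g - (\<Sum>i<n. \<beta> g (f i) *s e i) \<in> J"
    "\<And>g. g \<in> G \<Longrightarrow> g - (\<Sum>i<n. \<beta> (e i) g *s f i) \<in> J"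
proof -
  let ?P = "\<lambda>n. \<exists>e f. dual_system \<beta> G n e f"
  have "?P 0" by (simp add: dual_system_def)
  moreover have "\<forall>n. ?P n \<longrightarrow> n < Suc (card Basis)"
    using dual_system_bound[OF \<beta>] le_imp_less_Suc by blast
  ultimately have "\<exists>n. ?P n \<and> (\<forall>m. ?P m \<longrightarrow> m \<le> n)"
    by (rule ex_has_greatest_nat[where f = "\<lambda>n. n"])
  then obtain n e f where ef: "dual_system \<beta> G n e f" and max: "\<And>m. ?P m \<Longrightarrow> m \<le> n" by blast
  have d: "\<beta> (e i) (f j) = (if i = j then 1 else 0)" and G': "e i \<in> G" "f i \<in> G" if "i < n" "j < n" for i j
    using ef that by (auto simp: dual_system_def)
  have orth: "\<beta> x y = 0"
    if x: "x \<in> G" "\<And>j. j < n \<Longrightarrow> \<beta> x (f j) = 0" and y: "y \<in> G" "\<And>j. j < n \<Longrightarrow> \<beta> (e j) y = 0" for x y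
  proof (rule ccontr)
    assume *: "\<beta> x y \<noteq> 0"
    let ?y = "inverse (\<beta> x y) *s y"
    have "dual_system \<beta> G (Suc n) (e(n := x)) (f(n := ?y))"
      using * x y G' d G unfolding dual_system_def
      by (auto simp: less_Suc_eq bilin_scale_right[OF \<beta>] subspace_scale)
    then show False using max[of "Suc n"] by auto
  qed
  define pe where "pe g = g - (\<Sum>i<n. \<beta> g (f i) *s e i)" for g
  define pf where "pf g = g - (\<Sum>i<n. \<beta> (e i) g *s f i)" for g
  have pe: "\<beta> (pe g) (f j) = 0" if "j < n" for g j
  proof -
    have "\<beta> (pe g) (f j) = \<beta> g (f j) - (\<Sum>i<n. \<beta> g (f i) * (if i = j then 1 else 0))"
      unfolding pe_def bilin_diff_left[OF \<beta>] bilin_sum_left[OF \<beta>] bilin_scale_left[OF \<beta>]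
      using d that by simp
    then show ?thesis using that by (simp add: if_distrib[of "(*) _"] cong: if_cong)
  qed
  have pf: "\<beta> (e j) (pf g) = 0" if "j < n" for g j
  proof -
    have "\<beta> (e j) (pf g) = \<beta> (e j) g - (\<Sum>i<n. \<beta> (e i) g * (if j = i then 1 else 0))"
      unfolding pf_def bilin_diff_right[OF \<beta>] bilin_sum_right[OF \<beta>] bilin_scale_right[OF \<beta>]
      using d that by simp
    then show ?thesis using that by (simp add: if_distrib[of "(*) _"] cong: if_cong)
  qed
  have peG: "pe g \<in> G" and pfG: "pf g \<in> G" if "g \<in> G" for g
    unfolding pe_def pf_def using that G G'
    by (auto intro!: subspace_diff subspace_sum subspace_scale)
  have pfe: "\<beta> (pe x) (pf y) = 0" if "x \<in> G" "y \<in> G" for x y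
    by (rule orth[OF peG[OF that(1)] pe pfG[OF that(2)] pf])
  have 1: "\<beta> (pe x) (pf y) = \<beta> (pe x) y" for x y
    unfolding pf_def[of y] bilin_diff_right[OF \<beta>] bilin_sum_right[OF \<beta>] bilin_scale_right[OF \<beta>]
    by (simp add: pe)
  have 2: "\<beta> (pe x) (pf y) = \<beta> x (pf y)" for x y
    unfolding pe_def[of x] bilin_diff_left[OF \<beta>] bilin_sum_left[OF \<beta>] bilin_scale_left[OF \<beta>]
    by (simp add: pf)
  show thesis
  proof (rule that[OF ef])
    show "g - (\<Sum>i<n. \<beta> g (f i) *s e i) \<in> J" if "g \<in> G" for g
      using rad[OF peG[OF that]] pfe[OF that] 1 unfolding pe_def by metis
    show "g - (\<Sum>i<n. \<beta> (e i) g *s f i) \<in> J" if "g \<in> G" for g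
      using rad[OF pfG[OF that]] pfe[OF _ that] 2 bilin_sym[OF \<beta>] unfolding pf_def by metis
  qed
qed

end

section \<open>The trace form of a pair of a Lie algebra and its radical\<close>

context fd_lie0
begin

text \<open>Unlike in \<open>rep_on\<close>, linearity is required on the whole space, which makes
  trace forms bilinear without side conditions; only the bracket rule is tied to
  \<open>A\<close>.\<close>

definition lrep :: "'l set \<Rightarrow> ('l \<Rightarrow> 'l endo) \<Rightarrow> bool"
  where "lrep A \<xi> \<longleftrightarrow> (\<forall>x. lin (\<xi> x)) \<and> (\<forall>x y. \<xi> (x + y) = \<xi> x + \<xi> y) \<and>
    (\<forall>c x. \<xi> (c *s x) = scl c * \<xi> x) \<and> (\<forall>x\<in>A. \<forall>y\<in>A. \<xi> (br x y) = comm (\<xi> x) (\<xi> y))"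

lemma lrep_lin: "lrep A \<xi> \<Longrightarrow> lin (\<xi> x)"
  and lrep_add: "lrep A \<xi> \<Longrightarrow> \<xi> (x + y) = \<xi> x + \<xi> y"
  and lrep_scale: "lrep A \<xi> \<Longrightarrow> \<xi> (c *s x) = scl c * \<xi> x"
  and lrep_br: "lrep A \<xi> \<Longrightarrow> x \<in> A \<Longrightarrow> y \<in> A \<Longrightarrow> \<xi> (br x y) = comm (\<xi> x) (\<xi> y)"
  and lrep_rep_on: "lrep A \<xi> \<Longrightarrow> B \<subseteq> A \<Longrightarrow> rep_on B \<xi>"
  unfolding lrep_def rep_on_def by blast+

lemma lrep_diff: "lrep A \<xi> \<Longrightarrow> \<xi> (x - y) = \<xi> x - \<xi> y"
  using lrep_add[of A \<xi> "x - y" y] by simp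

lemma lrep_zero: "lrep A \<xi> \<Longrightarrow> \<xi> 0 = 0"
  using lrep_diff[of A \<xi> 0 0] by simp

lemma lrep_sum: "lrep A \<xi> \<Longrightarrow> \<xi> (\<Sum>i\<in>I. f i) = (\<Sum>i\<in>I. \<xi> (f i))"
  by (induction I rule: infinite_finite_induct) (auto simp: lrep_add lrep_zero)

lemma tr_cyclic: "lin f \<Longrightarrow> lin g \<Longrightarrow> tr (f * g) = tr (g * f)"
  by (rule trace_cyclic) (auto simp: finite_Basis independent_Basis)

lemma tr_add: "lin f \<Longrightarrow> lin g \<Longrightarrow> tr (f + g) = tr f + tr g"
  and tr_diff: "lin f \<Longrightarrow> lin g \<Longrightarrow> tr (f - g) = tr f - tr g"
  and tr_scl: "lin f \<Longrightarrow> tr (scl a * f) = a * tr f"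
  by (simp_all add: trace_add trace_diff trace_scl independent_Basis)

lemma tr_sum: "(\<And>i. i \<in> I \<Longrightarrow> lin (f i)) \<Longrightarrow> tr (\<Sum>i\<in>I. f i) = (\<Sum>i\<in>I. tr (f i))"
  by (rule trace_sum) (auto simp: independent_Basis)

definition tform :: "('l \<Rightarrow> 'l endo) \<Rightarrow> 'l \<Rightarrow> 'l \<Rightarrow> 'f"
  where "tform \<xi> x y = tr (\<xi> x * \<xi> y)"

lemma bilin_tform: "lrep A \<xi> \<Longrightarrow> bilin (tform \<xi>)"
  unfolding bilin_def tform_def
  by (auto simp: lrep_add lrep_scale lrep_lin tr_add tr_scl distrib_right mult.assoc intro: tr_cyclic)

lemma tform_invariant:
  assumes "lrep A \<xi>" "x \<in> A" "y \<in> A" "z \<in> A"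
  shows "tform \<xi> (br x y) z = tform \<xi> x (br y z)"
proof -
  note l = lrep_lin[OF assms(1)]
  have "tr (\<xi> y * (\<xi> x * \<xi> z)) = tr (\<xi> x * \<xi> z * \<xi> y)"
    by (rule tr_cyclic) (simp_all add: l)
  then show ?thesis
    using assms by (simp add: tform_def lrep_br comm_def left_diff_distrib right_diff_distrib tr_diff l mult.assoc)
qed

lemma ideal_subspace: "ideal_of A I \<Longrightarrow> subspace I"
  and ideal_subset: "ideal_of A I \<Longrightarrow> I \<subseteq> A"
  and ideal_br: "ideal_of A I \<Longrightarrow> x \<in> A \<Longrightarrow> y \<in> I \<Longrightarrow> br x y \<in> I"
  by (auto simp: ideal_of_def)

lemma ideal_br_right: "ideal_of A I \<Longrightarrow> x \<in> A \<Longrightarrow> y \<in> I \<Longrightarrow> br y x \<in> I"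
  by (metis br_skew ideal_br ideal_subspace subspace_neg)

lemma ideal_subalgebra: "ideal_of A I \<Longrightarrow> subalgebra I"
  unfolding subalgebra_def ideal_of_def by blast

lemma ideal_brackets:
  assumes I: "ideal_of A I"
  shows "ideal_of A (span {br x y | x y. x \<in> I \<and> y \<in> I})"
  unfolding ideal_of_def
proof (intro conjI ballI)
  let ?S = "{br x y | x y. x \<in> I \<and> y \<in> I}"
  have "?S \<subseteq> I" using I by (auto simp: ideal_of_def)
  then show "span ?S \<subseteq> A" using I by (meson ideal_subset ideal_subspace order_trans span_minimal)
  fix x y assume x: "x \<in> A" and y: "y \<in> span ?S"
  have "ad x \<bullet> y \<in> span ?S"
  proof (rule span_closed_app[OF lin_ad _ subspace_span y])
    fix z assume "z \<in> ?S"
    then obtain a b where z: "z = br a b" "a \<in> I" "b \<in> I" by blast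
    have "br x z = br (br x a) b + br a (br x b)"
      unfolding z by (simp add: br_br_left)
    moreover have "br x a \<in> I" "br x b \<in> I" using ideal_br[OF I x] z by auto
    then have "br (br x a) b \<in> ?S" "br a (br x b) \<in> ?S" using z by blast+
    ultimately show "ad x \<bullet> z \<in> span ?S"
      by (simp add: span_add span_base)
  qed
  then show "br x y \<in> span ?S" by simp
qed (simp add: subspace_span)

lemma ideal_derived_series: "ideal_of A I \<Longrightarrow> ideal_of A (derived_series I n)"
  by (induction n) (simp_all add: ideal_brackets)

end

text \<open>The assumption \<open>radical\<close> expresses that \<open>A / J\<close> is semisimple:
  an ideal of \<open>A\<close> that becomes solvable modulo \<open>J\<close> lies in
  \<open>J\<close>.\<close>

locale lie_pair = fd_lie0 scale Basis br
  for scale :: "'f::field_char_0 \<Rightarrow> 'l::ab_group_add \<Rightarrow> 'l" (infixr \<open>*s\<close> 75)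
    and Basis and br :: "'l \<Rightarrow> 'l \<Rightarrow> 'l" +
  fixes A J :: "'l set"
  assumes A: "subalgebra A" and J: "ideal_of A J"
    and radical: "\<And>I n. ideal_of A I \<Longrightarrow> derived_series I n \<subseteq> J \<Longrightarrow> I \<subseteq> J"
begin

lemmas A_subspace = subalgebra_subspace[OF A]
lemmas J_subspace = ideal_subspace[OF J]
lemmas JA = ideal_subset[OF J]

definition "q = (SOME q. lin q \<and> (\<forall>v. q \<bullet> v \<in> A) \<and> (\<forall>j\<in>J. q \<bullet> j = 0) \<and> (\<forall>x\<in>A. q \<bullet> x - x \<in> J) \<and> q * q = q)"

lemma q: "lin q" "q \<bullet> v \<in> A" "j \<in> J \<Longrightarrow> q \<bullet> j = 0" "x \<in> A \<Longrightarrow> q \<bullet> x - x \<in> J" "q * q = q"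
proof -
  have "\<exists>q. lin q \<and> (\<forall>v. q \<bullet> v \<in> A) \<and> (\<forall>j\<in>J. q \<bullet> j = 0) \<and> (\<forall>x\<in>A. q \<bullet> x - x \<in> J) \<and> q * q = q"
    using complement_projection[OF A_subspace J_subspace JA] by metis
  from someI_ex[OF this] show "lin q" "q \<bullet> v \<in> A" "j \<in> J \<Longrightarrow> q \<bullet> j = 0"
    "x \<in> A \<Longrightarrow> q \<bullet> x - x \<in> J" "q * q = q"
    unfolding q_def[symmetric] by auto
qed

lemma q_eq: "x \<in> A \<Longrightarrow> y \<in> A \<Longrightarrow> x - y \<in> J \<Longrightarrow> q \<bullet> x = q \<bullet> y"
  using q(3)[of "x - y"] by simp

lemma q_0D: "x \<in> A \<Longrightarrow> q \<bullet> x = 0 \<Longrightarrow> x \<in> J"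
  using q(4)[of x] subspace_neg[OF J_subspace, of "- x"] by simp

text \<open>The adjoint representation of \<open>A\<close> on \<open>A / J\<close>, transported to the complement \<open>q(A)\<close> of \<open>J\<close>.\<close>

definition adj :: "'l \<Rightarrow> 'l endo"
  where "adj x = q * ad x * q"

lemma q_br_q: assumes "x \<in> A" "y \<in> A" shows "q \<bullet> br x (q \<bullet> y) = q \<bullet> br x y"
proof (rule q_eq)
  have "br x (q \<bullet> y - y) \<in> J" using assms q(4) by (intro ideal_br[OF J]) auto
  then show "br x (q \<bullet> y) - br x y \<in> J" by (simp add: br_diff_right)
qed (use assms q A in \<open>auto intro: subalgebra_br\<close>)

lemma lrep_adj: "lrep A adj"
  unfolding lrep_def
proof (intro conjI allI ballI)
  show "lin (adj x)" for x by (simp add: adj_def q)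
  show "adj (x + y) = adj x + adj y" for x y by (simp add: adj_def ad_add algebra_simps)
  show "adj (c *s x) = scl c * adj x" for c x
    using q(1) by (simp add: adj_def ad_scale lin_commute flip: mult.assoc)
  show "adj (br x y) = comm (adj x) (adj y)" if "x \<in> A" "y \<in> A" for x y
  proof (rule endo_eqI)
    fix v
    have "q \<bullet> q \<bullet> w = q \<bullet> w" for w using q(5) by (metis app_times)
    then have *: "adj x \<bullet> adj y \<bullet> v = q \<bullet> br x (br y (q \<bullet> v))" if "x \<in> A" "y \<in> A" for x y
      using that q(2) q_br_q[OF that(1)] subalgebra_br[OF A that(2)] by (simp add: adj_def)
    show "adj (br x y) \<bullet> v = comm (adj x) (adj y) \<bullet> v"
      using that by (simp add: comm_def *) (simp add: adj_def br_br_left)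
  qed
qed

lemma adj_J: assumes "j \<in> J" shows "adj j = 0"
proof (rule endo_eqI)
  fix v
  have "br j (q \<bullet> v) \<in> J" by (rule ideal_br_right[OF J q(2) assms])
  then show "adj j \<bullet> v = 0 \<bullet> v" by (simp add: adj_def q)
qed

abbreviation "\<kappa> \<equiv> tform adj"

lemmas bilin_\<kappa> = bilin_tform[OF lrep_adj]

lemma \<kappa>_J: "j \<in> J \<Longrightarrow> \<kappa> j x = 0" "j \<in> J \<Longrightarrow> \<kappa> x j = 0"
  by (simp_all add: tform_def adj_J independent_Basis)

text \<open>Cartan's criterion for \<open>A / J\<close>: some derived term of \<open>I\<close> acts
  trivially on \<open>A / J\<close>, so its brackets fall into \<open>J\<close> and \<open>I\<close>
  is solvable modulo \<open>J\<close>.\<close>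

lemma ideal_in_J:
  assumes I: "ideal_of A I" and "\<And>x y. x \<in> I \<Longrightarrow> y \<in> I \<Longrightarrow> \<kappa> x y = 0"
  shows "I \<subseteq> J"
proof -
  obtain k where k: "\<And>x. x \<in> derived_series I k \<Longrightarrow> adj x = 0"
    by (rule cartan_solvable[OF ideal_subalgebra[OF I] lrep_rep_on[OF lrep_adj ideal_subset[OF I]]])
      (use assms(2) in \<open>auto simp: tform_def\<close>)
  have DA: "derived_series I k \<subseteq> A"
    using ideal_subset[OF ideal_derived_series[OF I]] .
  have "br x y \<in> J" if "x \<in> derived_series I k" "y \<in> derived_series I k" for x y
  proof (rule q_0D)
    have xy: "x \<in> A" "y \<in> A" using that DA by auto
    show "br x y \<in> A" using xy A by (rule subalgebra_br[rotated])
    have "q \<bullet> br x y = adj x \<bullet> y" using xy by (simp add: adj_def q_br_q)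
    then show "q \<bullet> br x y = 0" using k[OF that(1)] by simp
  qed
  then have "derived_series I (Suc k) \<subseteq> J"
    unfolding derived_series.simps by (intro span_minimal J_subspace) auto
  then show ?thesis by (rule radical[OF I])
qed

definition perp :: "'l set \<Rightarrow> 'l set"
  where "perp D = {x \<in> A. \<forall>y\<in>D. \<kappa> x y = 0}"

lemma ideal_inter: "ideal_of A I \<Longrightarrow> ideal_of A K \<Longrightarrow> ideal_of A (I \<inter> K)"
  unfolding ideal_of_def by (auto intro: subspace_inter)

lemma ideal_perp:
  assumes D: "ideal_of A D" shows "ideal_of A (perp D)"
  unfolding ideal_of_def
proof (intro conjI ballI)
  show "subspace (perp D)"
    using A_subspace unfolding subspace_def perp_def
    by (auto simp: bilin_zero_left[OF bilin_\<kappa>] bilin_add_left[OF bilin_\<kappa>] bilin_scale_left[OF bilin_\<kappa>])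
  fix x y assume x: "x \<in> A" and y: "y \<in> perp D"
  have "\<kappa> (br x y) d = 0" if "d \<in> D" for d
  proof -
    have "\<kappa> (br x y) d = - \<kappa> (br y x) d"
      using bilin_scale_left[OF bilin_\<kappa>, of "- 1" "br y x" d] by (simp add: br_skew[of x])
    also have "\<kappa> (br y x) d = \<kappa> y (br x d)"
      using x y that ideal_subset[OF D] by (intro tform_invariant[OF lrep_adj]) (auto simp: perp_def)
    also have "\<dots> = 0" using ideal_br[OF D x that] y by (auto simp: perp_def)
    finally show ?thesis by simp
  qed
  then show "br x y \<in> perp D" using x y A by (auto simp: perp_def intro: subalgebra_br)
qed (auto simp: perp_def)

lemma inter_perp: assumes D: "ideal_of A D" shows "D \<inter> perp D \<subseteq> J"
  by (rule ideal_in_J[OF ideal_inter[OF D ideal_perp[OF D]]]) (auto simp: perp_def bilin_sym[OF bilin_\<kappa>])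

text \<open>On \<open>D\<close> the Killing form is nondegenerate modulo \<open>J\<close> by
  \<open>inter_perp\<close>, so \<open>d\<close> can be the orthogonal projection of
  \<open>x\<close>, written in dual bases. Orthogonality to the \<open>f j\<close> extends to
  \<open>D\<close> because the expansion errors lie in \<open>J\<close>, which
  \<open>\<kappa>\<close> ignores.\<close>

lemma perp_decomposition:
  assumes D: "ideal_of A D" and x: "x \<in> A"
  obtains d where "d \<in> D" "x - d \<in> perp D"
proof -
  note DA = ideal_subset[OF D] and Ds = ideal_subspace[OF D]
  have rad: "x \<in> J" if "x \<in> D" "\<And>y. y \<in> D \<Longrightarrow> \<kappa> x y = 0" for x
    using inter_perp[OF D] that DA by (auto simp: perp_def)
  obtain n e f where ef: "dual_system \<kappa> D n e f" "\<And>g. g \<in> D \<Longrightarrow> g - (\<Sum>i<n. \<kappa> (e i) g *s f i) \<in> J"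
    by (rule dual_bases[OF bilin_\<kappa> Ds rad]) auto
  define d where "d = (\<Sum>i<n. \<kappa> x (f i) *s e i)"
  have dD: "d \<in> D" unfolding d_def using ef(1)
    by (intro subspace_sum[OF Ds] subspace_scale[OF Ds]) (auto simp: dual_system_def)
  have df: "\<kappa> d (f j) = \<kappa> x (f j)" if "j < n" for j
  proof -
    have "\<kappa> d (f j) = (\<Sum>i<n. \<kappa> x (f i) * (if i = j then 1 else 0))"
      unfolding d_def bilin_sum_left[OF bilin_\<kappa>] bilin_scale_left[OF bilin_\<kappa>]
      using ef(1) that by (simp add: dual_system_def)
    then show ?thesis using that by (simp add: if_distrib[of "(*) _"] cong: if_cong)
  qed
  have "\<kappa> (x - d) y = 0" if "y \<in> D" for y
  proof -
    have "\<kappa> (x - d) (y - (\<Sum>i<n. \<kappa> (e i) y *s f i)) = 0" by (rule \<kappa>_J(2)[OF ef(2)[OF that]])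
    moreover have "\<kappa> (x - d) (\<Sum>i<n. \<kappa> (e i) y *s f i) = 0"
      unfolding bilin_sum_right[OF bilin_\<kappa>] bilin_scale_right[OF bilin_\<kappa>] bilin_diff_left[OF bilin_\<kappa>]
      by (simp add: df)
    ultimately show ?thesis by (simp add: bilin_diff_right[OF bilin_\<kappa>])
  qed
  then have "x - d \<in> perp D" using x dD DA by (auto simp: perp_def intro: subspace_diff[OF A_subspace])
  with dD show thesis by (rule that)
qed

text \<open>With \<open>D = [I, I]\<close>, the ideal \<open>I \<inter> perp D\<close> is abelian modulo \<open>J\<close>, hence contained in \<open>J\<close>.\<close>

lemma ideal_perfect:
  assumes I: "ideal_of A I" and x: "x \<in> I"
  obtains d where "d \<in> span {br x y | x y. x \<in> I \<and> y \<in> I}" "x - d \<in> J"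
proof -
  let ?D = "span {br x y | x y. x \<in> I \<and> y \<in> I}"
  note D = ideal_brackets[OF I]
  have DI: "?D \<subseteq> I" using I by (intro span_minimal) (auto simp: ideal_of_def)
  obtain d where d: "d \<in> ?D" "x - d \<in> perp ?D"
    using perp_decomposition[OF D] x ideal_subset[OF I] by blast
  let ?E = "I \<inter> perp ?D"
  have E: "ideal_of A ?E" by (rule ideal_inter[OF I ideal_perp[OF D]])
  have "br a b \<in> J" if "a \<in> ?E" "b \<in> ?E" for a b
  proof -
    have "br a b \<in> perp ?D" using that ideal_perp[OF D] ideal_subset[OF I] by (auto intro: ideal_br)
    moreover have "br a b \<in> ?D" using that by (auto intro: span_base)
    ultimately show ?thesis using inter_perp[OF D] by blast
  qed
  then have "derived_series ?E 1 \<subseteq> J" by (simp, intro span_minimal J_subspace) auto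
  then have "?E \<subseteq> J" by (rule radical[OF E])
  moreover have "x - d \<in> ?E" using x d DI I by (auto intro: subspace_diff ideal_subspace)
  ultimately show thesis using that d by blast
qed

text \<open>Iterating \<open>ideal_perfect\<close>, each element of \<open>I\<close> agrees modulo
  \<open>J\<close> with one of \<open>derived_series I k\<close>, and \<open>\<xi>\<close> vanishes
  on both.\<close>

lemma solvable_ideal_acts_trivially:
  assumes \<xi>: "lrep A \<xi>" "\<And>j. j \<in> J \<Longrightarrow> \<xi> j = 0" and I: "ideal_of A I"
    and k: "\<And>x. x \<in> derived_series I k \<Longrightarrow> \<xi> x = 0" and x: "x \<in> I"
  shows "\<xi> x = 0"
proof -
  have "\<exists>d\<in>derived_series I k. x - d \<in> J" if "x \<in> I" for x k
  proof (induction k)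
    case 0
    show ?case using that subspace_0[OF J_subspace] by (auto intro!: bexI[of _ x])
  next
    case (Suc k)
    then obtain d where d: "d \<in> derived_series I k" "x - d \<in> J" by blast
    obtain d' where d': "d' \<in> derived_series I (Suc k)" "d - d' \<in> J"
      by (rule ideal_perfect[OF ideal_derived_series[OF I, of k] d(1)]) auto
    have "x - d' \<in> J" using subspace_add[OF J_subspace d(2) d'(2)] by simp
    then show ?case using d' by blast
  qed
  then obtain d where "d \<in> derived_series I k" "x - d \<in> J" using x by blast
  then have "\<xi> d = 0" "\<xi> (x - d) = 0" using k \<xi> by auto
  then show ?thesis by (simp add: lrep_diff[OF \<xi>(1)])
qed

text \<open>By invariance the radical of the form is an ideal. Cartan's criterion makes one of its
  derived terms act as zero, and semisimplicity carries this back to the whole ideal.\<close>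

lemma tform_radical:
  assumes \<xi>: "lrep A \<xi>" "\<And>j. j \<in> J \<Longrightarrow> \<xi> j = 0"
    and x: "x \<in> A" "\<And>y. y \<in> A \<Longrightarrow> tform \<xi> x y = 0"
  shows "\<xi> x = 0"
proof -
  note b = bilin_tform[OF \<xi>(1)]
  let ?I = "{x \<in> A. \<forall>y\<in>A. tform \<xi> x y = 0}"
  have I: "ideal_of A ?I" unfolding ideal_of_def
  proof (intro conjI ballI)
    show "subspace ?I"
      using A_subspace unfolding subspace_def
      by (auto simp: bilin_zero_left[OF b] bilin_add_left[OF b] bilin_scale_left[OF b])
    fix x y assume x: "x \<in> A" and y: "y \<in> ?I"
    have "tform \<xi> (br y x) z = 0" if "z \<in> A" for z
      using x y that tform_invariant[OF \<xi>(1), of y x z] subalgebra_br[OF A x that] by auto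
    then have "tform \<xi> (br x y) z = 0" if "z \<in> A" for z
      using bilin_scale_left[OF b, of "- 1" "br y x" z] that by (simp add: br_skew[of x])
    then show "br x y \<in> ?I" using x y subalgebra_br[OF A] by auto
  qed auto
  obtain k where k: "\<And>x. x \<in> derived_series ?I k \<Longrightarrow> \<xi> x = 0"
  proof -
    have tr0: "tr (\<xi> x * \<xi> y) = 0" if "x \<in> ?I" "y \<in> ?I" for x y
      using that by (simp add: tform_def)
    show thesis
      by (rule cartan_solvable[OF ideal_subalgebra[OF I] lrep_rep_on[OF \<xi>(1) ideal_subset[OF I]] tr0])
        (assumption | rule that)+
  qed
  show ?thesis
    by (rule solvable_ideal_acts_trivially[OF \<xi> I k]) (use x in auto)
qed

end

section \<open>Splitting off the abelian part of the radical\<close>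

text \<open>The trace of a sum of operators of rank at most one. It reads a trace off an expansion
  in dual bases.\<close>

lemma (in fd_lie0) tr_expand:
  assumes "\<And>v. t \<bullet> v = (\<Sum>i\<in>I. \<phi> i v *s w i)"
    and "\<And>i x y. i \<in> I \<Longrightarrow> \<phi> i (x + y) = \<phi> i x + \<phi> i y" "\<And>i c x. i \<in> I \<Longrightarrow> \<phi> i (c *s x) = c * \<phi> i x"
  shows "tr t = (\<Sum>i\<in>I. \<phi> i (w i))"
proof -
  have zero: "\<phi> i 0 = 0" if "i \<in> I" for i using assms(3)[OF that, of 0 0] by simp
  have sum: "\<phi> i (\<Sum>b\<in>Basis. c b *s b) = (\<Sum>b\<in>Basis. c b * \<phi> i b)" if "i \<in> I" for i c
    using finite_Basis
    by (induction Basis rule: finite_induct) (simp_all add: zero that assms(2,3))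
  have "tr t = (\<Sum>b\<in>Basis. \<Sum>i\<in>I. \<phi> i b * representation Basis (w i) b)"
    unfolding trace_on_def assms(1)
    by (simp add: representation_sum representation_scale independent_Basis span_Basis)
  also have "\<dots> = (\<Sum>i\<in>I. \<Sum>b\<in>Basis. representation Basis (w i) b * \<phi> i b)"
    by (subst sum.swap) (simp add: mult.commute)
  also have "\<dots> = (\<Sum>i\<in>I. \<phi> i (\<Sum>b\<in>Basis. representation Basis (w i) b *s b))"
    by (simp add: sum)
  also have "\<dots> = (\<Sum>i\<in>I. \<phi> i (w i))"
    by (simp add: sum_representation_eq independent_Basis span_Basis finite_Basis)
  finally show ?thesis .
qed

section \<open>Casimir elements\<close>

context lie_pair
begin

text \<open>The ideal \<open>G\<close> allows for actions with a kernel, whose trace form is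
  nondegenerate modulo \<open>J\<close> only on a complement of that kernel.\<close>

definition casimir_data :: "('l \<Rightarrow> 'l endo) \<Rightarrow> 'l set \<Rightarrow> nat \<Rightarrow> (nat \<Rightarrow> 'l) \<Rightarrow> (nat \<Rightarrow> 'l) \<Rightarrow> bool"
  where "casimir_data \<xi> G n e f \<longleftrightarrow> ideal_of A G \<and> dual_system (tform \<xi>) G n e f \<and>
    (\<forall>g\<in>G. g - (\<Sum>i<n. tform \<xi> g (f i) *s e i) \<in> J) \<and> (\<forall>g\<in>G. g - (\<Sum>i<n. tform \<xi> (e i) g *s f i) \<in> J)"

context
  fixes \<xi> G n e f
  assumes \<xi>: "lrep A \<xi>" "\<forall>j\<in>J. \<xi> j = 0" and cd: "casimir_data \<xi> G n e f"
begin

lemma cd_G: "i < n \<Longrightarrow> e i \<in> G" "i < n \<Longrightarrow> f i \<in> G"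
  using cd by (auto simp: casimir_data_def dual_system_def)

lemma cd_A: "i < n \<Longrightarrow> e i \<in> A" "i < n \<Longrightarrow> f i \<in> A"
  using cd_G ideal_subset[of A G] cd unfolding casimir_data_def by blast+

lemma cd_ideal: "ideal_of A G"
  using cd by (simp add: casimir_data_def)

lemma cd_e:
  assumes "x \<in> A" "i < n"
  shows "br x (e i) - (\<Sum>j<n. tform \<xi> (br x (e i)) (f j) *s e j) \<in> J"
  using cd ideal_br[OF cd_ideal assms(1) cd_G(1)[OF assms(2)]] by (auto simp: casimir_data_def)

text \<open>Invariance of the form: modulo \<open>J\<close>, the matrix of \<open>ad x\<close> on
  the \<open>f i\<close> is minus the transpose of its matrix on the \<open>e i\<close>.\<close>

lemma cd_f:
  assumes "x \<in> A" "i < n"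
  shows "br x (f i) + (\<Sum>j<n. tform \<xi> (br x (e j)) (f i) *s f j) \<in> J"
proof -
  note b = bilin_tform[OF \<xi>(1)]
  have "tform \<xi> (e j) (br x (f i)) = - tform \<xi> (br x (e j)) (f i)" if "j < n" for j
  proof -
    have "tform \<xi> (e j) (br x (f i)) = tform \<xi> (br (e j) x) (f i)"
      by (rule tform_invariant[OF \<xi>(1), symmetric]) (use assms that cd_A in auto)
    also have "\<dots> = - tform \<xi> (br x (e j)) (f i)"
      using bilin_scale_left[OF b, of "- 1" "br x (e j)" "f i"] by (simp add: br_skew[of "e j" x])
    finally show ?thesis .
  qed
  then have "(\<Sum>j<n. tform \<xi> (e j) (br x (f i)) *s f j) = - (\<Sum>j<n. tform \<xi> (br x (e j)) (f i) *s f j)"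
    by (simp add: sum_negf)
  moreover have "br x (f i) - (\<Sum>j<n. tform \<xi> (e j) (br x (f i)) *s f j) \<in> J"
    using cd ideal_br[OF cd_ideal assms(1) cd_G(2)[OF assms(2)]] by (auto simp: casimir_data_def)
  ultimately show ?thesis by simp
qed

text \<open>Invariance of the element \<open>\<Sum>i. e i \<otimes> f i\<close>, tested by a
  bilinear map \<open>B\<close> instead of being stated in a tensor product. As the bases are dual
  only modulo \<open>J\<close>, the map has to vanish there; then the two transposed matrices
  cancel.\<close>

lemma casimir_invariant:
  fixes B :: "'l \<Rightarrow> 'l \<Rightarrow> 'l"
  assumes x: "x \<in> A"
    and add: "\<And>a b c. B (a + b) c = B a c + B b c" "\<And>a b c. B a (b + c) = B a b + B a c"
    and sc: "\<And>r a b. B (r *s a) b = r *s B a b" "\<And>r a b. B a (r *s b) = r *s B a b"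
    and J0: "\<And>a b. a \<in> J \<Longrightarrow> b \<in> A \<Longrightarrow> B a b = 0" "\<And>a b. a \<in> A \<Longrightarrow> b \<in> J \<Longrightarrow> B a b = 0"
  shows "(\<Sum>i<n. B (br x (e i)) (f i) + B (e i) (br x (f i))) = 0"
proof -
  let ?a = "\<lambda>i j. tform \<xi> (br x (e i)) (f j)"
  have z: "B 0 c = 0" "B c 0 = 0" for c using sc(1)[of 0 c c] sc(2)[of c 0 c] by simp_all
  have sum: "B (\<Sum>i\<in>I. g i) c = (\<Sum>i\<in>I. B (g i) c)" "B c (\<Sum>i\<in>I. g i) = (\<Sum>i\<in>I. B c (g i))"
    for g :: "nat \<Rightarrow> 'l" and I c
    by (induction I rule: infinite_finite_induct) (simp_all add: z add)
  have 1: "B (br x (e i)) (f i) = (\<Sum>j<n. ?a i j *s B (e j) (f i))" if "i < n" for i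
  proof -
    have "B (br x (e i)) (f i) = B (br x (e i) - (\<Sum>j<n. ?a i j *s e j)) (f i) + B (\<Sum>j<n. ?a i j *s e j) (f i)"
      by (simp flip: add(1))
    then show ?thesis using J0(1)[OF cd_e[OF x that] cd_A(2)[OF that]] by (simp add: sum sc)
  qed
  have 2: "B (e i) (br x (f i)) = - (\<Sum>j<n. ?a j i *s B (e i) (f j))" if "i < n" for i
  proof -
    have "B (e i) (br x (f i)) + B (e i) (\<Sum>j<n. ?a j i *s f j) = 0"
      using J0(2)[OF cd_A(1)[OF that] cd_f[OF x that]] by (simp flip: add(2))
    then show ?thesis by (simp add: sum sc eq_neg_iff_add_eq_0)
  qed
  have "(\<Sum>i<n. B (br x (e i)) (f i) + B (e i) (br x (f i)))
    = (\<Sum>i<n. \<Sum>j<n. ?a i j *s B (e j) (f i)) - (\<Sum>i<n. \<Sum>j<n. ?a j i *s B (e i) (f j))"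
    by (simp add: 1 2 sum_subtractf)
  also have "\<dots> = 0" by (subst sum.swap) simp
  finally show ?thesis .
qed

end

lemma adj_J_all: "\<forall>j\<in>J. adj j = 0"
  by (simp add: adj_J)

lemma ideal_A: "ideal_of A A"
  using A by (auto simp: ideal_of_def subalgebra_def)

lemma adj_adj: "x \<in> A \<Longrightarrow> y \<in> A \<Longrightarrow> adj x * adj y \<bullet> v = q \<bullet> br x (br y (q \<bullet> v))"
proof -
  assume "x \<in> A" "y \<in> A"
  moreover have "q \<bullet> q \<bullet> w = q \<bullet> w" for w using q(5) by (metis app_times)
  ultimately show ?thesis using q(2) q_br_q subalgebra_br[OF A] by (simp add: adj_def)
qed

text \<open>Equality modulo \<open>J\<close> is tested with \<open>\<kappa>\<close>. Invariance
  turns the pairing of \<open>[e i, [f i, y]]\<close> with \<open>w\<close> into that of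
  \<open>[y, [w, e i]]\<close> with \<open>f i\<close>, and the sum of the latter is the trace of
  \<open>adj y * adj w\<close>, that is \<open>\<kappa> y w\<close>.\<close>

lemma casimir_adj:
  obtains n e f where "casimir_data adj A n e f"
    "\<And>y. y \<in> A \<Longrightarrow> (\<Sum>i<n. br (e i) (br (f i) y)) - y \<in> J"
proof -
  note b = bilin_\<kappa>
  have rad: "x \<in> J" if "x \<in> A" "\<And>y. y \<in> A \<Longrightarrow> \<kappa> x y = 0" for x
    using inter_perp[OF ideal_A] that by (auto simp: perp_def)
  obtain n e f where ef: "dual_system \<kappa> A n e f"
    "\<And>g. g \<in> A \<Longrightarrow> g - (\<Sum>i<n. \<kappa> g (f i) *s e i) \<in> J"
    "\<And>g. g \<in> A \<Longrightarrow> g - (\<Sum>i<n. \<kappa> (e i) g *s f i) \<in> J"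
    by (rule dual_bases[OF b A_subspace rad]) (assumption | rule that)+
  have efA: "e i \<in> A" "f i \<in> A" if "i < n" for i
    using ef(1) that by (auto simp: dual_system_def)
  have cd: "casimir_data adj A n e f" using ef ideal_A by (simp add: casimir_data_def)
  moreover have "(\<Sum>i<n. br (e i) (br (f i) y)) - y \<in> J" if y: "y \<in> A" for y
  proof (rule rad)
    show "(\<Sum>i<n. br (e i) (br (f i) y)) - y \<in> A"
      using y efA by (intro subspace_diff[OF A_subspace] subspace_sum[OF A_subspace]) (auto intro!: subalgebra_br[OF A])
    fix w assume w: "w \<in> A"
    have 1: "\<kappa> (br (e i) (br (f i) y)) w = \<kappa> (br y (br w (e i))) (f i)" if "i < n" for i
    proof -
      note i = efA[OF that]
      have neg: "\<kappa> (- a) c = - \<kappa> a c" "\<kappa> a (- c) = - \<kappa> a c" for a c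
        using bilin_scale_left[OF b, of "- 1"] bilin_scale_right[OF b, of _ "- 1"] by simp_all
      have "\<kappa> (br (e i) (br (f i) y)) w = - \<kappa> (br (br (f i) y) (e i)) w"
        by (subst br_skew) (simp add: neg)
      also have "\<dots> = - \<kappa> (br (f i) y) (br (e i) w)"
        using i y w by (subst tform_invariant[OF lrep_adj]) (auto intro: subalgebra_br[OF A])
      also have "\<dots> = - \<kappa> (f i) (br y (br (e i) w))"
        using i y w by (subst tform_invariant[OF lrep_adj]) (auto intro: subalgebra_br[OF A])
      also have "\<dots> = \<kappa> (f i) (br y (br w (e i)))"
        by (subst br_skew[of "e i" w]) (simp add: neg)
      finally show ?thesis using bilin_sym[OF b] by simp
    qed
    have "adj y * adj w \<bullet> v = (\<Sum>i<n. \<kappa> (br y (br w (q \<bullet> v))) (f i) *s (q \<bullet> e i))" for v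
    proof -
      let ?z = "br y (br w (q \<bullet> v))"
      have z: "?z \<in> A" using y w q(2) by (auto intro: subalgebra_br[OF A])
      have "q \<bullet> (?z - (\<Sum>i<n. \<kappa> ?z (f i) *s e i)) = 0" by (rule q(3)[OF ef(2)[OF z]])
      then show ?thesis unfolding adj_adj[OF y w] using q(1) by (simp add: app_sum lin_scale)
    qed
    then have "tr (adj y * adj w) = (\<Sum>i<n. \<kappa> (br y (br w (q \<bullet> q \<bullet> e i))) (f i))"
      by (rule tr_expand) (simp_all add: br_add_right bilin_add_left[OF b] lin_scale[OF q(1)] br_scale_right bilin_scale_left[OF b])
    also have "\<dots> = (\<Sum>i<n. \<kappa> (br y (br w (e i))) (f i))"
    proof (rule sum.cong)
      fix i assume "i \<in> {..<n}"
      then have i: "e i \<in> A" "f i \<in> A" using efA by auto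
      have qq: "q \<bullet> q \<bullet> e i = q \<bullet> e i" using q(5) by (metis app_times)
      have "br y (br w (q \<bullet> e i - e i)) \<in> J"
        using y w q(4)[OF i(1)] by (intro ideal_br[OF J]) auto
      then have "\<kappa> (br y (br w (q \<bullet> e i - e i))) (f i) = 0" by (rule \<kappa>_J)
      then show "\<kappa> (br y (br w (q \<bullet> q \<bullet> e i))) (f i) = \<kappa> (br y (br w (e i))) (f i)"
        unfolding qq by (simp add: br_diff_right bilin_diff_left[OF b])
    qed simp
    finally have "\<kappa> y w = (\<Sum>i<n. \<kappa> (br (e i) (br (f i) y)) w)"
      by (simp add: tform_def[of adj y w] 1)
    then show "\<kappa> ((\<Sum>i<n. br (e i) (br (f i) y)) - y) w = 0"
      by (simp add: bilin_diff_left[OF b] bilin_sum_left[OF b])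
  qed
  ultimately show thesis by (rule that)
qed

end

section \<open>Cocycles with values in an abelian quotient of ideals\<close>

locale lie_triple = lie_pair scale Basis br A J
  for scale :: "'f::field_char_0 \<Rightarrow> 'l::ab_group_add \<Rightarrow> 'l" (infixr \<open>*s\<close> 75)
    and Basis and br :: "'l \<Rightarrow> 'l \<Rightarrow> 'l" and A J +
  fixes J' :: "'l set"
  assumes J': "ideal_of A J'" "J' \<subseteq> J" and JJ: "\<And>x y. x \<in> J \<Longrightarrow> y \<in> J \<Longrightarrow> br x y \<in> J'"
begin

definition "u = (SOME u. lin u \<and> (\<forall>v. u \<bullet> v \<in> J) \<and> (\<forall>j\<in>J'. u \<bullet> j = 0) \<and> (\<forall>x\<in>J. u \<bullet> x - x \<in> J') \<and> u * u = u)"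

lemma u: "lin u" "u \<bullet> v \<in> J" "j \<in> J' \<Longrightarrow> u \<bullet> j = 0" "x \<in> J \<Longrightarrow> u \<bullet> x - x \<in> J'" "u * u = u"
proof -
  have "\<exists>u. lin u \<and> (\<forall>v. u \<bullet> v \<in> J) \<and> (\<forall>j\<in>J'. u \<bullet> j = 0) \<and> (\<forall>x\<in>J. u \<bullet> x - x \<in> J') \<and> u * u = u"
    using complement_projection[OF J_subspace ideal_subspace[OF J'(1)] J'(2)] by metis
  from someI_ex[OF this] show "lin u" "u \<bullet> v \<in> J" "j \<in> J' \<Longrightarrow> u \<bullet> j = 0"
    "x \<in> J \<Longrightarrow> u \<bullet> x - x \<in> J'" "u * u = u"
    unfolding u_def[symmetric] by auto
qed

lemma uu [simp]: "u \<bullet> u \<bullet> w = u \<bullet> w"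
  using u(5) by (metis app_times)

text \<open>The action of \<open>A\<close> on the abelian quotient \<open>J / J'\<close>, transported to the complement \<open>u(J)\<close> of \<open>J'\<close>.\<close>

definition act :: "'l \<Rightarrow> 'l endo"
  where "act x = u * ad x * u"

lemma u_br_u: assumes "x \<in> A" "y \<in> J" shows "u \<bullet> br x (u \<bullet> y) = u \<bullet> br x y"
proof -
  have "br x (u \<bullet> y - y) \<in> J'" using assms u(4) by (intro ideal_br[OF J'(1)]) auto
  then have "u \<bullet> br x (u \<bullet> y - y) = 0" by (rule u(3))
  then show ?thesis by (simp add: br_diff_right)
qed

lemma act_app: "x \<in> A \<Longrightarrow> y \<in> J \<Longrightarrow> act x \<bullet> y = u \<bullet> br x y"
  by (simp add: act_def u_br_u)

lemma lrep_act: "lrep A act"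
  unfolding lrep_def
proof (intro conjI allI ballI)
  show "lin (act x)" for x by (simp add: act_def u)
  show "act (x + y) = act x + act y" for x y by (simp add: act_def ad_add algebra_simps)
  show "act (c *s x) = scl c * act x" for c x
    using u(1) by (simp add: act_def ad_scale lin_commute flip: mult.assoc)
  show "act (br x y) = comm (act x) (act y)" if "x \<in> A" "y \<in> A" for x y
  proof (rule endo_eqI)
    fix v
    have *: "act x \<bullet> act y \<bullet> v = u \<bullet> br x (br y (u \<bullet> v))" if "x \<in> A" "y \<in> A" for x y
      using that u(2) u_br_u[OF that(1)] ideal_br[OF J that(2)] by (simp add: act_def)
    show "act (br x y) \<bullet> v = comm (act x) (act y) \<bullet> v"
      using that by (simp add: comm_def *) (simp add: act_def br_br_left)
  qed
qed

lemma act_J: assumes "j \<in> J" shows "act j = 0"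
  by (rule endo_eqI) (simp add: act_def u(3)[OF JJ[OF assms u(2)]])

text \<open>\<open>p\<close> is a 1-cocycle of \<open>A\<close> with values in \<open>J / J'\<close> that extends the restriction of \<open>\<pi>\<close> to \<open>J\<close>;
  for \<open>\<pi> = u\<close> its kernel modulo \<open>J'\<close> is the complement of \<open>J / J'\<close> in \<open>A / J'\<close>.\<close>

definition split_at :: "'l endo \<Rightarrow> 'l endo \<Rightarrow> bool"
  where "split_at \<pi> p \<longleftrightarrow> lin p \<and> u * p = p \<and> (\<forall>j\<in>J. p \<bullet> j = \<pi> \<bullet> j) \<and>
    (\<forall>x\<in>A. \<forall>y\<in>A. p \<bullet> br x y = act x \<bullet> p \<bullet> y - act y \<bullet> p \<bullet> x)"

text \<open>Idempotent endomorphisms of the \<open>A\<close>-module \<open>J / J'\<close>. Their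
  ranges are direct summands, and the induction is on the size of the summand.\<close>

definition act_idempotent :: "'l endo \<Rightarrow> bool"
  where "act_idempotent \<pi> \<longleftrightarrow> lin \<pi> \<and> \<pi> * \<pi> = \<pi> \<and> \<pi> * u = \<pi> \<and> u * \<pi> = \<pi> \<and> (\<forall>x\<in>A. \<pi> * act x = act x * \<pi>)"

text \<open>The map \<open>\<phi> - \<phi> \<circ> cs\<close> vanishes on brackets because the Casimir element \<open>cs\<close> of the Killing form
  acts on \<open>A / J\<close> as the identity.\<close>

lemma split_trivial:
  assumes \<pi>: "act_idempotent \<pi>" and triv: "\<And>x. x \<in> A \<Longrightarrow> act x * \<pi> = 0"
  shows "\<exists>p. split_at \<pi> p"
proof -
  obtain n e f where cd: "casimir_data adj A n e f"
    and cas: "\<And>y. y \<in> A \<Longrightarrow> (\<Sum>i<n. br (e i) (br (f i) y)) - y \<in> J"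
    using casimir_adj by blast
  note efA = cd_A[OF lrep_adj adj_J_all cd]
  define cs where "cs = (\<Sum>i<n. ad (e i) * ad (f i))"
  have cs: "cs \<bullet> y = (\<Sum>i<n. br (e i) (br (f i) y))" for y
    by (simp add: cs_def app_sum_endo)
  \<comment> \<open>Extends \<open>\<pi>\<close> from \<open>J\<close> to \<open>A\<close> by zero
    on the complement chosen by \<open>q\<close>.\<close>
  define \<phi> where "\<phi> = \<pi> * (1 - q)"
  have l\<phi>: "lin \<phi>" using \<pi> q by (simp add: \<phi>_def act_idempotent_def)
  have \<phi>J: "\<phi> \<bullet> j = \<pi> \<bullet> j" if "j \<in> J" for j using that by (simp add: \<phi>_def q)
  have \<pi>act: "\<pi> \<bullet> act x \<bullet> v = 0" "act x \<bullet> \<pi> \<bullet> v = 0" if "x \<in> A" for x v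
    using triv[OF that] \<pi> that unfolding act_idempotent_def by (metis app_times app_zero_endo)+
  have \<phi>1: "\<phi> \<bullet> br x j = 0" if "x \<in> A" "j \<in> J" for x j
  proof -
    have "\<phi> \<bullet> br x j = \<pi> \<bullet> br x j" by (rule \<phi>J) (rule ideal_br[OF J that])
    also have "\<dots> = \<pi> \<bullet> u \<bullet> br x j" using \<pi> unfolding act_idempotent_def by (metis app_times)
    also have "\<dots> = 0" using \<pi>act that by (simp flip: act_app)
    finally show ?thesis .
  qed
  have \<phi>2: "\<phi> \<bullet> br j x = 0" if "x \<in> A" "j \<in> J" for x j
    using \<phi>1[OF that] by (simp add: br_skew[of j])
  have inv: "\<phi> \<bullet> cs \<bullet> br x y = \<phi> \<bullet> br x (cs \<bullet> y)" if x: "x \<in> A" and y: "y \<in> A" for x y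
  proof -
    let ?B = "\<lambda>a b. \<phi> \<bullet> br a (br b y)"
    have "(\<Sum>i<n. ?B (br x (e i)) (f i) + ?B (e i) (br x (f i))) = 0"
    proof (rule casimir_invariant[OF lrep_adj adj_J_all cd x])
      show "?B a b = 0" if "a \<in> J" "b \<in> A" for a b
        using that y by (intro \<phi>2) (auto intro: subalgebra_br[OF A])
      show "?B a b = 0" if "a \<in> A" "b \<in> J" for a b
        using that y by (intro \<phi>1) (auto intro: ideal_br_right[OF J])
    qed (simp_all add: br_add_left br_add_right br_scale_left br_scale_right lin_scale[OF l\<phi>])
    moreover have "br x (br (e i) (br (f i) y)) = br (e i) (br (f i) (br x y))
      + (br (br x (e i)) (br (f i) y) + br (e i) (br (br x (f i)) y))" for i
      by (simp add: br_br_left br_diff_right)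
    ultimately show ?thesis
      unfolding cs br_sum_right app_sum by (simp add: sum.distrib)
  qed
  \<comment> \<open>On \<open>J\<close> the correction is invisible: \<open>cs\<close> leads to
    brackets of \<open>A\<close> with \<open>J\<close>, which \<open>\<phi>\<close> kills.\<close>
  define p where "p = \<phi> - \<phi> * cs"
  have "split_at \<pi> p"
    unfolding split_at_def
  proof (intro conjI ballI)
    show "lin p" unfolding p_def cs_def using l\<phi> by (intro lin_minus lin_times lin_sum) auto
    have u\<pi>: "u \<bullet> \<pi> \<bullet> v = \<pi> \<bullet> v" for v using \<pi> unfolding act_idempotent_def by (metis app_times)
    show "u * p = p" by (rule endo_eqI) (simp add: p_def \<phi>_def u\<pi>)
    show "p \<bullet> j = \<pi> \<bullet> j" if "j \<in> J" for j
    proof -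
      have "\<phi> \<bullet> cs \<bullet> j = 0"
        unfolding cs app_sum using efA that by (intro sum.neutral ballI \<phi>1 ideal_br[OF J]) auto
      then show ?thesis by (simp add: p_def \<phi>J[OF that])
    qed
    fix x y assume x: "x \<in> A" and y: "y \<in> A"
    have "\<phi> \<bullet> br x (cs \<bullet> y - y) = 0" by (rule \<phi>1[OF x]) (use cas[OF y] cs in simp)
    then have "p \<bullet> br x y = 0" by (simp add: p_def inv[OF x y] br_diff_right)
    moreover have "act x \<bullet> p \<bullet> y = 0" if "x \<in> A" for x y
      using \<pi>act(2)[OF that] by (simp add: p_def \<phi>_def)
    ultimately show "p \<bullet> br x y = act x \<bullet> p \<bullet> y - act y \<bullet> p \<bullet> x" using x y by simp
  qed
  then show ?thesis ..
qed

lemma subspace_range: "lin f \<Longrightarrow> subspace (range (app f))"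
  using subspace_image_app[of f UNIV] by simp

lemma dim_range_less:
  assumes "lin f" "lin g" "range (app f) \<subseteq> range (app g)" "v \<in> range (app g)" "v \<notin> range (app f)"
  shows "dim (range (app f)) < dim (range (app g))"
proof (rule ccontr)
  assume "\<not> ?thesis"
  then have "range (app f) = range (app g)"
    using subspace_range assms by (intro subspace_dim_equal) auto
  then show False using assms by blast
qed

text \<open>Let \<open>e\<close>, \<open>f\<close> be dual bases for the trace form of the action \<open>Y\<close> on the image of \<open>\<pi>\<close>, with Casimir
  operator \<open>C = (\<Sum>i. Y (e i) * Y (f i))\<close>. The span of the \<open>f i\<close> is stable under \<open>A\<close> only modulo \<open>J\<close>;
  \<open>g i x\<close> is the component in \<open>J\<close> of \<open>[x, f i]\<close>, and \<open>x \<mapsto> (\<Sum>i. Y (e i) (g i x))\<close> is a cocycle that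
  restricts to \<open>- C\<close> on \<open>J\<close>. As \<open>tr C \<noteq> 0\<close>, the operator \<open>C\<close> is invertible on the image of an
  idempotent \<open>E \<noteq> 0\<close>, which leaves the smaller idempotent \<open>\<pi> - E\<close>.\<close>

lemma split_step:
  assumes \<pi>: "act_idempotent \<pi>" and x0: "x0 \<in> A" "act x0 * \<pi> \<noteq> 0"
    and IH: "\<And>\<pi>'. act_idempotent \<pi>' \<Longrightarrow> dim (range (app \<pi>')) < dim (range (app \<pi>)) \<Longrightarrow> \<exists>p. split_at \<pi>' p"
  shows "\<exists>p. split_at \<pi> p"
proof -
  have l\<pi>: "lin \<pi>" and \<pi>\<pi>: "\<pi> * \<pi> = \<pi>" and \<pi>u: "\<pi> * u = \<pi>" and u\<pi>: "u * \<pi> = \<pi>"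
    and \<pi>c: "\<And>x. x \<in> A \<Longrightarrow> \<pi> * act x = act x * \<pi>"
    using \<pi> by (auto simp: act_idempotent_def)
  have lact: "lin (act x)" for x by (rule lrep_lin[OF lrep_act])
  define Y where "Y x = \<pi> * act x" for x
  have lY: "lin (Y x)" for x by (simp add: Y_def l\<pi> lact)
  have \<pi>Y: "\<pi> * Y x = Y x" for x unfolding Y_def by (simp add: \<pi>\<pi> flip: mult.assoc)
  have Y\<pi>: "Y x * \<pi> = Y x" and actY: "act x * \<pi> = Y x" if "x \<in> A" for x
    unfolding Y_def using \<pi>c[OF that] \<pi>\<pi> by (metis mult.assoc)+
  have Yact: "Y a * act x = Y a * Y x" "act x * Y a = Y x * Y a" if "a \<in> A" "x \<in> A" for a x
  proof -
    show "Y a * act x = Y a * Y x" using Y\<pi>[OF that(1)] by (metis Y_def mult.assoc)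
    show "act x * Y a = Y x * Y a" using \<pi>Y[of a] actY[OF that(2)] by (metis mult.assoc)
  qed
  have lrepY: "lrep A Y"
    unfolding lrep_def
  proof (intro conjI allI ballI)
    show "Y (x + y) = Y x + Y y" for x y by (simp add: Y_def lrep_add[OF lrep_act] distrib_left)
    show "Y (c *s x) = scl c * Y x" for c x
      using l\<pi> by (simp add: Y_def lrep_scale[OF lrep_act] lin_commute flip: mult.assoc)
    show "Y (br x y) = comm (Y x) (Y y)" if "x \<in> A" "y \<in> A" for x y
    proof -
      have "Y (br x y) = Y x * act y - Y y * act x"
        using that by (simp add: Y_def lrep_br[OF lrep_act] comm_def right_diff_distrib mult.assoc)
      then show ?thesis using that by (simp add: Yact comm_def)
    qed
  qed (rule lY)
  have YJ: "Y j = 0" if "j \<in> J" for j using that by (simp add: Y_def act_J)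
  then have YJa: "\<forall>j\<in>J. Y j = 0" by blast
  note b = bilin_tform[OF lrepY]
  define k where "k = {x \<in> A. Y x = 0}"
  have k: "ideal_of A k"
    unfolding ideal_of_def k_def using A A_subspace
    by (auto simp: subspace_def subalgebra_br lrep_zero[OF lrepY] lrep_add[OF lrepY] lrep_scale[OF lrepY]
        lrep_br[OF lrepY] comm_def)
  \<comment> \<open>Orthogonal for the Killing form to the kernel of \<open>Y\<close>:
    \<open>k\<close> and \<open>G\<close> span \<open>A\<close> and overlap inside \<open>J\<close>.
    Hence \<open>Y\<close> is faithful on \<open>G\<close> modulo \<open>J\<close>, and its trace
    form is nondegenerate there modulo \<open>J\<close>.\<close>
  define G where "G = perp k"
  have G: "ideal_of A G" unfolding G_def by (rule ideal_perp[OF k])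
  have rad: "x \<in> J" if "x \<in> G" "\<And>y. y \<in> G \<Longrightarrow> tform Y x y = 0" for x
  proof -
    have xA: "x \<in> A" using that(1) ideal_subset[OF G] by auto
    have "tform Y x y = 0" if y: "y \<in> A" for y
    proof -
      obtain d where d: "d \<in> k" "y - d \<in> G" using perp_decomposition[OF k y] unfolding G_def by blast
      have "tform Y x d = 0" using d(1) by (simp add: tform_def k_def independent_Basis)
      then show ?thesis using that(1) \<open>\<And>y. y \<in> G \<Longrightarrow> tform Y x y = 0\<close>[OF d(2)] by (simp add: bilin_diff_right[OF b])
    qed
    then have "Y x = 0" by (intro tform_radical[OF lrepY YJ xA])
    then show ?thesis using inter_perp[OF k] that(1) xA by (auto simp: k_def G_def)
  qed
  obtain n e f where ef: "dual_system (tform Y) G n e f"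
    "\<And>g. g \<in> G \<Longrightarrow> g - (\<Sum>i<n. tform Y g (f i) *s e i) \<in> J"
    "\<And>g. g \<in> G \<Longrightarrow> g - (\<Sum>i<n. tform Y (e i) g *s f i) \<in> J"
    by (rule dual_bases[OF b ideal_subspace[OF G] rad]) (assumption | rule that)+
  have cd: "casimir_data Y G n e f" using ef G by (simp add: casimir_data_def)
  note efA = cd_A[OF lrepY YJa cd] and cde = cd_e[OF lrepY YJa cd] and cdf = cd_f[OF lrepY YJa cd]
  \<comment> \<open>Otherwise \<open>G\<close> would lie in \<open>J\<close> and \<open>Y\<close>
    would vanish on all of \<open>A\<close>, against the choice of \<open>x0\<close>.\<close>
  have "n \<noteq> 0"
  proof
    assume "n = 0"
    then have GJ: "g \<in> J" if "g \<in> G" for g using ef(2)[OF that] by simp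
    obtain d where d: "d \<in> k" "x0 - d \<in> G" using perp_decomposition[OF k x0(1)] unfolding G_def by blast
    have "Y x0 = Y d + Y (x0 - d)" by (simp flip: lrep_add[OF lrepY])
    then have "Y x0 = 0" using d YJ GJ by (simp add: k_def)
    then show False using actY x0 by simp
  qed
  define C where "C = (\<Sum>i<n. Y (e i) * Y (f i))"
  have lC: "lin C" unfolding C_def by (intro lin_sum lin_times lY)
  have "tr C = (\<Sum>i<n. tform Y (e i) (f i))" unfolding C_def tform_def by (intro tr_sum lin_times lY)
  also have "\<dots> = of_nat n" using ef(1) by (simp add: dual_system_def)
  finally have trC: "tr C \<noteq> 0" using \<open>n \<noteq> 0\<close> by simp
  have \<pi>C: "\<pi> * C = C" unfolding C_def by (simp add: sum_distrib_left \<pi>Y flip: mult.assoc)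
  have C\<pi>: "C * \<pi> = C" unfolding C_def sum_distrib_right
    by (rule sum.cong) (use efA in \<open>auto simp: Y\<pi> mult.assoc\<close>)
  have Cact: "C * act x = act x * C" if x: "x \<in> A" for x
  proof -
    have "Y x * C = C * Y x"
    proof (rule endo_eqI)
      fix v
      let ?B = "\<lambda>a c. Y a \<bullet> Y c \<bullet> v"
      have "(\<Sum>i<n. ?B (br x (e i)) (f i) + ?B (e i) (br x (f i))) = 0"
        by (rule casimir_invariant[OF lrepY YJa cd x])
          (simp_all add: lrep_add[OF lrepY] lrep_scale[OF lrepY] lin_scale[OF lY] YJ)
      moreover have "?B (br x (e i)) (f i) + ?B (e i) (br x (f i))
        = Y x \<bullet> Y (e i) \<bullet> Y (f i) \<bullet> v - Y (e i) \<bullet> Y (f i) \<bullet> Y x \<bullet> v" if "i < n" for i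
        using x efA[OF that] by (simp add: lrep_br[OF lrepY] comm_def)
      ultimately show "Y x * C \<bullet> v = C * Y x \<bullet> v"
        by (simp add: C_def app_sum_endo app_sum sum_subtractf)
    qed
    moreover have "act x * C = Y x * C" using \<pi>C actY[OF x] by (metis mult.assoc)
    moreover have "C * act x = C * Y x" using C\<pi> by (metis Y_def mult.assoc)
    ultimately show ?thesis by simp
  qed
  obtain m where m: "m \<noteq> 0" "peval m C = 0" using annihilating_poly[OF lC] .
  obtain d bb where db: "C * peval d C * (C * peval d C) = C * peval d C" "C ^ bb * (1 - C * peval d C) = 0"
    using fitting[OF lC m] by blast
  \<comment> \<open>Inverts \<open>C\<close> on the range of the Fitting idempotent
    \<open>E\<close>; being a polynomial in \<open>C\<close>, it commutes with the action.\<close>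
  define D where "D = peval d C"
  define E where "E = C * D"
  have lD: "lin D" and lE: "lin E" using lC by (simp_all add: D_def E_def)
  have EE: "E * E = E" using db by (simp add: E_def D_def)
  have CD: "C * D = D * C" unfolding D_def by (rule peval_commute[OF lC refl])
  have "E \<noteq> 0"
  proof
    assume "E = 0"
    then have "C ^ bb = 0" using db by (simp add: E_def D_def)
    then have "tr C = 0" using lC finite_Basis independent_Basis by (intro trace_nilpotent[of Basis C bb]) auto
    then show False using trC by simp
  qed
  have \<pi>D: "\<pi> * D = D * \<pi>" unfolding D_def by (rule peval_commute[OF l\<pi>]) (simp add: \<pi>C C\<pi>)
  have Dact: "act x * D = D * act x" if "x \<in> A" for x
    unfolding D_def by (rule peval_commute[OF lact]) (simp add: Cact[OF that])
  have \<pi>E: "\<pi> * E = E" unfolding E_def by (simp add: \<pi>C flip: mult.assoc)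
  have E\<pi>: "E * \<pi> = E" unfolding E_def by (metis C\<pi> \<pi>D mult.assoc)
  have Eact: "E * act x = act x * E" if "x \<in> A" for x
    unfolding E_def by (metis Cact[OF that] Dact[OF that] mult.assoc)
  define \<pi>' where "\<pi>' = \<pi> - E"
  have \<pi>': "act_idempotent \<pi>'"
    unfolding act_idempotent_def
  proof (intro conjI ballI)
    show "lin \<pi>'" by (simp add: \<pi>'_def l\<pi> lE)
    show "\<pi>' * \<pi>' = \<pi>'" by (simp add: \<pi>'_def left_diff_distrib right_diff_distrib \<pi>\<pi> \<pi>E E\<pi> EE)
    have "E * u = E" by (metis E\<pi> \<pi>u mult.assoc)
    then show "\<pi>' * u = \<pi>'" by (simp add: \<pi>'_def left_diff_distrib \<pi>u)
    have "u * E = E" by (metis \<pi>E u\<pi> mult.assoc)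
    then show "u * \<pi>' = \<pi>'" by (simp add: \<pi>'_def right_diff_distrib u\<pi>)
    show "\<pi>' * act x = act x * \<pi>'" if "x \<in> A" for x
      using that by (simp add: \<pi>'_def left_diff_distrib right_diff_distrib \<pi>c Eact)
  qed
  obtain v where v: "E \<bullet> v \<noteq> 0" using \<open>E \<noteq> 0\<close> endo_eqI[of E 0] by auto
  have "dim (range (app \<pi>')) < dim (range (app \<pi>))"
  proof (rule dim_range_less)
    show "lin \<pi>'" "lin \<pi>" using \<pi>' by (auto simp: act_idempotent_def l\<pi>)
    have "\<pi> * \<pi>' = \<pi>'" by (simp add: \<pi>'_def right_diff_distrib \<pi>\<pi> \<pi>E)
    then show "range (app \<pi>') \<subseteq> range (app \<pi>)" by (metis app_times image_subsetI rangeI)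
    show "E \<bullet> v \<in> range (app \<pi>)" using \<pi>E by (metis app_times rangeI)
    show "E \<bullet> v \<notin> range (app \<pi>')"
    proof
      assume "E \<bullet> v \<in> range (app \<pi>')"
      then obtain z where z: "E \<bullet> v = \<pi>' \<bullet> z" by blast
      have "E * \<pi>' = 0" by (simp add: \<pi>'_def right_diff_distrib E\<pi> EE)
      then have "E \<bullet> E \<bullet> v = 0" unfolding z by (metis app_times app_zero_endo)
      then show False using v EE by (metis app_times)
    qed
  qed
  then obtain p' where p': "split_at \<pi>' p'" using IH[OF \<pi>'] by blast
  \<comment> \<open>Modulo \<open>J\<close> this is the matrix of \<open>ad x\<close> on the
    \<open>e i\<close>, and minus its transpose is the matrix on the \<open>f i\<close>;
    \<open>g i x\<close> is the error of the second statement.\<close>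
  define a where "a x i j = tform Y (br x (e i)) (f j)" for x i j
  define g where "g i x = br x (f i) + (\<Sum>j<n. a x j i *s f j)" for i x
  have a_add: "a (x + y) i j = a x i j + a y i j" and a_scale: "a (c *s x) i j = c * a x i j" for x y c i j
    by (simp_all add: a_def br_add_left br_scale_left bilin_add_left[OF b] bilin_scale_left[OF b])
  have gJ: "g i x \<in> J" if "x \<in> A" "i < n" for i x
    using cdf[OF that] by (simp add: g_def a_def)
  define Q where "Q = Endo (\<lambda>x. \<Sum>i<n. Y (e i) \<bullet> g i x)"
  have g_add: "g i (x + y) = g i x + g i y" for i x y
    by (simp add: g_def a_add br_add_left scale_left_distrib sum.distrib)
  have g_scale: "g i (c *s x) = c *s g i x" for i c x
    by (simp add: g_def a_scale br_scale_left scale_right_distrib scale_sum_right)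
  have Q: "Q \<bullet> x = (\<Sum>i<n. Y (e i) \<bullet> g i x)" for x
    unfolding Q_def by (rule app_Endo) (simp add: g_add sum.distrib)
  have lQ: "lin Q" by (simp add: lin_def Q g_scale lin_scale[OF lY] scale_sum_right)
  have \<pi>Q: "\<pi> * Q = Q"
    by (rule endo_eqI) (simp add: Q app_sum, simp add: \<pi>Y flip: app_times)
  have Yu: "Y c \<bullet> br x w = Y c \<bullet> act x \<bullet> w" if "x \<in> A" "w \<in> J" for x w c
    unfolding Y_def using that by (simp add: act_app) (simp add: act_def)
  have QJ: "Q \<bullet> j = - (C \<bullet> j)" if j: "j \<in> J" for j
  proof -
    have "a j i l = 0" if "i < n" for i l
      using YJ[OF ideal_br_right[OF J efA(1)[OF that] j]] by (simp add: a_def tform_def independent_Basis)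
    then have "g i j = - br (f i) j" if "i < n" for i
      by (simp add: g_def br_skew[of j])
    then have "Q \<bullet> j = (\<Sum>i<n. - (Y (e i) \<bullet> act (f i) \<bullet> j))"
      unfolding Q using efA j by (intro sum.cong) (auto simp: Yu)
    also have "\<dots> = (\<Sum>i<n. - (Y (e i) \<bullet> Y (f i) \<bullet> j))"
      by (rule sum.cong) (use efA Yact(1) in \<open>auto simp flip: app_times\<close>)
    finally show ?thesis by (simp add: C_def app_sum_endo sum_negf)
  qed
  \<comment> \<open>The multiplication rule of matrices holds exactly, not only modulo
    \<open>J\<close>, because the trace form ignores \<open>J\<close>.\<close>
  have a_br: "a (br x y) l i = (\<Sum>j<n. a y l j * a x j i) - (\<Sum>j<n. a x l j * a y j i)"
    if xy: "x \<in> A" "y \<in> A" and l: "l < n" for x y l i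
  proof -
    have *: "tform Y (br x (br y (e l))) (f i) = (\<Sum>j<n. a y l j * a x j i)"
      if "x \<in> A" "y \<in> A" for x y
    proof -
      have "br x (br y (e l) - (\<Sum>j<n. a y l j *s e j)) \<in> J"
        unfolding a_def by (rule ideal_br[OF J that(1) cde[OF that(2) l]])
      then have "tform Y (br x (br y (e l) - (\<Sum>j<n. a y l j *s e j))) (f i) = 0"
        by (simp add: tform_def YJ independent_Basis)
      then show ?thesis
        by (simp add: br_diff_right br_sum_right br_scale_right bilin_diff_left[OF b] bilin_sum_left[OF b]
            bilin_scale_left[OF b] a_def[of x])
    qed
    have "a (br x y) l i = tform Y (br x (br y (e l))) (f i) - tform Y (br y (br x (e l))) (f i)"
      by (simp add: a_def br_br_left bilin_diff_left[OF b])
    then show ?thesis using xy by (simp add: *)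
  qed
  \<comment> \<open>Single sums with coefficients from \<open>a\<close> cancel in pairs, and the
    double sums are those of \<open>a_br\<close>.\<close>
  have g_br: "g i (br x y) = br x (g i y) - br y (g i x)
      + (\<Sum>j<n. a x j i *s g j y) - (\<Sum>j<n. a y j i *s g j x)"
    if xy: "x \<in> A" "y \<in> A" and i: "i < n" for x y i
  proof -
    have 1: "(\<Sum>l<n. a (br x y) l i *s f l)
      = (\<Sum>j<n. \<Sum>l<n. (a x j i * a y l j) *s f l) - (\<Sum>j<n. \<Sum>l<n. (a y j i * a x l j) *s f l)"
    proof -
      have "(\<Sum>l<n. a (br x y) l i *s f l)
        = (\<Sum>l<n. \<Sum>j<n. (a y l j * a x j i) *s f l) - (\<Sum>l<n. \<Sum>j<n. (a x l j * a y j i) *s f l)"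
        using xy by (simp add: a_br scale_left_diff_distrib scale_sum_left sum_subtractf)
      also have "(\<Sum>l<n. \<Sum>j<n. (a y l j * a x j i) *s f l) = (\<Sum>j<n. \<Sum>l<n. (a x j i * a y l j) *s f l)"
        by (subst sum.swap) (simp add: mult.commute)
      also have "(\<Sum>l<n. \<Sum>j<n. (a x l j * a y j i) *s f l) = (\<Sum>j<n. \<Sum>l<n. (a y j i * a x l j) *s f l)"
        by (subst sum.swap) (simp add: mult.commute)
      finally show ?thesis .
    qed
    have 2: "br x (g i y) = br x (br y (f i)) + (\<Sum>j<n. a y j i *s br x (f j))" for x y
      by (simp add: g_def br_add_right br_sum_right br_scale_right)
    have 3: "(\<Sum>j<n. a x j i *s g j y) = (\<Sum>j<n. a x j i *s br y (f j)) + (\<Sum>j<n. \<Sum>l<n. (a x j i * a y l j) *s f l)"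
      for x y
      by (simp add: g_def scale_right_distrib scale_sum_right sum.distrib)
    show ?thesis unfolding 2 3 by (simp add: g_def 1 br_br_left)
  qed
  have Q_br: "Q \<bullet> br x y = act x \<bullet> Q \<bullet> y - act y \<bullet> Q \<bullet> x" if xy: "x \<in> A" "y \<in> A" for x y
  proof -
    \<comment> \<open>Moving \<open>act x\<close> to the left of \<open>Y (e i)\<close> costs
      \<open>Y [x, e i]\<close>; its expansion by \<open>a\<close> cancels the matrix terms of
      \<open>g_br\<close>.\<close>
    have *: "(\<Sum>i<n. Y (e i) \<bullet> br x (g i y)) + (\<Sum>i<n. \<Sum>j<n. a x j i *s (Y (e i) \<bullet> g j y)) = act x \<bullet> Q \<bullet> y"
      if x: "x \<in> A" and y: "y \<in> A" for x y
    proof -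
      have "Y (e i) \<bullet> br x (g i y) = act x \<bullet> Y (e i) \<bullet> g i y - (\<Sum>j<n. a x i j *s (Y (e j) \<bullet> g i y))"
        if i: "i < n" for i
      proof -
        have "Y (e i) \<bullet> br x (g i y) = Y (e i) \<bullet> act x \<bullet> g i y" by (rule Yu[OF x gJ[OF y i]])
        also have "\<dots> = act x \<bullet> Y (e i) \<bullet> g i y - Y (br x (e i)) \<bullet> g i y"
          using x efA[OF i] by (simp add: lrep_br[OF lrepY] comm_def Yact flip: app_times)
        also have "Y (br x (e i)) = (\<Sum>j<n. scl (a x i j) * Y (e j))"
        proof -
          have "Y (br x (e i) - (\<Sum>j<n. a x i j *s e j)) = 0"
            unfolding a_def by (rule YJ[OF cde[OF x i]])
          then show ?thesis by (simp add: lrep_diff[OF lrepY] lrep_sum[OF lrepY] lrep_scale[OF lrepY])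
        qed
        finally show ?thesis by (simp add: app_sum_endo)
      qed
      then have "(\<Sum>i<n. Y (e i) \<bullet> br x (g i y)) = act x \<bullet> Q \<bullet> y - (\<Sum>i<n. \<Sum>j<n. a x i j *s (Y (e j) \<bullet> g i y))"
        by (simp add: Q app_sum sum_subtractf)
      also have "(\<Sum>i<n. \<Sum>j<n. a x i j *s (Y (e j) \<bullet> g i y)) = (\<Sum>i<n. \<Sum>j<n. a x j i *s (Y (e i) \<bullet> g j y))"
        by (rule sum.swap)
      finally show ?thesis by simp
    qed
    have "Q \<bullet> br x y = (\<Sum>i<n. Y (e i) \<bullet> br x (g i y)) + (\<Sum>i<n. \<Sum>j<n. a x j i *s (Y (e i) \<bullet> g j y))
        - ((\<Sum>i<n. Y (e i) \<bullet> br y (g i x)) + (\<Sum>i<n. \<Sum>j<n. a y j i *s (Y (e i) \<bullet> g j x)))"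
      unfolding Q using g_br[OF xy]
      by (simp add: app_sum lin_scale[OF lY] sum.distrib sum_subtractf)
    then show ?thesis using *[OF xy] *[OF xy(2,1)] by simp
  qed
  \<comment> \<open>On \<open>J\<close> the operator \<open>Q\<close> is \<open>- C\<close>, so the
    second term contributes \<open>D * C = E\<close> and restores
    \<open>\<pi>' + E = \<pi>\<close>.\<close>
  define p where "p = p' - D * Q"
  have "split_at \<pi> p"
    unfolding split_at_def
  proof (intro conjI ballI)
    show "lin p" using p' by (simp add: p_def split_at_def lD lQ)
    have "u * (D * Q) = D * Q"
      by (metis \<pi>D \<pi>Q u\<pi> mult.assoc)
    then show "u * p = p" using p' by (simp add: p_def split_at_def right_diff_distrib)
    show "p \<bullet> j = \<pi> \<bullet> j" if "j \<in> J" for j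
    proof -
      have "p \<bullet> j = \<pi>' \<bullet> j + D \<bullet> C \<bullet> j" using p' that QJ by (simp add: p_def split_at_def)
      also have "D \<bullet> C \<bullet> j = E \<bullet> j" unfolding E_def CD by simp
      finally show ?thesis by (simp add: \<pi>'_def)
    qed
    fix x y assume xy: "x \<in> A" "y \<in> A"
    have "D \<bullet> act x \<bullet> w = act x \<bullet> D \<bullet> w" if "x \<in> A" for x w
      using Dact[OF that] by (metis app_times)
    then show "p \<bullet> br x y = act x \<bullet> p \<bullet> y - act y \<bullet> p \<bullet> x"
      using p' xy by (simp add: p_def split_at_def Q_br)
  qed
  then show ?thesis ..
qed

lemma split_exists: "act_idempotent \<pi> \<Longrightarrow> \<exists>p. split_at \<pi> p"
proof (induction "dim (range (app \<pi>))" arbitrary: \<pi> rule: less_induct)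
  case less
  show ?case
  proof (cases "\<forall>x\<in>A. act x * \<pi> = 0")
    case True
    then show ?thesis using split_trivial[OF less.prems] by blast
  next
    case False
    then obtain x0 where "x0 \<in> A" "act x0 * \<pi> \<noteq> 0" by blast
    then show ?thesis by (rule split_step[OF less.prems]) (use less.hyps in blast)
  qed
qed

text \<open>The case \<open>\<pi> = u\<close>. Modulo \<open>J'\<close> the action on values of
  \<open>p\<close> is the bracket, so the cocycle rule becomes the derivation rule, in which
  \<open>u\<close> no longer occurs.\<close>

theorem levi_derivation:
  obtains p where "lin p" "\<And>v. p \<bullet> v \<in> J" "\<And>j. j \<in> J \<Longrightarrow> p \<bullet> j - j \<in> J'"
    "\<And>x y. x \<in> A \<Longrightarrow> y \<in> A \<Longrightarrow> p \<bullet> br x y - (br (p \<bullet> x) y + br x (p \<bullet> y)) \<in> J'"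
proof -
  have "act_idempotent u"
    unfolding act_idempotent_def using u by (auto simp: act_def mult.assoc) (simp flip: mult.assoc)
  then obtain p where p: "split_at u p" using split_exists by blast
  have up: "u \<bullet> p \<bullet> v = p \<bullet> v" for v using p unfolding split_at_def by (metis app_times)
  have pJ: "p \<bullet> v \<in> J" for v using u(2)[of "p \<bullet> v"] up by simp
  have "p \<bullet> br x y - (br (p \<bullet> x) y + br x (p \<bullet> y)) \<in> J'" if xy: "x \<in> A" "y \<in> A" for x y
  proof -
    have *: "act x \<bullet> p \<bullet> y - br x (p \<bullet> y) \<in> J'" if "x \<in> A" for x y
      using act_app[OF that pJ, of y] u(4)[OF ideal_br[OF J that pJ, of y]] by simp
    have mem: "(act x \<bullet> p \<bullet> y - br x (p \<bullet> y)) - (act y \<bullet> p \<bullet> x - br y (p \<bullet> x)) \<in> J'"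
      using xy by (intro subspace_diff[OF ideal_subspace[OF J'(1)]] *)
    have "p \<bullet> br x y = act x \<bullet> p \<bullet> y - act y \<bullet> p \<bullet> x"
      using p xy by (simp add: split_at_def)
    moreover have "br (p \<bullet> x) y = - br y (p \<bullet> x)" by (rule br_skew)
    ultimately have "p \<bullet> br x y - (br (p \<bullet> x) y + br x (p \<bullet> y))
        = (act x \<bullet> p \<bullet> y - br x (p \<bullet> y)) - (act y \<bullet> p \<bullet> x - br y (p \<bullet> x))"
      by (simp add: algebra_simps)
    with mem show ?thesis by (simp only:)
  qed
  moreover have "p \<bullet> j - j \<in> J'" if "j \<in> J" for j using p u(4) that by (simp add: split_at_def)
  moreover have "lin p" using p by (simp add: split_at_def)
  ultimately show thesis using that pJ by blast
qed

end

section \<open>Bilinear maps on tensor products\<close>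

definition bilinear_map ::
    "('f::field \<Rightarrow> 'a::ab_group_add \<Rightarrow> 'a) \<Rightarrow> ('f \<Rightarrow> 'b::ab_group_add \<Rightarrow> 'b) \<Rightarrow>
     ('f \<Rightarrow> 'c::ab_group_add \<Rightarrow> 'c) \<Rightarrow> ('a \<Rightarrow> 'b \<Rightarrow> 'c) \<Rightarrow> bool"
  where "bilinear_map s1 s2 s g \<longleftrightarrow>
    (\<forall>a a' b. g (a + a') b = g a b + g a' b) \<and> (\<forall>a b b'. g a (b + b') = g a b + g a b') \<and>
    (\<forall>c a b. g (s1 c a) b = s c (g a b)) \<and> (\<forall>c a b. g a (s2 c b) = s c (g a b))"

text \<open>The Sweedler sum of \<open>g\<close> over a formal sum; it is well defined on the tensor
  product by \<open>ext_tensor_eq\<close>.\<close>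

definition ext ::
    "('f::field \<Rightarrow> 'c::ab_group_add \<Rightarrow> 'c) \<Rightarrow> ('a \<Rightarrow> 'b \<Rightarrow> 'c) \<Rightarrow> ('a \<times> 'b \<Rightarrow>\<^sub>0 'f) \<Rightarrow> 'c"
  where "ext s g = lin_ext s (\<lambda>(a, b). g a b)"

lemma bilinear_map_sum_left:
  assumes "bilinear_map s1 s2 s g" "vector_space s1"
  shows "g (\<Sum>i\<in>I. s1 (c i) (a i)) b = (\<Sum>i\<in>I. s (c i) (g (a i) b))"
proof -
  have "g (0 + 0) b = g 0 b + g 0 b" using assms(1) unfolding bilinear_map_def by blast
  then have "g 0 b = 0" by simp
  then show ?thesis
    using assms(1) unfolding bilinear_map_def
    by (induction I rule: infinite_finite_induct) auto
qed

lemma bilinear_map_sum_right: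
  assumes "bilinear_map s1 s2 s g"
  shows "g a (\<Sum>i\<in>I. s2 (c i) (b i)) = (\<Sum>i\<in>I. s (c i) (g a (b i)))"
proof -
  have "g a (0 + 0) = g a 0 + g a 0" using assms unfolding bilinear_map_def by blast
  then have "g a 0 = 0" by simp
  then show ?thesis
    using assms unfolding bilinear_map_def
    by (induction I rule: infinite_finite_induct) auto
qed

lemma ext_tensor_eq:
  assumes "vector_space s" "bilinear_map s1 s2 s g" "tensor_eq s1 s2 x y"
  shows "ext s g x = ext s g y"
  unfolding ext_def
  by (rule lin_ext_tensor_eq[OF assms(1) _ _ _ _ assms(3)]) (use assms(2) in \<open>auto simp: bilinear_map_def\<close>)

lemma lin_ext_compose:
  assumes "Vector_Spaces.linear s s' f"
  shows "f (lin_ext s g x) = lin_ext s' (\<lambda>k. f (g k)) x"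
proof -
  interpret Vector_Spaces.linear s s' f by (rule assms)
  show ?thesis by (simp add: lin_ext_def sum scale)
qed

lemma ext_compose:
  assumes "Vector_Spaces.linear s s' f"
  shows "f (ext s g x) = ext s' (\<lambda>a b. f (g a b)) x"
  unfolding ext_def lin_ext_compose[OF assms] by (simp add: case_prod_unfold)

lemma lin_ext_pure: "vector_space s \<Longrightarrow> lin_ext s g (pure k) = g k"
  by (simp add: lin_ext_def module.scale_one module_iff_vector_space)

lemma linear_ext: "vector_space s \<Longrightarrow> Vector_Spaces.linear fscale s (ext s g)"
  unfolding ext_def by (rule linear_lin_ext)

lemma ext_sum: "ext s (\<lambda>a b. \<Sum>i\<in>I. g i a b) x = (\<Sum>i\<in>I. ext s (g i) x)" if "vector_space s"
proof -
  interpret vector_space s by (rule that)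
  show ?thesis
    unfolding ext_def lin_ext_def by (simp add: case_prod_unfold scale_sum_right) (rule sum.swap)
qed

lemma linear_ext_into_tensor:
  assumes s: "vector_space s" and s0: "vector_space s0"
    and g: "bilinear_map s1 s2 s g" and \<phi>: "linear_into_tensor s0 s1 s2 \<phi>"
  shows "Vector_Spaces.linear s0 s (\<lambda>a. ext s g (\<phi> a))"
proof -
  interpret E: Vector_Spaces.linear fscale s "ext s g" by (rule linear_ext[OF s])
  interpret s: vector_space s by (rule s)
  interpret s0: vector_space s0 by (rule s0)
  show ?thesis
  proof
    show "ext s g (\<phi> (a + b)) = ext s g (\<phi> a) + ext s g (\<phi> b)" for a b
      using ext_tensor_eq[OF s g, of "\<phi> (a + b)" "\<phi> a + \<phi> b"] \<phi> by (simp add: linear_into_tensor_def E.add)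
    show "ext s g (\<phi> (s0 c a)) = s c (ext s g (\<phi> a))" for c a
      using ext_tensor_eq[OF s g, of "\<phi> (s0 c a)" "fscale c (\<phi> a)"] \<phi> by (simp add: linear_into_tensor_def E.scale)
  qed
qed

lemma lin_ext_tensor3_eq:
  assumes "vector_space s"
    and "\<And>a a' b c. g (a + a') b c = g a b c + g a' b c"
    and "\<And>a b b' c. g a (b + b') c = g a b c + g a b' c"
    and "\<And>a b c c'. g a b (c + c') = g a b c + g a b c'"
    and "\<And>r a b c. g (s1 r a) b c = s r (g a b c)"
    and "\<And>r a b c. g a (s2 r b) c = s r (g a b c)"
    and "\<And>r a b c. g a b (s3 r c) = s r (g a b c)"
    and "tensor3_eq s1 s2 s3 x y"
  shows "lin_ext s (\<lambda>(a, b, c). g a b c) x = lin_ext s (\<lambda>(a, b, c). g a b c) y"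
proof -
  let ?g = "\<lambda>(a, b, c). g a b c"
  interpret L: Vector_Spaces.linear fscale s "lin_ext s ?g"
    by (rule linear_lin_ext) fact
  have "lin_ext s ?g r = 0" if "r \<in> tensor3_relations s1 s2 s3" for r
    using that assms(2-7)
    by (auto simp: tensor3_relations_def L.diff L.scale lin_ext_pure[OF assms(1)])
  then have "lin_ext s ?g (x - y) = 0"
    using assms(8) unfolding tensor3_eq_def by (rule L.eq_0_on_span)
  then show ?thesis by (simp add: L.diff)
qed

lemma lin_ext_tensor_left:
  assumes "vector_space s"
  shows "lin_ext s (\<lambda>(a, b, c). g a b c) (tensor_left \<phi> x) = ext s (\<lambda>m n. ext s (\<lambda>a b. g a b n) (\<phi> m)) x"
  unfolding tensor_left_def lin_ext_compose[OF linear_lin_ext[OF assms]] ext_def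
  by (simp add: case_prod_unfold lin_ext_compose[OF linear_lin_ext[OF assms]] lin_ext_pure[OF assms])

lemma lin_ext_tensor_right:
  assumes "vector_space s"
  shows "lin_ext s (\<lambda>(a, b, c). g a b c) (tensor_right \<phi> x) = ext s (\<lambda>m n. ext s (\<lambda>a b. g m a b) (\<phi> n)) x"
  unfolding tensor_right_def lin_ext_compose[OF linear_lin_ext[OF assms]] ext_def
  by (simp add: case_prod_unfold lin_ext_compose[OF linear_lin_ext[OF assms]] lin_ext_pure[OF assms])

lemma ext_tensor_product_mult:
  assumes "vector_space s"
  shows "ext s g (tensor_product_mult f h x y) = ext s (\<lambda>a b. ext s (\<lambda>a' b'. g (f a a') (h b b')) y) x"
  unfolding tensor_product_mult_def ext_def lin_ext_compose[OF linear_lin_ext[OF assms]]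
  by (simp add: case_prod_unfold lin_ext_compose[OF linear_lin_ext[OF assms]] lin_ext_pure[OF assms])

lemma tensor_eq_refl: "tensor_eq s1 s2 x x"
  and tensor_eq_sym: "tensor_eq s1 s2 x y \<Longrightarrow> tensor_eq s1 s2 y x"
  and tensor_eq_trans: "tensor_eq s1 s2 x y \<Longrightarrow> tensor_eq s1 s2 y z \<Longrightarrow> tensor_eq s1 s2 x z"
  and tensor_eq_add: "tensor_eq s1 s2 x y \<Longrightarrow> tensor_eq s1 s2 x' y' \<Longrightarrow> tensor_eq s1 s2 (x + x') (y + y')"
  and tensor_eq_fscale: "tensor_eq s1 s2 x y \<Longrightarrow> tensor_eq s1 s2 (fscale c x) (fscale c y)"
proof -
  interpret W: vector_space fscale by (rule vector_space_fscale)
  show "tensor_eq s1 s2 x x" by (simp add: tensor_eq_def W.span_zero)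
  show "tensor_eq s1 s2 x y \<Longrightarrow> tensor_eq s1 s2 y x"
    unfolding tensor_eq_def using W.span_neg[of "x - y"] by simp
  show "tensor_eq s1 s2 x y \<Longrightarrow> tensor_eq s1 s2 y z \<Longrightarrow> tensor_eq s1 s2 x z"
    unfolding tensor_eq_def using W.span_add[of "x - y" _ "y - z"] by simp
  show "tensor_eq s1 s2 x y \<Longrightarrow> tensor_eq s1 s2 x' y' \<Longrightarrow> tensor_eq s1 s2 (x + x') (y + y')"
    unfolding tensor_eq_def using W.span_add[of "x - y" _ "x' - y'"] by (simp add: algebra_simps)
  show "tensor_eq s1 s2 x y \<Longrightarrow> tensor_eq s1 s2 (fscale c x) (fscale c y)"
    unfolding tensor_eq_def using W.span_scale[of "x - y" _ c] by (simp add: W.scale_right_diff_distrib)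
qed

lemma tensor_eq_sum:
  "(\<And>i. i \<in> I \<Longrightarrow> tensor_eq s1 s2 (x i) (y i)) \<Longrightarrow> tensor_eq s1 s2 (\<Sum>i\<in>I. x i) (\<Sum>i\<in>I. y i)"
  by (induction I rule: infinite_finite_induct) (auto intro: tensor_eq_refl tensor_eq_add)

lemma tensor_eq_pure_add_left: "tensor_eq s1 s2 (pure (a + a', b)) (pure (a, b) + pure (a', b))"
  and tensor_eq_pure_add_right: "tensor_eq s1 s2 (pure (a, b + b')) (pure (a, b) + pure (a, b'))"
  and tensor_eq_pure_scale_left: "tensor_eq s1 s2 (pure (s1 c a, b)) (fscale c (pure (a, b)))"
  and tensor_eq_pure_scale_right: "tensor_eq s1 s2 (pure (a, s2 c b)) (fscale c (pure (a, b)))"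
proof -
  interpret W: vector_space fscale by (rule vector_space_fscale)
  have *: "r \<in> W.span (tensor_relations s1 s2)" if "r \<in> tensor_relations s1 s2"
    for r using that by (rule W.span_base)
  show "tensor_eq s1 s2 (pure (a + a', b)) (pure (a, b) + pure (a', b))"
    unfolding tensor_eq_def diff_diff_eq[symmetric] by (rule *) (unfold tensor_relations_def, blast)
  show "tensor_eq s1 s2 (pure (a, b + b')) (pure (a, b) + pure (a, b'))"
    unfolding tensor_eq_def diff_diff_eq[symmetric] by (rule *) (unfold tensor_relations_def, blast)
  show "tensor_eq s1 s2 (pure (s1 c a, b)) (fscale c (pure (a, b)))"
    unfolding tensor_eq_def by (rule *) (unfold tensor_relations_def, blast)
  show "tensor_eq s1 s2 (pure (a, s2 c b)) (fscale c (pure (a, b)))"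
    unfolding tensor_eq_def by (rule *) (unfold tensor_relations_def, blast)
qed

lemma tensor_eq_pure_zero_right: "tensor_eq s1 s2 (pure (a, 0)) 0"
proof -
  have "tensor_eq s1 s2 (pure (a, 0 + 0)) (pure (a, 0) + pure (a, 0))" by (rule tensor_eq_pure_add_right)
  then have "tensor_eq s1 s2 (pure (a, 0) + (- pure (a, 0))) (pure (a, 0) + pure (a, 0) + (- pure (a, 0)))"
    by (intro tensor_eq_add tensor_eq_refl) simp
  then show ?thesis by (simp add: tensor_eq_sym)
qed

lemma tensor_eq_pure_zero_left: "tensor_eq s1 s2 (pure (0, b)) 0"
proof -
  have "tensor_eq s1 s2 (pure (0 + 0, b)) (pure (0, b) + pure (0, b))" by (rule tensor_eq_pure_add_left)
  then have "tensor_eq s1 s2 (pure (0, b) + (- pure (0, b))) (pure (0, b) + pure (0, b) + (- pure (0, b)))"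
    by (intro tensor_eq_add tensor_eq_refl) simp
  then show ?thesis by (simp add: tensor_eq_sym)
qed

lemma tensor_eq_pure_sum_left: "tensor_eq s1 s2 (pure (\<Sum>i\<in>I. a i, b)) (\<Sum>i\<in>I. pure (a i, b))"
proof (induction I rule: infinite_finite_induct)
  case (insert i I)
  have "tensor_eq s1 s2 (pure (a i, b) + pure (\<Sum>i\<in>I. a i, b)) (pure (a i, b) + (\<Sum>i\<in>I. pure (a i, b)))"
    by (rule tensor_eq_add[OF tensor_eq_refl insert.IH])
  with tensor_eq_pure_add_left[of s1 s2 "a i" "\<Sum>i\<in>I. a i" b]
  show ?case using insert.hyps by simp (rule tensor_eq_trans)
qed (simp_all add: tensor_eq_pure_zero_left)

section \<open>Coinvariant averaging\<close>

locale fd_comodule_lie =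
  fd_lie0 scale Basis br + comodule_lie_algebra scaleH \<Delta> \<epsilon> S scale br \<rho>
  for scaleH :: "'f::field_char_0 \<Rightarrow> 'h::ring_1 \<Rightarrow> 'h" (infixr \<open>*h\<close> 75)
    and \<Delta> :: "'h \<Rightarrow> ('h \<times> 'h \<Rightarrow>\<^sub>0 'f)" and \<epsilon> :: "'h \<Rightarrow> 'f" and S :: "'h \<Rightarrow> 'h"
    and scale :: "'f \<Rightarrow> 'l::ab_group_add \<Rightarrow> 'l" (infixr \<open>*s\<close> 75)
    and Basis and br :: "'l \<Rightarrow> 'l \<Rightarrow> 'l"
    and \<rho> :: "'l \<Rightarrow> ('l \<times> 'h \<Rightarrow>\<^sub>0 'f)"
begin

lemma vsL: "vector_space scale" by unfold_locales
lemma vsH: "vector_space scaleH" by unfold_locales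

abbreviation "bilL s \<equiv> bilinear_map scale scaleH s"
abbreviation "bilH s \<equiv> bilinear_map scaleH scaleH s"
abbreviation "cor i v \<equiv> representation Basis v i"

lemma cor_sum: "(\<Sum>i\<in>Basis. cor i v *s i) = v"
  by (simp add: sum_representation_eq independent_Basis span_Basis finite_Basis)

lemma cor_add: "cor i (u + v) = cor i u + cor i v"
  and cor_scale: "cor i (c *s v) = c * cor i v"
  by (simp_all add: representation_Basis_plus representation_Basis_scale)

lemma cor_sum_scale: "cor i (\<Sum>k\<in>I. c k *s w k) = (\<Sum>k\<in>I. c k * cor i (w k))"
  by (simp add: representation_sum representation_scale independent_Basis span_Basis)

lemma cor_basis: "i \<in> Basis \<Longrightarrow> cor k i = (if k = i then 1 else 0)"
  by (simp add: representation_basis[OF independent_Basis])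

lemma cor_lincomb: "i \<in> Basis \<Longrightarrow> cor i (\<Sum>k\<in>Basis. c k *s k) = c i"
  by (simp add: cor_sum_scale cor_basis if_distrib[of "(*) _"] finite_Basis cong: if_cong)

text \<open>With \<open>hc i v\<close>, \<open>\<rho> v = (\<Sum>i. i \<otimes> hc i v)\<close>; the matrix \<open>hc i j\<close> is a corepresentation of \<open>H\<close>, and
  \<open>S (hc i j)\<close> is its inverse matrix. Working with it avoids that \<open>S\<close> reverses products and
  coproducts.\<close>

definition hc :: "'l \<Rightarrow> 'l \<Rightarrow> 'h"
  where "hc i v = ext scaleH (\<lambda>m a. cor i m *h a) (\<rho> v)"

lemma bil_cor: "bilL scaleH (\<lambda>m a. cor i m *h a)"
  by (auto simp: bilinear_map_def cor_add cor_scale H.scale_left_distrib H.scale_right_distrib mult.commute)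

lemma linear_hc: "Vector_Spaces.linear scale scaleH (hc i)"
  unfolding hc_def by (rule linear_ext_into_tensor[OF vsH vsL bil_cor coaction_linear])

lemma hc_add: "hc i (u + v) = hc i u + hc i v"
  and hc_scale: "hc i (c *s v) = c *h hc i v"
  and hc_sum: "hc i (\<Sum>k\<in>K. w k) = (\<Sum>k\<in>K. hc i (w k))"
proof -
  interpret h: Vector_Spaces.linear scale scaleH "hc i" by (rule linear_hc)
  show "hc i (u + v) = hc i u + hc i v" "hc i (c *s v) = c *h hc i v" "hc i (\<Sum>k\<in>K. w k) = (\<Sum>k\<in>K. hc i (w k))"
    by (simp_all add: h.add h.scale h.sum)
qed

lemma hc_cor: "(\<Sum>k\<in>Basis. cor k v *h hc i k) = hc i v"
  by (subst (2) cor_sum[of v, symmetric]) (simp add: hc_sum hc_scale)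

lemma ext_coordinates:
  assumes s: "vector_space s" and g: "bilL s g"
  shows "ext s g x = (\<Sum>i\<in>Basis. g i (ext scaleH (\<lambda>m a. cor i m *h a) x))"
proof -
  interpret s: vector_space s by (rule s)
  have g1: "g m a = (\<Sum>i\<in>Basis. g i (cor i m *h a))" for m a
  proof -
    have "g m a = g (\<Sum>i\<in>Basis. cor i m *s i) a" by (simp add: cor_sum)
    also have "\<dots> = (\<Sum>i\<in>Basis. s (cor i m) (g i a))" by (rule bilinear_map_sum_left[OF g vsL])
    finally show ?thesis using g by (simp add: bilinear_map_def)
  qed
  have lin: "Vector_Spaces.linear scaleH s (g i)" for i
    using g by unfold_locales (auto simp: bilinear_map_def)
  have "ext s g x = ext s (\<lambda>m a. \<Sum>i\<in>Basis. g i (cor i m *h a)) x"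
    by (rule arg_cong[of _ _ "\<lambda>g. ext s g x"]) (intro HOL.ext g1)
  also have "\<dots> = (\<Sum>i\<in>Basis. g i (ext scaleH (\<lambda>m a. cor i m *h a) x))"
    by (simp add: ext_sum[OF s] ext_compose[OF lin])
  finally show ?thesis .
qed

lemma ext_coaction: "vector_space s \<Longrightarrow> bilL s g \<Longrightarrow> ext s g (\<rho> v) = (\<Sum>i\<in>Basis. g i (hc i v))"
  unfolding hc_def by (rule ext_coordinates)

text \<open>The matrix comultiplication
  \<open>\<Delta> (hc i v) = (\<Sum>k. hc i k \<otimes> hc k v)\<close>, tested by a bilinear
  \<open>g\<close>. It is coassociativity of the coaction, evaluated on the trilinear map
  \<open>?T\<close> that takes the coordinate \<open>i\<close> of the first leg.\<close>

lemma ext_comult: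
  assumes s: "vector_space s" and g: "bilH s g"
  shows "ext s g (\<Delta> (hc i v)) = (\<Sum>k\<in>Basis. g (hc i k) (hc k v))"
proof -
  interpret s: vector_space s by (rule s)
  note gs = g[unfolded bilinear_map_def]
  let ?T = "\<lambda>m a b. s (cor i m) (g a b)"
  have lin1: "Vector_Spaces.linear scaleH s (\<lambda>a. g a n)" for n
    using gs by unfold_locales auto
  have lin2: "Vector_Spaces.linear scaleH s (\<lambda>a. ext s g (\<Delta> a))"
    by (rule linear_ext_into_tensor[OF s vsH g H.comult_linear])
  have "lin_ext s (\<lambda>(m, a, b). ?T m a b) (tensor_left \<rho> (\<rho> v)) = lin_ext s (\<lambda>(m, a, b). ?T m a b) (tensor_right \<Delta> (\<rho> v))"
    by (rule lin_ext_tensor3_eq[OF s _ _ _ _ _ _ coaction_coassoc])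
      (use gs in \<open>auto simp: cor_add cor_scale s.scale_left_distrib s.scale_right_distrib mult.commute\<close>)
  moreover have "lin_ext s (\<lambda>(m, a, b). ?T m a b) (tensor_left \<rho> (\<rho> v)) = (\<Sum>k\<in>Basis. g (hc i k) (hc k v))"
  proof -
    have "ext s (\<lambda>a b. ?T a b n) (\<rho> m) = g (hc i m) n" for m n
      unfolding hc_def ext_compose[OF lin1] using gs by simp
    then show ?thesis
      unfolding lin_ext_tensor_left[OF s]
      using gs by (simp add: ext_coaction[OF s] bilinear_map_def hc_add hc_scale)
  qed
  moreover have "lin_ext s (\<lambda>(m, a, b). ?T m a b) (tensor_right \<Delta> (\<rho> v)) = ext s g (\<Delta> (hc i v))"
  proof -
    have lin3: "Vector_Spaces.linear s s (s c)" for c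
      by unfold_locales (auto simp: s.scale_right_distrib mult.commute)
    interpret l2: Vector_Spaces.linear scaleH s "\<lambda>a. ext s g (\<Delta> a)" by (rule lin2)
    have "ext s (\<lambda>a b. ?T m a b) (\<Delta> n) = ext s g (\<Delta> (cor i m *h n))" for m n
      unfolding ext_compose[OF lin3, symmetric] by (simp add: l2.scale)
    then show ?thesis
      unfolding lin_ext_tensor_right[OF s] hc_def ext_compose[OF lin2] by simp
  qed
  ultimately show ?thesis by simp
qed

lemma scaleH_mult: "(c *h a) * b = c *h (a * b)" "a * (c *h b) = c *h (a * b)"
  using H.scale_mult_left H.scale_mult_right by metis+

lemma counit_hc: assumes "i \<in> Basis" shows "\<epsilon> (hc i v) = cor i v"
proof -
  interpret e: Vector_Spaces.linear scaleH "(*)" \<epsilon> by (rule H.counit_linear)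
  have "v = ext scale (\<lambda>m a. \<epsilon> a *s m) (\<rho> v)"
    using coaction_counit[of v] by (simp add: ext_def)
  also have "\<dots> = (\<Sum>k\<in>Basis. \<epsilon> (hc k v) *s k)"
    by (rule ext_coaction[OF vsL])
      (auto simp: bilinear_map_def scale_left_distrib scale_right_distrib e.add e.scale mult.commute)
  finally show ?thesis using cor_lincomb[OF assms, of "\<lambda>k. \<epsilon> (hc k v)"] by metis
qed

lemma antipode_add: "S (a + b) = S a + S b"
  and antipode_scale: "S (c *h a) = c *h S a"
  and antipode_sum: "S (\<Sum>k\<in>K. w k) = (\<Sum>k\<in>K. S (w k))"
proof -
  interpret s: Vector_Spaces.linear scaleH scaleH S by (rule H.antipode_linear)
  show "S (a + b) = S a + S b" "S (c *h a) = c *h S a" "S (\<Sum>k\<in>K. w k) = (\<Sum>k\<in>K. S (w k))"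
    by (simp_all add: s.add s.scale s.sum)
qed

lemma hc_antipode:
  assumes "i \<in> Basis"
  shows "(\<Sum>k\<in>Basis. hc i k * S (hc k v)) = cor i v *h 1"
    and "(\<Sum>k\<in>Basis. S (hc i k) * hc k v) = cor i v *h 1"
proof -
  have "(\<Sum>k\<in>Basis. hc i k * S (hc k v)) = ext scaleH (\<lambda>a b. a * S b) (\<Delta> (hc i v))"
    by (rule ext_comult[OF vsH, symmetric])
      (auto simp: bilinear_map_def distrib_left distrib_right antipode_add antipode_scale scaleH_mult)
  then show "(\<Sum>k\<in>Basis. hc i k * S (hc k v)) = cor i v *h 1"
    using H.antipode_right[of "hc i v"] by (simp add: ext_def counit_hc[OF assms])
  have "(\<Sum>k\<in>Basis. S (hc i k) * hc k v) = ext scaleH (\<lambda>a b. S a * b) (\<Delta> (hc i v))"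
    by (rule ext_comult[OF vsH, symmetric])
      (auto simp: bilinear_map_def distrib_left distrib_right antipode_add antipode_scale scaleH_mult)
  then show "(\<Sum>k\<in>Basis. S (hc i k) * hc k v) = cor i v *h 1"
    using H.antipode_left[of "hc i v"] by (simp add: ext_def counit_hc[OF assms])
qed

lemma hc_br: "hc m (br x y) = (\<Sum>p\<in>Basis. \<Sum>r\<in>Basis. cor m (br p r) *h (hc p x * hc r y))"
proof -
  have "hc m (br x y) = ext scaleH (\<lambda>m' a. cor m m' *h a) (tensor_product_mult br (*) (\<rho> x) (\<rho> y))"
    unfolding hc_def by (rule ext_tensor_eq[OF vsH bil_cor coaction_bracket])
  also have "\<dots> = ext scaleH (\<lambda>a b. ext scaleH (\<lambda>a' b'. cor m (br a a') *h (b * b')) (\<rho> y)) (\<rho> x)"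
    by (rule ext_tensor_product_mult[OF vsH])
  also have "\<dots> = ext scaleH (\<lambda>a b. \<Sum>r\<in>Basis. cor m (br a r) *h (b * hc r y)) (\<rho> x)"
  proof -
    have "ext scaleH (\<lambda>a' b'. cor m (br a a') *h (b * b')) (\<rho> y) = (\<Sum>r\<in>Basis. cor m (br a r) *h (b * hc r y))" for a b
      by (rule ext_coaction[OF vsH])
        (auto simp: bilinear_map_def br_add_right br_scale_right cor_add cor_scale H.scale_left_distrib
          H.scale_right_distrib distrib_left scaleH_mult mult.commute)
    then show ?thesis by simp
  qed
  also have "\<dots> = (\<Sum>p\<in>Basis. \<Sum>r\<in>Basis. cor m (br p r) *h (hc p x * hc r y))"
    by (rule ext_coaction[OF vsH])
      (auto simp: bilinear_map_def br_add_left br_scale_left cor_add cor_scale H.scale_left_distrib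
        H.scale_right_distrib distrib_right scaleH_mult mult.commute sum.distrib H.scale_sum_right)
  finally show ?thesis .
qed

subsection \<open>Subcomodules as submodules over the dual algebra\<close>

text \<open>In Sweedler notation \<open>f(x_(1)) x_(0)\<close>. Functionals separate the points of
  \<open>H\<close>, so stability under these operators captures subcomodules without
  tensors.\<close>

definition dact :: "('h \<Rightarrow> 'f) \<Rightarrow> 'l \<Rightarrow> 'l"
  where "dact f x = (\<Sum>i\<in>Basis. f (hc i x) *s i)"

abbreviation "functional f \<equiv> Vector_Spaces.linear scaleH ((*) :: 'f \<Rightarrow> _) f"

lemma functional_simps:
  assumes "functional f"
  shows "f (a + b) = f a + f b" "f (a - b) = f a - f b" "f (c *h a) = c * f a"
    "f (\<Sum>k\<in>K. w k) = (\<Sum>k\<in>K. f (w k))" "f 0 = 0"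
proof -
  interpret f: Vector_Spaces.linear scaleH "(*)" f by (rule assms)
  show "f (a + b) = f a + f b" "f (a - b) = f a - f b" "f (c *h a) = c * f a"
    "f (\<Sum>k\<in>K. w k) = (\<Sum>k\<in>K. f (w k))" "f 0 = 0"
    by (simp_all add: f.add f.diff f.scale f.sum)
qed

lemma functional_mult_right: "functional f \<Longrightarrow> functional (\<lambda>a. f (a * z))"
  by unfold_locales (auto simp: distrib_left distrib_right functional_simps scaleH_mult mult.assoc)

lemma separating_functional:
  assumes "z \<noteq> (0 :: 'h)" obtains f where "functional f" "f z \<noteq> 0"
proof -
  interpret vector_space_pair scaleH "(*) :: 'f \<Rightarrow> 'f \<Rightarrow> 'f"
    by unfold_locales (auto simp: algebra_simps)
  obtain g where "functional g" "\<forall>x\<in>{z}. g x = 1"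
    using linear_independent_extend[of "{z}" "\<lambda>_. 1"] assms by auto
  then show thesis using that[of g] by simp
qed

lemma dact_add: "functional f \<Longrightarrow> dact f (x + y) = dact f x + dact f y"
  and dact_scale: "functional f \<Longrightarrow> dact f (c *s x) = c *s dact f x"
  by (simp_all add: dact_def hc_add hc_scale functional_simps scale_left_distrib sum.distrib scale_sum_right)

definition coinv :: "'l set \<Rightarrow> bool"
  where "coinv W \<longleftrightarrow> subspace W \<and> (\<forall>f. functional f \<longrightarrow> (\<forall>w\<in>W. dact f w \<in> W))"

lemma coinv_subspace: "coinv W \<Longrightarrow> subspace W"
  and coinv_dact: "coinv W \<Longrightarrow> functional f \<Longrightarrow> w \<in> W \<Longrightarrow> dact f w \<in> W"
  by (auto simp: coinv_def)

lemma subcomodule_coinv: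
  assumes "subcomodule W" shows "coinv W"
  unfolding coinv_def
proof (intro conjI allI impI ballI)
  show W: "subspace W" using assms by (simp add: subcomodule_def)
  fix f w assume f: "functional f" and "w \<in> W"
  then obtain x where x: "Poly_Mapping.keys x \<subseteq> W \<times> UNIV" "tensor_eq scale scaleH (\<rho> w) x"
    using assms by (auto simp: subcomodule_def)
  have b: "bilL scale (\<lambda>m a. f a *s m)"
    by (auto simp: bilinear_map_def scale_left_distrib scale_right_distrib functional_simps[OF f] mult.commute)
  have "dact f w = ext scale (\<lambda>m a. f a *s m) (\<rho> w)"
    unfolding dact_def by (rule ext_coaction[OF vsL b, symmetric])
  also have "\<dots> = ext scale (\<lambda>m a. f a *s m) x" by (rule ext_tensor_eq[OF vsL b x(2)])
  also have "\<dots> \<in> W"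
    unfolding ext_def lin_ext_def
    by (intro subspace_sum[OF W] subspace_scale[OF W]) (use x(1) W in \<open>auto intro: subspace_scale\<close>)
  finally show "dact f w \<in> W" .
qed

lemma coinv_hc:
  assumes W: "coinv W" and p: "lin p" "\<And>w. w \<in> W \<Longrightarrow> p \<bullet> w = w" and k: "k \<in> Basis" and w: "w \<in> W"
  shows "hc k w = (\<Sum>i\<in>Basis. cor k (p \<bullet> i) *h hc i w)"
proof (rule ccontr)
  assume "\<not> ?thesis"
  then have "hc k w - (\<Sum>i\<in>Basis. cor k (p \<bullet> i) *h hc i w) \<noteq> 0" by simp
  then obtain f where f: "functional f" "f (hc k w - (\<Sum>i\<in>Basis. cor k (p \<bullet> i) *h hc i w)) \<noteq> 0"
    using separating_functional by blast
  have "p \<bullet> dact f w = dact f w" by (rule p(2)[OF coinv_dact[OF W f(1) w]])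
  then have "cor k (p \<bullet> dact f w) = cor k (dact f w)" by simp
  moreover have "cor k (dact f w) = f (hc k w)" unfolding dact_def by (rule cor_lincomb[OF k])
  moreover have "cor k (p \<bullet> dact f w) = (\<Sum>i\<in>Basis. f (hc i w) * cor k (p \<bullet> i))"
    unfolding dact_def using p(1) by (simp add: app_sum lin_scale cor_sum_scale)
  ultimately have "(\<Sum>i\<in>Basis. f (hc i w) * cor k (p \<bullet> i)) = f (hc k w)" by simp
  then show False using f by (simp add: functional_simps mult.commute)
qed

text \<open>For \<open>w\<close> in \<open>W\<close> the basis vectors \<open>k\<close> in a
  Sweedler sum may be replaced by their projections to \<open>W\<close>. Facts known only for
  elements of \<open>W\<close> then apply to every summand.\<close>

lemma coinv_sum:
  assumes W: "coinv W" and p: "lin p" "\<And>w. w \<in> W \<Longrightarrow> p \<bullet> w = w" and w: "w \<in> W" and g: "bilL s g"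
    and s: "vector_space s"
  shows "(\<Sum>k\<in>Basis. g k (hc k w)) = (\<Sum>i\<in>Basis. g (p \<bullet> i) (hc i w))"
proof -
  have "(\<Sum>k\<in>Basis. g k (hc k w)) = (\<Sum>k\<in>Basis. g k (\<Sum>i\<in>Basis. cor k (p \<bullet> i) *h hc i w))"
    by (rule sum.cong) (use coinv_hc[OF W p _ w] in auto)
  also have "\<dots> = (\<Sum>i\<in>Basis. \<Sum>k\<in>Basis. s (cor k (p \<bullet> i)) (g k (hc i w)))"
    unfolding bilinear_map_sum_right[OF g] by (rule sum.swap)
  also have "\<dots> = (\<Sum>i\<in>Basis. g (\<Sum>k\<in>Basis. cor k (p \<bullet> i) *s k) (hc i w))"
    unfolding bilinear_map_sum_left[OF g vsL] ..
  finally show ?thesis by (simp add: cor_sum)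
qed

text \<open>A normal form, by which elements with equal coordinates are equal in the tensor product.
  It supplies the passage from \<open>dact\<close> back to tensors.\<close>

lemma tensor_eq_coordinates:
  "tensor_eq scale scaleH x (\<Sum>i\<in>Basis. pure (i, ext scaleH (\<lambda>m a. cor i m *h a) x))"
proof -
  interpret W: vector_space fscale by (rule vector_space_fscale)
  let ?c = "\<lambda>i x. ext scaleH (\<lambda>m a. cor i m *h a) x"
  interpret c: Vector_Spaces.linear fscale scaleH "?c i" for i by (rule linear_ext[OF vsH])
  let ?E = "{x. tensor_eq scale scaleH x (\<Sum>i\<in>Basis. pure (i, ?c i x))}"
  have zero: "0 \<in> ?E"
  proof -
    have "tensor_eq scale scaleH (\<Sum>i\<in>Basis. pure (i, 0)) (\<Sum>i\<in>Basis. 0)"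
      by (intro tensor_eq_sum tensor_eq_pure_zero_right)
    then show ?thesis by (simp add: c.zero tensor_eq_sym)
  qed
  have add: "x + y \<in> ?E" if "x \<in> ?E" "y \<in> ?E" for x y
  proof -
    have "tensor_eq scale scaleH (\<Sum>i\<in>Basis. pure (i, ?c i x + ?c i y)) (\<Sum>i\<in>Basis. pure (i, ?c i x) + pure (i, ?c i y))"
      by (intro tensor_eq_sum tensor_eq_pure_add_right)
    moreover have "tensor_eq scale scaleH (x + y) (\<Sum>i\<in>Basis. pure (i, ?c i x) + pure (i, ?c i y))"
      using that by (simp add: sum.distrib tensor_eq_add)
    ultimately show ?thesis by (simp add: c.add) (meson tensor_eq_sym tensor_eq_trans)
  qed
  have sc: "fscale r x \<in> ?E" if "x \<in> ?E" for r x
  proof -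
    have "tensor_eq scale scaleH (\<Sum>i\<in>Basis. pure (i, r *h ?c i x)) (\<Sum>i\<in>Basis. fscale r (pure (i, ?c i x)))"
      by (intro tensor_eq_sum tensor_eq_pure_scale_right)
    moreover have "tensor_eq scale scaleH (fscale r x) (\<Sum>i\<in>Basis. fscale r (pure (i, ?c i x)))"
    proof -
      from that have "tensor_eq scale scaleH x (\<Sum>i\<in>Basis. pure (i, ?c i x))" by simp
      from tensor_eq_fscale[OF this, of r] show ?thesis by (simp add: W.scale_sum_right)
    qed
    ultimately show ?thesis by (simp add: c.scale) (meson tensor_eq_sym tensor_eq_trans)
  qed
  have pure: "pure (m, a) \<in> ?E" for m a
  proof -
    have "tensor_eq scale scaleH (pure (\<Sum>i\<in>Basis. cor i m *s i, a)) (\<Sum>i\<in>Basis. pure (cor i m *s i, a))"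
      by (rule tensor_eq_pure_sum_left)
    moreover have "tensor_eq scale scaleH (\<Sum>i\<in>Basis. pure (cor i m *s i, a)) (\<Sum>i\<in>Basis. pure (i, cor i m *h a))"
      by (intro tensor_eq_sum) (meson tensor_eq_pure_scale_left tensor_eq_pure_scale_right tensor_eq_sym tensor_eq_trans)
    moreover have "?c i (pure (m, a)) = cor i m *h a" for i
      by (simp add: ext_def lin_ext_pure[OF vsH])
    ultimately show ?thesis by (simp add: cor_sum) (rule tensor_eq_trans)
  qed
  have dec: "x = (\<Sum>k\<in>Poly_Mapping.keys x. fscale (Poly_Mapping.lookup x k) (pure k))"
    by (rule poly_mapping_eqI)
      (auto simp: lookup_sum lookup_single when_def in_keys_iff if_distrib[of "(*) _"] cong: if_cong)
  have mem: "(\<Sum>k\<in>K. fscale (c k) (pure k)) \<in> ?E" for K c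
  proof (induction K rule: infinite_finite_induct)
    case (insert k K)
    have "fscale (c k) (pure k) \<in> ?E" by (rule sc) (cases k, simp only: pure)
    then show ?case unfolding sum.insert[OF insert.hyps] using insert.IH by (rule add)
  qed (simp_all only: sum.infinite sum.empty zero not_False_eq_True)
  have "x \<in> ?E" by (subst dec) (rule mem)
  then show ?thesis by (rule CollectD)
qed

lemma coinv_subcomodule:
  assumes W: "coinv W" shows "subcomodule W"
  unfolding subcomodule_def
proof (intro conjI ballI)
  show "subspace W" using W by (rule coinv_subspace)
  then obtain p where p: "lin p" "\<And>v. p \<bullet> v \<in> W" "\<And>w. w \<in> W \<Longrightarrow> p \<bullet> w = w"
    using projection_exists by blast
  fix w assume w: "w \<in> W"
  let ?x = "\<Sum>i\<in>Basis. pure (p \<bullet> i, hc i w)"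
  let ?c = "\<lambda>i x. ext scaleH (\<lambda>m a. cor i m *h a) x"
  interpret c: Vector_Spaces.linear fscale scaleH "?c i" for i by (rule linear_ext[OF vsH])
  have "Poly_Mapping.keys ?x \<subseteq> W \<times> UNIV"
    by (rule order_trans[OF Poly_Mapping.keys_sum]) (use p(2) in auto)
  moreover have "tensor_eq scale scaleH (\<rho> w) ?x"
  proof -
    have "?c k (\<rho> w) = ?c k ?x" if "k \<in> Basis" for k
      using coinv_hc[OF W p(1,3) that w]
      unfolding c.sum by (simp add: hc_def[symmetric]) (simp add: ext_def lin_ext_pure[OF vsH])
    then have "(\<Sum>k\<in>Basis. pure (k, ?c k (\<rho> w))) = (\<Sum>k\<in>Basis. pure (k, ?c k ?x) :: 'l \<times> 'h \<Rightarrow>\<^sub>0 'f)"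
      by (intro sum.cong) auto
    then show ?thesis
      using tensor_eq_trans[OF tensor_eq_coordinates[of "\<rho> w"]] tensor_eq_sym[OF tensor_eq_coordinates[of ?x]]
      by simp
  qed
  ultimately show "\<exists>x. Poly_Mapping.keys x \<subseteq> W \<times> UNIV \<and> tensor_eq scale scaleH (\<rho> w) x" by blast
qed

lemma dact_br:
  assumes f: "functional f"
  shows "dact f (br x y) = (\<Sum>p\<in>Basis. \<Sum>r\<in>Basis. f (hc p x * hc r y) *s br p r)"
proof -
  have "dact f (br x y) = (\<Sum>m\<in>Basis. (\<Sum>p\<in>Basis. \<Sum>r\<in>Basis. (f (hc p x * hc r y) * cor m (br p r)) *s m))"
    by (simp add: dact_def hc_br functional_simps[OF f] scale_sum_left mult.commute)
  also have "\<dots> = (\<Sum>p\<in>Basis. \<Sum>r\<in>Basis. \<Sum>m\<in>Basis. (f (hc p x * hc r y) * cor m (br p r)) *s m)"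
    by (subst sum.swap, rule sum.cong[OF refl], rule sum.swap)
  also have "\<dots> = (\<Sum>p\<in>Basis. \<Sum>r\<in>Basis. f (hc p x * hc r y) *s br p r)"
    by (intro sum.cong refl) (subst (2) cor_sum[symmetric], simp add: scale_sum_right)
  finally show ?thesis .
qed

text \<open>The coaction on \<open>br x y\<close> has brackets of first legs of \<open>x\<close> and
  \<open>y\<close> as its first legs, and by \<open>coinv_sum\<close> these legs can be taken in
  \<open>W\<close>.\<close>

lemma coinv_brackets:
  assumes W: "coinv W"
  shows "coinv (span {br x y | x y. x \<in> W \<and> y \<in> W})"
  unfolding coinv_def
proof (intro conjI allI impI ballI)
  let ?S = "{br x y | x y. x \<in> W \<and> y \<in> W}"
  show "subspace (span ?S)" by (rule subspace_span)
  fix f w assume f: "functional f" and w: "w \<in> span ?S"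
  obtain p where p: "lin p" "\<And>v. p \<bullet> v \<in> W" "\<And>w. w \<in> W \<Longrightarrow> p \<bullet> w = w"
    using projection_exists[OF coinv_subspace[OF W]] by blast
  have "dact f (br x y) \<in> span ?S" if x: "x \<in> W" and y: "y \<in> W" for x y
  proof -
    have "dact f (br x y) = (\<Sum>k\<in>Basis. \<Sum>r\<in>Basis. f (hc (k) x * hc r y) *s br k r)"
      by (rule dact_br[OF f])
    also have "\<dots> = (\<Sum>k\<in>Basis. \<Sum>r\<in>Basis. f (hc k x * hc r y) *s br (p \<bullet> k) r)"
      by (rule coinv_sum[OF W p(1,3) x _ vsL, of "\<lambda>k a. \<Sum>r\<in>Basis. f (a * hc r y) *s br k r"])
        (auto simp: bilinear_map_def br_add_left br_scale_left scale_left_distrib scale_right_distrib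
          sum.distrib scale_sum_right distrib_right functional_simps[OF f] scaleH_mult mult.commute)
    also have "\<dots> = (\<Sum>k\<in>Basis. \<Sum>r\<in>Basis. f (hc k x * hc r y) *s br (p \<bullet> k) (p \<bullet> r))"
      by (rule sum.cong[OF refl],
          rule coinv_sum[OF W p(1,3) y _ vsL, of "\<lambda>r a. f (hc _ x * a) *s br (p \<bullet> _) r"])
        (auto simp: bilinear_map_def br_add_right br_scale_right scale_left_distrib scale_right_distrib
          distrib_left functional_simps[OF f] scaleH_mult mult.commute)
    also have "\<dots> \<in> span ?S"
      using p(2) by (intro span_sum span_scale span_base) blast
    finally show ?thesis .
  qed
  then have gen: "dact f b \<in> span ?S" if "b \<in> ?S" for b using that by auto
  have "lin (Endo (dact f))" "Endo (dact f) \<bullet> x = dact f x" for x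
  proof -
    show app: "Endo (dact f) \<bullet> x = dact f x" for x by (rule app_Endo) (rule dact_add[OF f])
    show "lin (Endo (dact f))" by (simp add: lin_def app dact_scale[OF f])
  qed
  then show "dact f w \<in> span ?S"
    using span_closed_app[OF _ _ subspace_span w, of "Endo (dact f)"] gen by auto
qed

end

context fd_comodule_lie
begin

section \<open>Averaging with an ad-invariant integral\<close>

context
  fixes t :: "'h \<Rightarrow> 'f"
  assumes integral: "H.left_integral t" and adinv: "H.ad_invariant t" and t1: "t 1 = 1"
begin

lemma t_functional: "functional t"
  using integral by (simp add: H.left_integral_def)

lemmas t_simps = functional_simps[OF t_functional]

lemma t_integral: "ext scaleH (\<lambda>a b. t b *h a) (\<Delta> a) = t a *h 1"
  using integral by (simp add: H.left_integral_def ext_def)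

text \<open>Ad-invariance on the element \<open>hc p x\<close>, whose coproduct is a matrix
  product.\<close>

lemma t_ad: assumes "p \<in> Basis" shows "(\<Sum>a\<in>Basis. t (hc p a * b * S (hc a x))) = cor p x * t b"
proof -
  have "(\<Sum>a\<in>Basis. hc p a * b * S (hc a x)) = ext scaleH (\<lambda>a1 a2. a1 * b * S a2) (\<Delta> (hc p x))"
    by (rule ext_comult[OF vsH, symmetric])
      (auto simp: bilinear_map_def distrib_left distrib_right antipode_add antipode_scale scaleH_mult)
  then have "t (\<Sum>a\<in>Basis. hc p a * b * S (hc a x)) = \<epsilon> (hc p x) * t b"
    using adinv by (simp add: H.ad_invariant_def ext_def)
  then show ?thesis using counit_hc[OF assms] by (simp add: t_simps)
qed

definition twist :: "'l \<Rightarrow> 'h \<Rightarrow> 'l"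
  where "twist v z = dact (\<lambda>a. t (a * z)) v"

lemma bil_twist: "bilL scale twist"
  unfolding bilinear_map_def twist_def
  by (auto simp: dact_add[OF functional_mult_right[OF t_functional]] dact_scale[OF functional_mult_right[OF t_functional]])
    (auto simp: dact_def distrib_left t_simps scale_left_distrib sum.distrib scaleH_mult scale_sum_right)

lemma twist_simps:
  "twist (u + v) z = twist u z + twist v z" "twist u (y + z) = twist u y + twist u z"
  "twist (c *s u) z = c *s twist u z" "twist u (c *h z) = c *s twist u z"
  using bil_twist by (auto simp: bilinear_map_def)

lemma twist_diff: "twist (u - v) z = twist u z - twist v z"
  using twist_simps(1)[of "u - v" v z] by simp

lemma twist_coinv: "coinv W \<Longrightarrow> v \<in> W \<Longrightarrow> twist v z \<in> W"
  unfolding twist_def by (intro coinv_dact functional_mult_right t_functional)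

text \<open>In Sweedler notation, \<open>twist v z = t(v_(1) z) v_(0)\<close> and
  \<open>average p x = t(p(x_(0))_(1) S(x_(1))) p(x_(0))_(0)\<close>.\<close>

definition average :: "'l endo \<Rightarrow> 'l endo"
  where "average p = Endo (\<lambda>x. \<Sum>l\<in>Basis. twist (p \<bullet> l) (S (hc l x)))"

lemma average: "average p \<bullet> x = (\<Sum>l\<in>Basis. twist (p \<bullet> l) (S (hc l x)))"
  unfolding average_def
  by (rule app_Endo) (simp add: hc_add antipode_add twist_simps sum.distrib)

lemma lin_average: "lin (average p)"
  by (simp add: lin_def average hc_scale antipode_scale twist_simps scale_sum_right)

lemma bil_average: "lin p \<Longrightarrow> bilL scale (\<lambda>l a. twist (p \<bullet> l) (S a))"
  by (auto simp: bilinear_map_def lin_scale antipode_add antipode_scale twist_simps)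

lemma average_in: "coinv W \<Longrightarrow> (\<And>v. p \<bullet> v \<in> W) \<Longrightarrow> average p \<bullet> x \<in> W"
  unfolding average by (intro subspace_sum coinv_subspace twist_coinv)

text \<open>The average of the identity is the identity: \<open>x_(1) S(x_(2))\<close> collapses and
  \<open>t 1 = 1\<close> remains.\<close>

lemma twist_antipode: "(\<Sum>i\<in>Basis. twist i (S (hc i x))) = x"
proof -
  have "(\<Sum>i\<in>Basis. twist i (S (hc i x))) = (\<Sum>m\<in>Basis. t (\<Sum>i\<in>Basis. hc m i * S (hc i x)) *s m)"
    unfolding twist_def dact_def by (subst sum.swap) (simp add: t_simps scale_sum_left)
  also have "\<dots> = (\<Sum>m\<in>Basis. cor m x *s m)"
    by (rule sum.cong) (simp_all add: hc_antipode t_simps t1)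
  finally show ?thesis by (simp add: cor_sum)
qed

lemma average_identity:
  assumes J: "coinv J" and J': "coinv J'" and p: "lin p" "\<And>j. j \<in> J \<Longrightarrow> p \<bullet> j - j \<in> J'" and j: "j \<in> J"
  shows "average p \<bullet> j - j \<in> J'"
proof -
  obtain r where r: "lin r" "\<And>v. r \<bullet> v \<in> J" "\<And>w. w \<in> J \<Longrightarrow> r \<bullet> w = w"
    using projection_exists[OF coinv_subspace[OF J]] by blast
  have "average p \<bullet> j = (\<Sum>i\<in>Basis. twist (p \<bullet> r \<bullet> i) (S (hc i j)))"
    unfolding average by (rule coinv_sum[OF J r(1,3) j bil_average[OF p(1)] vsL])
  moreover have "j = (\<Sum>i\<in>Basis. twist (r \<bullet> i) (S (hc i j)))"
    using coinv_sum[OF J r(1,3) j bil_average[of 1] vsL] by (simp add: twist_antipode)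
  ultimately have "average p \<bullet> j - j = (\<Sum>i\<in>Basis. twist (p \<bullet> r \<bullet> i - r \<bullet> i) (S (hc i j)))"
    by (simp add: twist_diff sum_subtractf)
  also have "\<dots> \<in> J'"
    by (intro subspace_sum coinv_subspace[OF J'] twist_coinv[OF J'] p(2) r(2))
  finally show ?thesis .
qed

lemma br_sum_sum: "br (\<Sum>i\<in>I. c i *s u i) (\<Sum>j\<in>K. d j *s v j) = (\<Sum>i\<in>I. \<Sum>j\<in>K. (c i * d j) *s br (u i) (v j))"
  unfolding br_sum_left br_scale_left by (simp add: br_sum_right br_scale_right scale_sum_right)

lemma br_coordinates: "br x y = (\<Sum>p\<in>Basis. \<Sum>r\<in>Basis. (cor p x * cor r y) *s br p r)"
proof -
  have "br x y = br (\<Sum>p\<in>Basis. cor p x *s p) (\<Sum>r\<in>Basis. cor r y *s r)" by (simp only: cor_sum)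
  also have "\<dots> = (\<Sum>p\<in>Basis. \<Sum>r\<in>Basis. (cor p x * cor r y) *s br p r)"
    by (rule br_sum_sum)
  finally show ?thesis .
qed

text \<open>Takes the place of \<open>S(a b) = S(b) S(a)\<close>. By \<open>M\<close> the reversed
  products are a right inverse of the array \<open>hc m (br a b)\<close>, so multiplying by
  \<open>S (hc l m)\<close>, which inverts the matrix from the left, isolates
  \<open>S (hc l (br x y))\<close>.\<close>

lemma antipode_hc_br:
  assumes l: "l \<in> Basis"
  shows "S (hc l (br x y)) = (\<Sum>a\<in>Basis. \<Sum>b\<in>Basis. cor l (br a b) *h (S (hc b y) * S (hc a x)))"
proof -
  let ?z = "\<lambda>a b. S (hc b y) * S (hc a x)"
  have M: "(\<Sum>a\<in>Basis. \<Sum>b\<in>Basis. hc m (br a b) * ?z a b) = cor m (br x y) *h 1" for m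
  proof -
    have 1: "(\<Sum>b\<in>Basis. hc m (br a b) * ?z a b)
      = (\<Sum>p\<in>Basis. \<Sum>r\<in>Basis. (cor m (br p r) * cor r y) *h (hc p a * S (hc a x)))" for a
    proof -
      have "(\<Sum>b\<in>Basis. hc m (br a b) * ?z a b)
        = (\<Sum>b\<in>Basis. \<Sum>p\<in>Basis. \<Sum>r\<in>Basis. cor m (br p r) *h (hc p a * (hc r b * S (hc b y)) * S (hc a x)))"
        by (simp add: hc_br sum_distrib_right scaleH_mult mult.assoc)
      also have "\<dots> = (\<Sum>p\<in>Basis. \<Sum>b\<in>Basis. \<Sum>r\<in>Basis. cor m (br p r) *h (hc p a * (hc r b * S (hc b y)) * S (hc a x)))"
        by (rule sum.swap)
      also have "\<dots> = (\<Sum>p\<in>Basis. \<Sum>r\<in>Basis. \<Sum>b\<in>Basis. cor m (br p r) *h (hc p a * (hc r b * S (hc b y)) * S (hc a x)))"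
        by (intro sum.cong refl sum.swap)
      also have "\<dots> = (\<Sum>p\<in>Basis. \<Sum>r\<in>Basis. (cor m (br p r) * cor r y) *h (hc p a * S (hc a x)))"
      proof (intro sum.cong refl)
        fix p r assume r: "r \<in> Basis"
        have "(\<Sum>b\<in>Basis. cor m (br p r) *h (hc p a * (hc r b * S (hc b y)) * S (hc a x)))
          = cor m (br p r) *h (hc p a * (\<Sum>b\<in>Basis. hc r b * S (hc b y)) * S (hc a x))"
          by (simp add: H.scale_sum_right sum_distrib_left sum_distrib_right)
        then show "(\<Sum>b\<in>Basis. cor m (br p r) *h (hc p a * (hc r b * S (hc b y)) * S (hc a x)))
          = (cor m (br p r) * cor r y) *h (hc p a * S (hc a x))"
          by (simp add: hc_antipode[OF r] scaleH_mult)
      qed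
      finally show ?thesis .
    qed
    have "(\<Sum>a\<in>Basis. \<Sum>b\<in>Basis. hc m (br a b) * ?z a b)
      = (\<Sum>p\<in>Basis. \<Sum>a\<in>Basis. \<Sum>r\<in>Basis. (cor m (br p r) * cor r y) *h (hc p a * S (hc a x)))"
      unfolding 1 by (rule sum.swap)
    also have "\<dots> = (\<Sum>p\<in>Basis. \<Sum>r\<in>Basis. \<Sum>a\<in>Basis. (cor m (br p r) * cor r y) *h (hc p a * S (hc a x)))"
      by (intro sum.cong refl sum.swap)
    also have "\<dots> = (\<Sum>p\<in>Basis. \<Sum>r\<in>Basis. (cor m (br p r) * cor r y * cor p x) *h 1)"
      by (intro sum.cong refl) (simp add: hc_antipode flip: H.scale_sum_right)
    also have "\<dots> = cor m (br x y) *h 1"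
      by (subst br_coordinates) 
        (simp add: representation_sum representation_scale independent_Basis span_Basis H.scale_sum_left mult_ac)
    finally show ?thesis .
  qed
  have "(\<Sum>a\<in>Basis. \<Sum>b\<in>Basis. cor l (br a b) *h ?z a b)
    = (\<Sum>a\<in>Basis. \<Sum>b\<in>Basis. \<Sum>m\<in>Basis. S (hc l m) * (hc m (br a b) * ?z a b))"
  proof (intro sum.cong refl)
    fix a b
    have "cor l (br a b) *h ?z a b = (cor l (br a b) *h 1) * ?z a b" by (simp add: scaleH_mult)
    also have "\<dots> = (\<Sum>m\<in>Basis. S (hc l m) * hc m (br a b)) * ?z a b"
      by (simp only: hc_antipode(2)[OF l])
    finally show "cor l (br a b) *h ?z a b = (\<Sum>m\<in>Basis. S (hc l m) * (hc m (br a b) * ?z a b))"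
      by (simp add: sum_distrib_right mult.assoc)
  qed
  also have "\<dots> = (\<Sum>a\<in>Basis. \<Sum>m\<in>Basis. \<Sum>b\<in>Basis. S (hc l m) * (hc m (br a b) * ?z a b))"
    by (intro sum.cong refl sum.swap)
  also have "\<dots> = (\<Sum>m\<in>Basis. \<Sum>a\<in>Basis. \<Sum>b\<in>Basis. S (hc l m) * (hc m (br a b) * ?z a b))"
    by (rule sum.swap)
  also have "\<dots> = (\<Sum>m\<in>Basis. S (hc l m) * (cor m (br x y) *h 1))"
    by (simp add: M flip: sum_distrib_left)
  also have "\<dots> = S (\<Sum>m\<in>Basis. cor m (br x y) *h hc l m)"
    by (simp add: antipode_sum antipode_scale scaleH_mult)
  finally show ?thesis by (simp add: hc_cor)
qed

lemma average_br:
  assumes p: "lin p"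
  shows "average p \<bullet> br x y = (\<Sum>a\<in>Basis. \<Sum>b\<in>Basis. twist (p \<bullet> br a b) (S (hc b y) * S (hc a x)))"
proof -
  let ?z = "\<lambda>a b. S (hc b y) * S (hc a x)"
  have "average p \<bullet> br x y = (\<Sum>l\<in>Basis. \<Sum>a\<in>Basis. \<Sum>b\<in>Basis. cor l (br a b) *s twist (p \<bullet> l) (?z a b))"
  proof (unfold average, intro sum.cong refl)
    fix l assume l: "l \<in> Basis"
    have sum: "twist v (\<Sum>i\<in>I. w i) = (\<Sum>i\<in>I. twist v (w i))" for v and w :: "'l \<Rightarrow> 'h" and I
      using bilinear_map_sum_right[OF bil_twist, of v "\<lambda>_. 1" w I] by simp
    show "twist (p \<bullet> l) (S (hc l (br x y))) = (\<Sum>a\<in>Basis. \<Sum>b\<in>Basis. cor l (br a b) *s twist (p \<bullet> l) (?z a b))"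
      unfolding antipode_hc_br[OF l] by (simp add: sum twist_simps)
  qed
  also have "\<dots> = (\<Sum>a\<in>Basis. \<Sum>l\<in>Basis. \<Sum>b\<in>Basis. cor l (br a b) *s twist (p \<bullet> l) (?z a b))"
    by (rule sum.swap)
  also have "\<dots> = (\<Sum>a\<in>Basis. \<Sum>b\<in>Basis. \<Sum>l\<in>Basis. cor l (br a b) *s twist (p \<bullet> l) (?z a b))"
    by (intro sum.cong refl sum.swap)
  also have "\<dots> = (\<Sum>a\<in>Basis. \<Sum>b\<in>Basis. twist (p \<bullet> br a b) (?z a b))"
  proof (intro sum.cong refl)
    fix a b
    have "p \<bullet> br a b = (\<Sum>l\<in>Basis. cor l (br a b) *s (p \<bullet> l))"
      by (subst cor_sum[of "br a b", symmetric]) (simp add: app_sum lin_scale[OF p])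
    then show "(\<Sum>l\<in>Basis. cor l (br a b) *s twist (p \<bullet> l) (?z a b)) = twist (p \<bullet> br a b) (?z a b)"
      using bilinear_map_sum_left[OF bil_twist vsL] by metis
  qed
  finally show ?thesis .
qed

lemma coinv_sum2:
  assumes W: "coinv W" and r: "lin r" "\<And>w. w \<in> W \<Longrightarrow> r \<bullet> w = w" and x: "x \<in> W" and y: "y \<in> W"
    and F: "bilinear_map scale scale scale F"
  shows "(\<Sum>a\<in>Basis. \<Sum>b\<in>Basis. twist (F a b) (S (hc b y) * S (hc a x)))
    = (\<Sum>a\<in>Basis. \<Sum>b\<in>Basis. twist (F (r \<bullet> a) (r \<bullet> b)) (S (hc b y) * S (hc a x)))"
proof -
  note F' = F[unfolded bilinear_map_def]
  have "(\<Sum>a\<in>Basis. \<Sum>b\<in>Basis. twist (F a b) (S (hc b y) * S (hc a x)))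
    = (\<Sum>a\<in>Basis. \<Sum>b\<in>Basis. twist (F (r \<bullet> a) b) (S (hc b y) * S (hc a x)))"
    by (rule coinv_sum[OF W r x _ vsL, of "\<lambda>a h. \<Sum>b\<in>Basis. twist (F a b) (S (hc b y) * S h)"])
      (use F' in \<open>auto simp: bilinear_map_def antipode_add antipode_scale scaleH_mult distrib_left twist_simps
        sum.distrib scale_sum_right\<close>)
  also have "\<dots> = (\<Sum>a\<in>Basis. \<Sum>b\<in>Basis. twist (F (r \<bullet> a) (r \<bullet> b)) (S (hc b y) * S (hc a x)))"
    by (rule sum.cong[OF refl],
        rule coinv_sum[OF W r y _ vsL, of "\<lambda>b h. twist (F (r \<bullet> _) b) (S h * S (hc _ x))"])
      (use F' in \<open>auto simp: bilinear_map_def antipode_add antipode_scale scaleH_mult distrib_right twist_simps\<close>)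
  finally show ?thesis .
qed

lemma twist_br: "twist (br u v) z = (\<Sum>p\<in>Basis. \<Sum>r\<in>Basis. t (hc p u * hc r v * z) *s br p r)"
  unfolding twist_def by (rule dact_br[OF functional_mult_right[OF t_functional]])

lemma twist_br_right: "(\<Sum>b\<in>Basis. twist (br v b) (S (hc b y) * z)) = br (twist v z) y"
proof -
  have "(\<Sum>b\<in>Basis. twist (br v b) (S (hc b y) * z))
    = (\<Sum>p\<in>Basis. \<Sum>b\<in>Basis. \<Sum>r\<in>Basis. t (hc p v * (hc r b * S (hc b y)) * z) *s br p r)"
    unfolding twist_br by (subst sum.swap) (simp add: mult.assoc)
  also have "\<dots> = (\<Sum>p\<in>Basis. \<Sum>r\<in>Basis. \<Sum>b\<in>Basis. t (hc p v * (hc r b * S (hc b y)) * z) *s br p r)"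
    by (intro sum.cong refl sum.swap)
  also have "\<dots> = (\<Sum>p\<in>Basis. \<Sum>r\<in>Basis. (t (hc p v * z) * cor r y) *s br p r)"
  proof (intro sum.cong refl)
    fix p r assume r: "r \<in> Basis"
    have "(\<Sum>b\<in>Basis. t (hc p v * (hc r b * S (hc b y)) * z) *s br p r)
      = t (hc p v * (\<Sum>b\<in>Basis. hc r b * S (hc b y)) * z) *s br p r"
      by (simp add: sum_distrib_left sum_distrib_right t_simps scale_sum_left)
    then show "(\<Sum>b\<in>Basis. t (hc p v * (hc r b * S (hc b y)) * z) *s br p r) = (t (hc p v * z) * cor r y) *s br p r"
      by (simp add: hc_antipode[OF r] scaleH_mult t_simps mult.commute)
  qed
  also have "\<dots> = br (twist v z) (\<Sum>r\<in>Basis. cor r y *s r)"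
    unfolding twist_def dact_def br_sum_sum ..
  finally show ?thesis by (simp add: cor_sum)
qed

text \<open>In \<open>twist_br_right\<close> the two factors from \<open>y\<close> are adjacent and
  cancel by the antipode. Here those from \<open>x\<close> enclose \<open>hc r v * z\<close>, and
  ad-invariance of \<open>t\<close> is what removes them.\<close>

lemma twist_br_left: "(\<Sum>a\<in>Basis. twist (br a v) (z * S (hc a x))) = br x (twist v z)"
proof -
  have "(\<Sum>a\<in>Basis. twist (br a v) (z * S (hc a x)))
    = (\<Sum>p\<in>Basis. \<Sum>a\<in>Basis. \<Sum>r\<in>Basis. t (hc p a * (hc r v * z) * S (hc a x)) *s br p r)"
    unfolding twist_br by (subst sum.swap) (simp add: mult.assoc)
  also have "\<dots> = (\<Sum>p\<in>Basis. \<Sum>r\<in>Basis. \<Sum>a\<in>Basis. t (hc p a * (hc r v * z) * S (hc a x)) *s br p r)"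
    by (intro sum.cong refl sum.swap)
  also have "\<dots> = (\<Sum>p\<in>Basis. \<Sum>r\<in>Basis. (cor p x * t (hc r v * z)) *s br p r)"
    by (intro sum.cong refl) (simp add: t_ad flip: scale_sum_left)
  also have "\<dots> = br (\<Sum>p\<in>Basis. cor p x *s p) (twist v z)"
    unfolding twist_def dact_def br_sum_sum ..
  finally show ?thesis by (simp add: cor_sum)
qed

text \<open>Both sides are sums over the same arguments \<open>S (hc b y) * S (hc a x)\<close>.
  After \<open>a\<close> and \<open>b\<close> are projected to \<open>A\<close>, the derivation rule
  holds in each summand modulo \<open>J'\<close>, and twisting preserves \<open>J'\<close>.\<close>

lemma average_derivation:
  assumes A: "coinv A" and J': "coinv J'" and p: "lin p"
    and der: "\<And>x y. x \<in> A \<Longrightarrow> y \<in> A \<Longrightarrow> p \<bullet> br x y - (br (p \<bullet> x) y + br x (p \<bullet> y)) \<in> J'"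
    and x: "x \<in> A" and y: "y \<in> A"
  shows "average p \<bullet> br x y - (br (average p \<bullet> x) y + br x (average p \<bullet> y)) \<in> J'"
proof -
  obtain r where r: "lin r" "\<And>v. r \<bullet> v \<in> A" "\<And>w. w \<in> A \<Longrightarrow> r \<bullet> w = w"
    using projection_exists[OF coinv_subspace[OF A]] by blast
  let ?z = "\<lambda>a b. S (hc b y) * S (hc a x)"
  let ?F = "\<lambda>a b. br (p \<bullet> a) b + br a (p \<bullet> b)"
  have bF: "bilinear_map scale scale scale ?F"
    by (auto simp: bilinear_map_def br_add_left br_add_right br_scale_left br_scale_right lin_scale[OF p] scale_right_distrib)
  have bp: "bilinear_map scale scale scale (\<lambda>a b. p \<bullet> br a b)"
    by (auto simp: bilinear_map_def br_add_left br_add_right br_scale_left br_scale_right lin_scale[OF p])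
  have 1: "(\<Sum>a\<in>Basis. \<Sum>b\<in>Basis. twist (br (p \<bullet> a) b) (?z a b)) = br (average p \<bullet> x) y"
    by (simp add: twist_br_right average br_sum_left)
  have 2: "(\<Sum>a\<in>Basis. \<Sum>b\<in>Basis. twist (br a (p \<bullet> b)) (?z a b)) = br x (average p \<bullet> y)"
    by (subst sum.swap) (simp add: twist_br_left average br_sum_right)
  have "br (average p \<bullet> x) y + br x (average p \<bullet> y) = (\<Sum>a\<in>Basis. \<Sum>b\<in>Basis. twist (?F a b) (?z a b))"
    by (simp add: twist_simps sum.distrib 1 2)
  also have "\<dots> = (\<Sum>a\<in>Basis. \<Sum>b\<in>Basis. twist (?F (r \<bullet> a) (r \<bullet> b)) (?z a b))"
    by (rule coinv_sum2[OF A r(1,3) x y bF])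
  finally have 3: "br (average p \<bullet> x) y + br x (average p \<bullet> y)
    = (\<Sum>a\<in>Basis. \<Sum>b\<in>Basis. twist (?F (r \<bullet> a) (r \<bullet> b)) (?z a b))" .
  have "average p \<bullet> br x y = (\<Sum>a\<in>Basis. \<Sum>b\<in>Basis. twist (p \<bullet> br (r \<bullet> a) (r \<bullet> b)) (?z a b))"
    unfolding average_br[OF p] by (rule coinv_sum2[OF A r(1,3) x y bp])
  then have "average p \<bullet> br x y - (br (average p \<bullet> x) y + br x (average p \<bullet> y))
    = (\<Sum>a\<in>Basis. \<Sum>b\<in>Basis. twist (p \<bullet> br (r \<bullet> a) (r \<bullet> b) - ?F (r \<bullet> a) (r \<bullet> b)) (?z a b))"
    unfolding 3 by (simp only: twist_diff sum_subtractf)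
  also have "\<dots> \<in> J'"
    by (intro subspace_sum[OF coinv_subspace[OF J']] twist_coinv[OF J'] der r)
  finally show ?thesis .
qed

text \<open>This is the colinearity of \<open>average p\<close>. It follows by evaluating the sum over \<open>m\<close> of
  \<open>a \<otimes> b \<mapsto> t(b S(hc m x)) a\<close> on \<open>\<Delta> (hc i (p m))\<close> in two ways, once through
  \<open>hc i (p m) = (\<Sum>k. M i k * hc k m)\<close> and the integral property of \<open>t\<close>.\<close>

lemma hc_average:
  assumes p: "lin p" and i: "i \<in> Basis"
  shows "hc i (average p \<bullet> x) = (\<Sum>k\<in>Basis. cor i (average p \<bullet> k) *h hc k x)"
proof -
  \<comment> \<open>The matrix of \<open>p\<close> conjugated by the corepresentation;
    \<open>t\<close> applied to its entries gives \<open>average p\<close>.\<close>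
  define M where "M i x = (\<Sum>l\<in>Basis. hc i (p \<bullet> l) * S (hc l x))" for i x
  have avg: "average p \<bullet> x = (\<Sum>m\<in>Basis. t (M m x) *s m)" for x
    unfolding average twist_def dact_def M_def by (subst sum.swap) (simp add: t_simps scale_sum_left)
  define G where "G m a b = t (b * S (hc m x)) *h a" for m a b
  have bG: "bilH scaleH (G m)" for m
    by (auto simp: G_def bilinear_map_def distrib_right t_simps scaleH_mult H.scale_left_distrib
        H.scale_right_distrib mult.commute)
  have lG: "Vector_Spaces.linear scaleH scaleH (\<lambda>a. ext scaleH (G m) (\<Delta> a))" for m
    by (rule linear_ext_into_tensor[OF vsH vsH bG H.comult_linear])
  have left: "hc i (average p \<bullet> x) = (\<Sum>m\<in>Basis. ext scaleH (G m) (\<Delta> (hc i (p \<bullet> m))))"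
  proof -
    have "(\<Sum>m\<in>Basis. ext scaleH (G m) (\<Delta> (hc i (p \<bullet> m))))
      = (\<Sum>k\<in>Basis. \<Sum>m\<in>Basis. t (hc k (p \<bullet> m) * S (hc m x)) *h hc i k)"
      by (subst sum.swap) (simp add: ext_comult[OF vsH bG] G_def)
    then show ?thesis
      by (simp add: avg hc_sum hc_scale M_def t_simps H.scale_sum_left)
  qed
  have M_mult: "(\<Sum>k\<in>Basis. M i k * hc k m) = hc i (p \<bullet> m)" for m
  proof -
    have "(\<Sum>k\<in>Basis. M i k * hc k m) = (\<Sum>l\<in>Basis. \<Sum>k\<in>Basis. hc i (p \<bullet> l) * (S (hc l k) * hc k m))"
      unfolding M_def by (subst sum.swap) (simp add: sum_distrib_right mult.assoc)
    also have "\<dots> = (\<Sum>l\<in>Basis. cor l m *h hc i (p \<bullet> l))"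
      by (intro sum.cong refl) (simp add: hc_antipode scaleH_mult flip: sum_distrib_left)
    also have "\<dots> = hc i (p \<bullet> (\<Sum>l\<in>Basis. cor l m *s l))"
      by (simp add: app_sum lin_scale[OF p] hc_sum hc_scale)
    finally show ?thesis by (simp add: cor_sum)
  qed
  have ext_mult: "ext scaleH (G m) (\<Delta> (c * hc k m))
      = ext scaleH (\<lambda>a b. \<Sum>r\<in>Basis. t (b * (hc r m * S (hc m x))) *h (a * hc k r)) (\<Delta> c)" for c k m
  proof -
    have "ext scaleH (\<lambda>a' b'. G m (a * a') (b * b')) (\<Delta> (hc k m)) = (\<Sum>r\<in>Basis. G m (a * hc k r) (b * hc r m))" for a b
      by (rule ext_comult[OF vsH])
        (use bG[of m] in \<open>auto simp: bilinear_map_def distrib_left scaleH_mult\<close>)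
    moreover have "ext scaleH (G m) (\<Delta> (c * hc k m))
      = ext scaleH (\<lambda>a b. ext scaleH (\<lambda>a' b'. G m (a * a') (b * b')) (\<Delta> (hc k m))) (\<Delta> c)"
      unfolding ext_tensor_eq[OF vsH bG H.comult_mult] by (rule ext_tensor_product_mult[OF vsH])
    ultimately show ?thesis by (simp add: G_def mult.assoc)
  qed
  have "hc i (average p \<bullet> x) = (\<Sum>m\<in>Basis. \<Sum>k\<in>Basis. ext scaleH (G m) (\<Delta> (M i k * hc k m)))"
    unfolding left
  proof (intro sum.cong refl)
    fix m
    interpret l: Vector_Spaces.linear scaleH scaleH "\<lambda>a. ext scaleH (G m) (\<Delta> a)" by (rule lG)
    show "ext scaleH (G m) (\<Delta> (hc i (p \<bullet> m))) = (\<Sum>k\<in>Basis. ext scaleH (G m) (\<Delta> (M i k * hc k m)))"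
      unfolding M_mult[symmetric] by (rule l.sum)
  qed
  also have "\<dots> = (\<Sum>k\<in>Basis. \<Sum>m\<in>Basis. ext scaleH (\<lambda>a b. \<Sum>r\<in>Basis. t (b * (hc r m * S (hc m x))) *h (a * hc k r)) (\<Delta> (M i k)))"
    unfolding ext_mult by (rule sum.swap)
  also have "\<dots> = (\<Sum>k\<in>Basis. (t (M i k) *h 1) * hc k x)"
  proof (intro sum.cong refl)
    fix k
    \<comment> \<open>The leg \<open>hc r m\<close> of the coproduct of \<open>hc k m\<close> meets
      \<open>S (hc m x)\<close>. Summation over \<open>m\<close> cancels both, and the integral
      property for \<open>M i k\<close> remains to be used.\<close>
    have "(\<Sum>m\<in>Basis. \<Sum>r\<in>Basis. t (b * (hc r m * S (hc m x))) *h (a * hc k r)) = t b *h a * hc k x" for a b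
    proof -
      have "(\<Sum>m\<in>Basis. \<Sum>r\<in>Basis. t (b * (hc r m * S (hc m x))) *h (a * hc k r))
        = (\<Sum>r\<in>Basis. t (b * (\<Sum>m\<in>Basis. hc r m * S (hc m x))) *h (a * hc k r))"
        by (subst sum.swap) (simp add: sum_distrib_left t_simps H.scale_sum_left)
      also have "\<dots> = (\<Sum>r\<in>Basis. t b *h (a * (cor r x *h hc k r)))"
        by (intro sum.cong refl) (simp add: hc_antipode scaleH_mult t_simps mult.commute)
      also have "\<dots> = t b *h (a * hc k x)"
        by (simp add: hc_cor flip: H.scale_sum_right sum_distrib_left)
      finally show ?thesis by (simp add: scaleH_mult)
    qed
    moreover have "Vector_Spaces.linear scaleH scaleH (\<lambda>z. z * hc k x)"
      by unfold_locales (auto simp: distrib_right scaleH_mult)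
    ultimately show "(\<Sum>m\<in>Basis. ext scaleH (\<lambda>a b. \<Sum>r\<in>Basis. t (b * (hc r m * S (hc m x))) *h (a * hc k r)) (\<Delta> (M i k)))
      = (t (M i k) *h 1) * hc k x"
      by (simp add: ext_sum[OF vsH, symmetric] flip: t_integral)
        (rule ext_compose[of scaleH scaleH "\<lambda>z. z * hc k x", symmetric])
  qed
  also have "\<dots> = (\<Sum>k\<in>Basis. cor i (average p \<bullet> k) *h hc k x)"
    by (simp add: avg cor_lincomb[OF i] scaleH_mult)
  finally show ?thesis .
qed

lemma dact_average:
  assumes p: "lin p" and f: "functional f"
  shows "dact f (average p \<bullet> x) = average p \<bullet> dact f x"
proof -
  have "dact f (average p \<bullet> x) = (\<Sum>i\<in>Basis. \<Sum>k\<in>Basis. (f (hc k x) * cor i (average p \<bullet> k)) *s i)"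
    unfolding dact_def
    by (intro sum.cong refl) (simp add: hc_average[OF p] functional_simps[OF f] scale_sum_left mult.commute)
  also have "\<dots> = (\<Sum>k\<in>Basis. f (hc k x) *s (\<Sum>i\<in>Basis. cor i (average p \<bullet> k) *s i))"
    by (subst sum.swap) (simp add: scale_sum_right)
  also have "\<dots> = average p \<bullet> dact f x"
    by (simp add: cor_sum dact_def app_sum lin_scale[OF lin_average])
  finally show ?thesis .
qed

lemma coinvariant_step:
  assumes triple: "lie_triple scale Basis br A J J'"
    and A: "coinv A" and J: "coinv J" and J': "coinv J'"
  obtains B where "subalgebra B" "coinv B" "B \<subseteq> A" "\<And>a. a \<in> A \<Longrightarrow> \<exists>b\<in>B. a - b \<in> J" "B \<inter> J = J'"
proof -
  interpret T: lie_triple scale Basis br A J J' by (rule triple)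
  obtain p where p: "lin p" "\<And>v. p \<bullet> v \<in> J" "\<And>j. j \<in> J \<Longrightarrow> p \<bullet> j - j \<in> J'"
    "\<And>x y. x \<in> A \<Longrightarrow> y \<in> A \<Longrightarrow> p \<bullet> br x y - (br (p \<bullet> x) y + br x (p \<bullet> y)) \<in> J'"
    using T.levi_derivation by blast
  let ?p = "average p"
  have pJ: "?p \<bullet> v \<in> J" for v by (rule average_in[OF J p(2)])
  have pid: "?p \<bullet> j - j \<in> J'" if "j \<in> J" for j by (rule average_identity[OF J J' p(1,3) that])
  note Js = T.J_subspace and J's = ideal_subspace[OF T.J'(1)] and As = T.A_subspace
  define B where "B = {x \<in> A. ?p \<bullet> x \<in> J'}"
  have Bs: "subspace B"
    using As J's by (auto simp: B_def subspace_def lin_scale[OF lin_average])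
  have "br x y \<in> B" if "x \<in> B" "y \<in> B" for x y
  proof -
    have xy: "x \<in> A" "y \<in> A" "?p \<bullet> x \<in> J'" "?p \<bullet> y \<in> J'" using that by (auto simp: B_def)
    have "br (?p \<bullet> x) y + br x (?p \<bullet> y) \<in> J'"
      using xy T.J'(1) by (intro subspace_add[OF J's]) (auto intro: ideal_br ideal_br_right)
    from subspace_add[OF J's this average_derivation[OF A J' p(1,4) xy(1,2)]]
    have "?p \<bullet> br x y \<in> J'" by simp
    then show ?thesis using xy subalgebra_br[OF T.A] by (auto simp: B_def)
  qed
  then have "subalgebra B" using Bs by (auto simp: subalgebra_def)
  moreover have "coinv B"
    unfolding coinv_def
  proof (intro conjI allI impI ballI)
    fix f w assume f: "functional f" and "w \<in> B"
    then have "w \<in> A" "?p \<bullet> w \<in> J'" by (auto simp: B_def)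
    then show "dact f w \<in> B"
      using coinv_dact[OF A f] coinv_dact[OF J' f] by (simp add: B_def flip: dact_average[OF p(1) f])
  qed (rule Bs)
  moreover have "\<exists>b\<in>B. a - b \<in> J" if a: "a \<in> A" for a
  proof (rule bexI)
    show "a - (a - ?p \<bullet> a) \<in> J" using pJ by simp
    \<comment> \<open>The averaged map takes values in \<open>J\<close> and is the identity there
      modulo \<open>J'\<close>, so it is idempotent modulo \<open>J'\<close>.\<close>
    have "?p \<bullet> (a - ?p \<bullet> a) = - (?p \<bullet> ?p \<bullet> a - ?p \<bullet> a)" by simp
    also have "\<dots> \<in> J'" by (rule subspace_neg[OF J's pid[OF pJ]])
    finally show "a - ?p \<bullet> a \<in> B" using a pJ T.JA subspace_diff[OF As] by (auto simp: B_def)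
  qed
  moreover have "B \<inter> J = J'"
  proof
    show "B \<inter> J \<subseteq> J'"
    proof
      fix x assume "x \<in> B \<inter> J"
      then have "?p \<bullet> x \<in> J'" "?p \<bullet> x - x \<in> J'" using pid by (auto simp: B_def)
      from subspace_diff[OF J's this] show "x \<in> J'" by simp
    qed
    show "J' \<subseteq> B \<inter> J"
    proof
      fix x assume x: "x \<in> J'"
      then have "x \<in> J" using T.J'(2) by auto
      then have "?p \<bullet> x - x + x \<in> J'" using pid x by (intro subspace_add[OF J's])
      then show "x \<in> B \<inter> J" using \<open>x \<in> J\<close> T.JA by (auto simp: B_def)
    qed
  qed
  ultimately show thesis using that by (auto simp: B_def)
qed

end

section \<open>Descent along the derived series of the radical\<close>

lemma derived_series_mono: "C \<subseteq> D \<Longrightarrow> derived_series C n \<subseteq> derived_series D n"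
proof (induction n)
  case (Suc n)
  then show ?case unfolding derived_series.simps by (intro span_mono) blast
qed simp

lemma derived_series_add: "derived_series C (m + n) = derived_series (derived_series C m) n"
  by (induction n) auto

lemma subspace_derived_series: "subspace C \<Longrightarrow> subspace (derived_series C n)"
  by (cases n) (auto simp: subspace_span)

lemma solvableI: "subspace C \<Longrightarrow> derived_series C n \<subseteq> {0} \<Longrightarrow> solvable C"
  unfolding solvable_def using subspace_derived_series[of C n] subspace_0 by blast

text \<open>As \<open>A + R\<close> is everything, \<open>I + R\<close> is an ideal of the whole
  algebra. Its derived series reaches \<open>R\<close> and then zero, so it is contained in the
  radical. Used both to apply the splitting at each stage and to see that the final \<open>B\<close>
  is semisimple.\<close>

lemma radical_of_complement:
  assumes R: "solvable_radical_of UNIV R" and A: "subalgebra A" "\<And>x. \<exists>a\<in>A. x - a \<in> R"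
    and I: "ideal_of A I" "derived_series I m \<subseteq> R"
  shows "I \<subseteq> R"
proof -
  have Ri: "ideal_of UNIV R" and max: "\<And>I. ideal_of UNIV I \<Longrightarrow> solvable I \<Longrightarrow> I \<subseteq> R"
    using R by (auto simp: solvable_radical_of_def)
  note Rs = ideal_subspace[OF Ri]
  obtain n where n: "derived_series R n = {0}" using R by (auto simp: solvable_radical_of_def solvable_def)
  define sum where "sum C = {c + r | c r. c \<in> C \<and> r \<in> R}" for C
  have ss: "subspace (sum C)" if "subspace C" for C
    unfolding sum_def using subspace_sums[OF that Rs] .
  have I': "ideal_of UNIV (sum I)"
    unfolding ideal_of_def
  proof (intro conjI ballI)
    fix x y assume "y \<in> sum I"
    then obtain c r where y: "y = c + r" "c \<in> I" "r \<in> R" by (auto simp: sum_def)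
    obtain a where a: "a \<in> A" "x - a \<in> R" using A(2) by blast
    have "br x y = br a c + (br (x - a) c + br x r)"
      by (simp add: y br_add_right br_diff_left)
    moreover have "br a c \<in> I" by (rule ideal_br[OF I(1) a(1) y(2)])
    moreover have "br (x - a) c + br x r \<in> R"
      using a y by (intro subspace_add[OF Rs] ideal_br[OF Ri] ideal_br_right[OF Ri]) auto
    ultimately show "br x y \<in> sum I" by (auto simp: sum_def)
  qed (use ss[OF ideal_subspace[OF I(1)]] in auto)
  have "derived_series (sum I) k \<subseteq> sum (derived_series I k)" for k
  proof (induction k)
    case (Suc k)
    have "br x y \<in> sum (derived_series I (Suc k))"
      if mem: "x \<in> sum (derived_series I k)" "y \<in> sum (derived_series I k)" for x y
    proof -
      obtain c r c' r' where xy: "x = c + r" "c \<in> derived_series I k" "r \<in> R"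
        "y = c' + r'" "c' \<in> derived_series I k" "r' \<in> R" using mem unfolding sum_def by blast
      have "br x y = br c c' + (br r c' + br (c + r) r')" by (simp add: xy br_add_left br_add_right)
      moreover have "br c c' \<in> derived_series I (Suc k)" using xy by (auto intro: span_base)
      moreover have "br r c' + br (c + r) r' \<in> R"
        using xy by (intro subspace_add[OF Rs] ideal_br[OF Ri] ideal_br_right[OF Ri]) auto
      ultimately show ?thesis unfolding sum_def by blast
    qed
    moreover have "subspace (sum (derived_series I (Suc k)))" by (intro ss) (simp add: subspace_span)
    ultimately show ?case
      unfolding derived_series.simps(2)[of "sum I"] using Suc by (intro span_minimal) blast+
  qed simp
  then have "derived_series (sum I) m \<subseteq> sum (derived_series I m)" .
  also have "\<dots> \<subseteq> R" using I(2) subspace_add[OF Rs] by (auto simp: sum_def)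
  finally have "derived_series (sum I) (m + n) \<subseteq> {0}"
    unfolding derived_series_add n[symmetric] by (rule derived_series_mono)
  then have "sum I \<subseteq> R" by (intro max I' solvableI ideal_subspace[OF I'])
  moreover have "I \<subseteq> sum I"
  proof
    fix x assume "x \<in> I"
    moreover have "x = x + 0" "0 \<in> R" using subspace_0[OF Rs] by auto
    ultimately show "x \<in> sum I" unfolding sum_def by blast
  qed
  ultimately show ?thesis by blast
qed

theorem coinvariant_levi:
  assumes R: "solvable_radical_of UNIV R" and coR: "coinv R"
    and t: "H.left_integral t" "H.ad_invariant t" "t 1 = 1"
  obtains B where "maximal_semisimple_subalgebra B" "coinv B" "B \<inter> R = {0}" "\<And>x. \<exists>b\<in>B. x - b \<in> R"
proof -
  have Ri: "ideal_of UNIV R" using R by (simp add: solvable_radical_of_def)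
  note Rs = ideal_subspace[OF Ri]
  obtain n where n: "derived_series R n = {0}" using R by (auto simp: solvable_radical_of_def solvable_def)
  let ?D = "derived_series R"
  have Di: "ideal_of UNIV (?D k)" for k by (rule ideal_derived_series[OF Ri])
  have DR: "?D k \<subseteq> R" for k by (rule derived_series_subset[OF ideal_subalgebra[OF Ri]])
  have coD: "coinv (?D k)" for k
    by (induction k) (simp_all add: coR coinv_brackets)
  have rel: "ideal_of A (?D k)" if "?D k \<subseteq> A" for A k
    using Di[of k] that by (auto simp: ideal_of_def)
  have "\<exists>B. subalgebra B \<and> coinv B \<and> (\<forall>x. \<exists>b\<in>B. x - b \<in> R) \<and> B \<inter> R = ?D k" for k
  proof (induction k)
    case 0
    have "subalgebra UNIV" by (simp add: subalgebra_def)
    moreover have "coinv UNIV" by (simp add: coinv_def)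
    moreover have "\<exists>b\<in>UNIV. x - b \<in> R" for x by (rule bexI[of _ x]) (simp_all add: subspace_0[OF Rs])
    ultimately show ?case by (intro exI[of _ UNIV]) simp
  next
    case (Suc k)
    then obtain A where A: "subalgebra A" "coinv A" "\<And>x. \<exists>b\<in>A. x - b \<in> R" "A \<inter> R = ?D k" by blast
    have sub: "?D (Suc k) \<subseteq> ?D k"
      using derived_series_subset_subalgebra[OF ideal_subalgebra[OF Ri], of k] by blast
    have "lie_triple scale Basis br A (?D k) (?D (Suc k))"
    proof unfold_locales
      show "ideal_of A (?D k)" "ideal_of A (?D (Suc k))" using A(4) sub by (blast intro: rel)+
      \<comment> \<open>Containment in \<open>R\<close> is enough, since \<open>I\<close> lies in
        \<open>A\<close> and \<open>A \<inter> R\<close> is \<open>?D k\<close>.\<close>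
      show "I \<subseteq> ?D k" if "ideal_of A I" "derived_series I m \<subseteq> ?D k" for I m
        using radical_of_complement[OF R A(1,3) that(1), of m] that DR[of k] A(4) ideal_subset[OF that(1)] by blast
      show "br x y \<in> ?D (Suc k)" if "x \<in> ?D k" "y \<in> ?D k" for x y
        using that by (auto intro: span_base)
    qed (use A(1) sub in auto)
    then obtain B where B: "subalgebra B" "coinv B" "B \<subseteq> A" "\<And>a. a \<in> A \<Longrightarrow> \<exists>b\<in>B. a - b \<in> ?D k"
      "B \<inter> ?D k = ?D (Suc k)"
      using coinvariant_step[OF t _ A(2) coD coD] by blast
    have "\<exists>b\<in>B. x - b \<in> R" for x
    proof -
      obtain a where a: "a \<in> A" "x - a \<in> R" using A(3) by blast
      obtain b where b: "b \<in> B" "a - b \<in> ?D k" using B(4)[OF a(1)] by blast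
      have "x - a + (a - b) \<in> R" using a b DR by (intro subspace_add[OF Rs]) auto
      then show ?thesis using b by auto
    qed
    moreover have "B \<inter> R = ?D (Suc k)" using B(3,5) A(4) by blast
    ultimately show ?case using B by blast
  qed
  then obtain B where B: "subalgebra B" "coinv B" "\<And>x. \<exists>b\<in>B. x - b \<in> R" "B \<inter> R = {0}"
    unfolding n[symmetric] by blast
  have "semisimple_subalgebra B"
    unfolding semisimple_subalgebra_def solvable_radical_of_def
  proof (intro conjI allI impI)
    show "subalgebra B" by (rule B)
    show "ideal_of B {0}" using rel[of n B] n B(4) by simp blast
    show "solvable {0}" unfolding solvable_def by (rule exI[of _ 0]) simp
    fix I assume I: "ideal_of B I \<and> solvable I"
    then obtain m where "derived_series I m = {0}" by (auto simp: solvable_def)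
    then have "derived_series I m \<subseteq> R" using subspace_0[OF Rs] by simp
    then have "I \<subseteq> R" using radical_of_complement[OF R B(1,3)] I by blast
    then show "I \<subseteq> {0}" using I B(4) ideal_subset by blast
  qed
  \<comment> \<open>A semisimple \<open>C\<close> meets \<open>R\<close> in a solvable ideal of
    \<open>C\<close>, hence in zero, and every \<open>c\<close> in \<open>C\<close> differs from an
    element of \<open>B\<close> by an element of this intersection.\<close>
  moreover have "C = B" if C: "semisimple_subalgebra C" "B \<subseteq> C" for C
  proof
    have Cs: "subalgebra C" using C by (simp add: semisimple_subalgebra_def)
    have CR: "ideal_of C (C \<inter> R)"
      unfolding ideal_of_def using Cs ideal_br[OF Ri]
      by (auto simp: subalgebra_def intro: subspace_inter Rs)
    have "derived_series (C \<inter> R) n \<subseteq> {0}" unfolding n[symmetric] by (rule derived_series_mono) simp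
    then have "solvable (C \<inter> R)" by (rule solvableI[OF ideal_subspace[OF CR]])
    then have zero: "C \<inter> R \<subseteq> {0}"
      using C CR by (auto simp: semisimple_subalgebra_def solvable_radical_of_def)
    show "C \<subseteq> B"
    proof
      fix c assume c: "c \<in> C"
      obtain b where b: "b \<in> B" "c - b \<in> R" using B(3) by blast
      then have "c - b \<in> C \<inter> R" using c C(2) subspace_diff[OF subalgebra_subspace[OF Cs]] by auto
      then have "c - b = 0" using zero by blast
      then show "c \<in> B" using b by simp
    qed
  qed (rule C)
  ultimately have "maximal_semisimple_subalgebra B" unfolding maximal_semisimple_subalgebra_def by blast
  then show thesis using that B by blast
qed

end

theorem theorem2:
  fixes scaleH :: "'f::field_char_0 \<Rightarrow> 'h::ring_1 \<Rightarrow> 'h"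
    and \<Delta> :: "'h \<Rightarrow> ('h \<times> 'h \<Rightarrow>\<^sub>0 'f)" and \<epsilon> :: "'h \<Rightarrow> 'f" and S :: "'h \<Rightarrow> 'h"
    and scaleL :: "'f \<Rightarrow> 'l::ab_group_add \<Rightarrow> 'l" and bracket :: "'l \<Rightarrow> 'l \<Rightarrow> 'l"
    and \<rho> :: "'l \<Rightarrow> ('l \<times> 'h \<Rightarrow>\<^sub>0 'f)"
    and R :: "'l set"
  assumes "hopf_algebra scaleH \<Delta> \<epsilon> S"
    and "comodule_lie_algebra scaleH \<Delta> \<epsilon> S scaleL bracket \<rho>"
    and "\<exists>Basis. finite_dimensional_vector_space scaleL Basis"
    and "lie_algebra.solvable_radical_of scaleL bracket UNIV R"
    and "right_comodule.subcomodule scaleH scaleL \<rho> R"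
    and "\<exists>t. hopf_algebra.left_integral scaleH \<Delta> t \<and>
             hopf_algebra.ad_invariant scaleH \<Delta> \<epsilon> S t \<and> t 1 = 1"
  shows "\<exists>B. lie_algebra.maximal_semisimple_subalgebra scaleL bracket B \<and>
             right_comodule.subcomodule scaleH scaleL \<rho> B \<and>
             right_comodule.subcomodule scaleH scaleL \<rho> R \<and>
             B \<inter> R = {0} \<and> {b + r | b r. b \<in> B \<and> r \<in> R} = UNIV"
proof -
  obtain Basis where Basis: "finite_dimensional_vector_space scaleL Basis" using assms(3) by blast
  interpret C: comodule_lie_algebra scaleH \<Delta> \<epsilon> S scaleL bracket \<rho> by (rule assms(2))
  interpret F: finite_dimensional_vector_space scaleL Basis by (rule Basis)
  interpret fd_comodule_lie scaleH \<Delta> \<epsilon> S scaleL Basis bracket \<rho> by unfold_locales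
  obtain t where t: "hopf_algebra.left_integral scaleH \<Delta> t" "hopf_algebra.ad_invariant scaleH \<Delta> \<epsilon> S t" "t 1 = 1"
    using assms(6) by blast
  obtain B where B: "lie_algebra.maximal_semisimple_subalgebra scaleL bracket B" "coinv B" "B \<inter> R = {0}" "\<And>x. \<exists>b\<in>B. x - b \<in> R"
    by (rule coinvariant_levi[OF assms(4) subcomodule_coinv[OF assms(5)] t]) (rule that)
  have "x \<in> {b + r | b r. b \<in> B \<and> r \<in> R}" for x
  proof -
    obtain b where "b \<in> B" "x - b \<in> R" using B(4) by blast
    moreover have "x = b + (x - b)" by simp
    ultimately show ?thesis by blast
  qed
  then show ?thesis using B coinv_subcomodule assms(5) by blast
qed

end
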